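(* Let $f_1,f_2$ be entire functions, let $p,\sigma,\tilde p,\tilde\sigma\in L_2(0,\pi)$ be complex-valued, and consider the boundary value problems $L(p,\sigma)$ and $L(\tilde p,\tilde\sigma)$ with the same $f_1,f_2$. Let $\{\lambda_n\}_{n=1}^\infty$ and $\{\tilde\lambda_n\}_{n=1}^\infty$ be subspectra of $L(p,\sigma)$ and $L(\tilde p,\tilde\sigma)$, respectively. Suppose that the sequence $\{v_k\}_{k=0}^\infty$ constructed from $\{\lambda_n\}_{n=1}^\infty$ (and $f_1,f_2$) is complete in $\mathcal H$. If $\lambda_n=\tilde\lambda_n$ for all $n\ge 1$ and $\omega_0-\tilde\omega_0\in\mathbb Z$ (that is, $(\omega_0 \bmod 1)=(\tilde\omega_0\bmod 1)$), where $\omega_0=\frac1\pi\int_0^\pi p(s)\,ds$ and $\tilde\omega_0=\frac1\pi\int_0^\pi\tilde p(s)\,ds$, then $p=\tilde p$ and $\sigma=\tilde\sigma$ almost everywhere on $(0,\pi)$.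
   Context: All functions are complex-valued. The boundary value problem. For $p,\sigma\in L_2(0,\pi)$ and entire functions $f_1,f_2$, $L(p,\sigma)$ denotes the problem $$\ell y+2\lambda p(x)y=\lambda^2y,\quad x\in(0,\pi),\qquad \ell y:=-(y^{[1]})'-\sigma(x)y^{[1]}-\sigma^2(x)y,\qquad y^{[1]}:=y'-\sigma y,$$ $$y(0)=0,\qquad f_1(\lambda)y^{[1]}(\pi)+f_2(\lambda)y(\pi)=0,$$ where solutions satisfy $y,y^{[1]}\in AC[0,\pi]$ and $\ell y\in L_2(0,\pi)$. (This is the regularized form of $-y''+qy+2\lambda py=\lambda^2y$ with $q=\sigma'\in W_2^{-1}(0,\pi)$.) Let $S(x,\lambda)$ be the unique solution of the differential equation with $S(0,\lambda)=0$, $S^{[1]}(0,\lambda)=1$. The functions $S(\pi,\lambda)$, $S^{[1]}(\pi,\lambda)$ are entire in $\lambda$. The characteristic function of $L(p,\sigma)$ is $\Delta(\lambda)=f_1(\lambda)S^{[1]}(\pi,\lambda)+f_2(\lambda)S(\pi,\lambda)$; its zeros are the eigenvalues. Subspectrum. A sequence $\{\lambda_k\}_{k\ge1}$ of complex numbers is called a subspectrum of $L(p,\sigma)$ if $\Delta(\lambda_k)=0$ for all $k\ge 1$ and each value occurs in the sequence at most as many times as its multiplicity as a zero of $\Delta$. Index notation. Put $\lambda_0:=0$, $\mathbb S_\lambda=\{n\ge0:\lambda_n\ne\lambda_k\ \forall k,\ 0\le k<n\}$, $m_{\lambda,n}=\#\{k\ge0:\lambda_k=\lambda_n\}$. It is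 assumed throughout that equal values are consecutive: $\lambda_n=\lambda_{n+1}=\dots=\lambda_{n+m_{\lambda,n}-1}$ for $n\in\mathbb S_\lambda$. The sequence $\{v_k\}$. Let $\mathcal H=L_2(-\pi,\pi)\oplus L_2(-\pi,\pi)$ with scalar product $(g,h)_{\mathcal H}=\int_{-\pi}^\pi(\overline{g_1}h_1+\overline{g_2}h_2)\,dt$ for $g=[g_1,g_2]$, $h=[h_1,h_2]$. Denote $f^{<j>}(z)=\frac1{j!}\frac{d^j}{d\lambda^j}f(\lambda)\big|_{\lambda=z}$ (derivatives with respect to the spectral variable $\lambda$), and $$v(t,\lambda)=[\lambda f_1(\lambda)e^{i\lambda t},\ f_2(\lambda)e^{i\lambda t}],\quad t\in(-\pi,\pi).$$ For $n\in\mathbb S_\lambda$ and $0\le\nu\le m_{\lambda,n}-1$ put $v_{n+\nu}(t)=v^{<\nu>}(t,\lambda_n)$ if $n+\nu>0$, and $v_0(t)=[0,1]$. The index $n+\nu$ runs over all nonnegative integers. "Complete" means that the closed linear span is the whole space. *)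

theory Defs
  imports "HOL-Complex_Analysis.Complex_Analysis" "HOL-Library.Extended_Nat"
begin

definition L2_on :: "real \<Rightarrow> real \<Rightarrow> (real \<Rightarrow> complex) \<Rightarrow> bool" where
  "L2_on a b f \<longleftrightarrow>
     f \<in> borel_measurable (lebesgue_on {a<..<b}) \<and>
     integrable (lebesgue_on {a<..<b}) (\<lambda>x. (cmod (f x))\<^sup>2)"

text \<open>
  Absolute continuity on \<open>[a, b]\<close>; the pairs \<open>(u i, w i)\<close> are the end points of
  finitely many pairwise non-overlapping subintervals.
\<close>

definition abs_cont_on :: "real \<Rightarrow> real \<Rightarrow> (real \<Rightarrow> complex) \<Rightarrow> bool" where
  "abs_cont_on a b f \<longleftrightarrow>
     (\<forall>\<epsilon>>0. \<exists>\<delta>>0. \<forall>(N::nat) u w.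
        (\<forall>i<N. a \<le> u i \<and> u i \<le> w i \<and> w i \<le> b) \<and>
        (\<forall>i<N. \<forall>j<N. i \<noteq> j \<longrightarrow> {u i<..<w i} \<inter> {u j<..<w j} = {}) \<and>
        (\<Sum>i<N. w i - u i) < \<delta>
        \<longrightarrow> (\<Sum>i<N. cmod (f (w i) - f (u i))) < \<epsilon>)"

text \<open>
  The quasi-derivative \<open>y' - \<sigma> y\<close> and the expression \<open>\<ell> y\<close> are determined by \<open>y\<close> almost
  everywhere only. The argument \<open>y1\<close> below is the absolutely continuous representative of the
  quasi-derivative, so that its values at \<open>0\<close> and \<open>\<pi>\<close> make sense.
\<close>

definition is_quasi_deriv ::
    "(real \<Rightarrow> complex) \<Rightarrow> (real \<Rightarrow> complex) \<Rightarrow> (real \<Rightarrow> complex) \<Rightarrow> bool" where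
  "is_quasi_deriv \<sigma> y y1 \<longleftrightarrow>
     (AE x in lebesgue_on {0<..<pi}.
        y differentiable (at x) \<and> y1 x = vector_derivative y (at x) - \<sigma> x * y x)"

definition ell ::
    "(real \<Rightarrow> complex) \<Rightarrow> (real \<Rightarrow> complex) \<Rightarrow> (real \<Rightarrow> complex) \<Rightarrow> real \<Rightarrow> complex" where
  "ell \<sigma> y y1 x = - vector_derivative y1 (at x) - \<sigma> x * y1 x - (\<sigma> x)\<^sup>2 * y x"

definition is_solution ::
    "(real \<Rightarrow> complex) \<Rightarrow> (real \<Rightarrow> complex) \<Rightarrow> complex \<Rightarrow>
     (real \<Rightarrow> complex) \<Rightarrow> (real \<Rightarrow> complex) \<Rightarrow> bool" where
  "is_solution p \<sigma> z y y1 \<longleftrightarrow>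
     abs_cont_on 0 pi y \<and> abs_cont_on 0 pi y1 \<and> is_quasi_deriv \<sigma> y y1 \<and>
     L2_on 0 pi (ell \<sigma> y y1) \<and>
     (AE x in lebesgue_on {0<..<pi}.
        y1 differentiable (at x) \<and> ell \<sigma> y y1 x + 2 * z * p x * y x = z\<^sup>2 * y x)"

text \<open>
  \<open>S_sol p \<sigma> x z\<close> and \<open>S_quasi p \<sigma> x z\<close> are the values at \<open>x \<in> [0, \<pi>]\<close> of the solution with
  \<open>y 0 = 0\<close>, \<open>y1 0 = 1\<close> and of its quasi-derivative. The description is applied to the value and
  not to the function because solutions are unique only as functions on \<open>[0, \<pi>]\<close>.
\<close>

definition S_sol :: "(real \<Rightarrow> complex) \<Rightarrow> (real \<Rightarrow> complex) \<Rightarrow> real \<Rightarrow> complex \<Rightarrow> complex" where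
  "S_sol p \<sigma> x z =
     (THE c. \<exists>y y1. is_solution p \<sigma> z y y1 \<and> y 0 = 0 \<and> y1 0 = 1 \<and> c = y x)"

definition S_quasi :: "(real \<Rightarrow> complex) \<Rightarrow> (real \<Rightarrow> complex) \<Rightarrow> real \<Rightarrow> complex \<Rightarrow> complex" where
  "S_quasi p \<sigma> x z =
     (THE c. \<exists>y y1. is_solution p \<sigma> z y y1 \<and> y 0 = 0 \<and> y1 0 = 1 \<and> c = y1 x)"

definition char_fun ::
    "(complex \<Rightarrow> complex) \<Rightarrow> (complex \<Rightarrow> complex) \<Rightarrow>
     (real \<Rightarrow> complex) \<Rightarrow> (real \<Rightarrow> complex) \<Rightarrow> complex \<Rightarrow> complex" where
  "char_fun f1 f2 p \<sigma> z = f1 z * S_quasi p \<sigma> pi z + f2 z * S_sol p \<sigma> pi z"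

text \<open>
  Multiplicity of a zero of an entire function. The characteristic function may vanish
  identically, in which case every point is a zero of infinite multiplicity.
\<close>

definition zero_mult :: "(complex \<Rightarrow> complex) \<Rightarrow> complex \<Rightarrow> enat" where
  "zero_mult f z = (if \<forall>w. f w = 0 then \<infinity> else enat (nat (zorder f z)))"

definition ecard :: "'a set \<Rightarrow> enat" where
  "ecard A = (if finite A then enat (card A) else \<infinity>)"

text \<open>
  A sequence indexed from \<open>1\<close> is a function on \<open>nat\<close> whose value at \<open>0\<close> is the conventional
  additional entry; that entry plays no role in the notion of a subspectrum.
\<close>

definition subspectrum ::
    "(complex \<Rightarrow> complex) \<Rightarrow> (complex \<Rightarrow> complex) \<Rightarrow>
     (real \<Rightarrow> complex) \<Rightarrow> (real \<Rightarrow> complex) \<Rightarrow> (nat \<Rightarrow> complex) \<Rightarrow> bool" where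
  "subspectrum f1 f2 p \<sigma> lam \<longleftrightarrow>
     (\<forall>k\<ge>1. char_fun f1 f2 p \<sigma> (lam k) = 0 \<and>
        ecard {j. 1 \<le> j \<and> lam j = lam k} \<le> zero_mult (char_fun f1 f2 p \<sigma>) (lam k))"

definition first_indices :: "(nat \<Rightarrow> complex) \<Rightarrow> nat set" where
  "first_indices lam = {n. \<forall>k<n. lam n \<noteq> lam k}"

definition occurrences :: "(nat \<Rightarrow> complex) \<Rightarrow> nat \<Rightarrow> enat" where
  "occurrences lam n = ecard {k. lam k = lam n}"

definition equal_values_consecutive :: "(nat \<Rightarrow> complex) \<Rightarrow> bool" where
  "equal_values_consecutive lam \<longleftrightarrow>
     (\<forall>n\<in>first_indices lam. \<forall>\<nu>. enat \<nu> < occurrences lam n \<longrightarrow> lam (n + \<nu>) = lam n)"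

definition taylor_coeff :: "(complex \<Rightarrow> complex) \<Rightarrow> nat \<Rightarrow> complex \<Rightarrow> complex" where
  "taylor_coeff f j z = (deriv ^^ j) f z / fact j"

definition v_fun ::
    "(complex \<Rightarrow> complex) \<Rightarrow> (complex \<Rightarrow> complex) \<Rightarrow> real \<Rightarrow> complex \<Rightarrow> complex \<times> complex" where
  "v_fun f1 f2 t z = (z * f1 z * exp (\<i> * z * of_real t), f2 z * exp (\<i> * z * of_real t))"

definition v_coeff ::
    "(complex \<Rightarrow> complex) \<Rightarrow> (complex \<Rightarrow> complex) \<Rightarrow> nat \<Rightarrow> complex \<Rightarrow> real \<Rightarrow> complex \<times> complex" where
  "v_coeff f1 f2 j z t =
     (taylor_coeff (\<lambda>w. fst (v_fun f1 f2 t w)) j z, taylor_coeff (\<lambda>w. snd (v_fun f1 f2 t w)) j z)"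

text \<open>
  The index \<open>k\<close> is decomposed as \<open>k = n + \<nu>\<close> with \<open>n\<close> the first index at which the value
  \<open>lam k\<close> occurs. The two lemmas below show that this is the indexing by pairs
  \<open>n \<in> first_indices lam\<close>, \<open>\<nu> < occurrences lam n\<close>.
\<close>

definition v_seq ::
    "(complex \<Rightarrow> complex) \<Rightarrow> (complex \<Rightarrow> complex) \<Rightarrow> (nat \<Rightarrow> complex) \<Rightarrow>
     nat \<Rightarrow> real \<Rightarrow> complex \<times> complex" where
  "v_seq f1 f2 lam k =
     (if k = 0 then (\<lambda>t. (0, 1))
      else let n = (LEAST n. lam n = lam k) in v_coeff f1 f2 (k - n) (lam n))"

lemma v_seq_eq:
  assumes "equal_values_consecutive lam" and n: "n \<in> first_indices lam"
    and "enat \<nu> < occurrences lam n" and "n + \<nu> > 0"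
  shows "v_seq f1 f2 lam (n + \<nu>) = v_coeff f1 f2 \<nu> (lam n)"
proof -
  have eq: "lam (n + \<nu>) = lam n"
    using assms unfolding equal_values_consecutive_def by blast
  have *: "(LEAST m. lam m = lam (n + \<nu>)) = n"
  proof (rule Least_equality)
    show "lam n = lam (n + \<nu>)" using eq by simp
    show "n \<le> m" if "lam m = lam (n + \<nu>)" for m
    proof (rule ccontr)
      assume "\<not> n \<le> m"
      then have "lam n \<noteq> lam m" using n by (simp add: first_indices_def)
      then show False using that eq by simp
    qed
  qed
  have "n + \<nu> \<noteq> 0" using assms(4) by simp
  then show ?thesis unfolding v_seq_def Let_def * by (simp only: if_False add_diff_cancel_left')
qed

lemma index_decomposition:
  assumes "equal_values_consecutive lam"
  shows "\<exists>!(n, \<nu>). n \<in> first_indices lam \<and> enat \<nu> < occurrences lam n \<and> k = n + \<nu>"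
proof -
  define n where "n = (LEAST n. lam n = lam k)"
  have n_eq: "lam n = lam k" unfolding n_def by (rule LeastI) simp
  have n_le: "n \<le> m" if "lam m = lam k" for m unfolding n_def using that by (rule Least_le)
  have nF: "n \<in> first_indices lam"
    unfolding first_indices_def
  proof (intro CollectI allI impI)
    fix m assume "m < n"
    then show "lam n \<noteq> lam m" using n_le[of m] n_eq by auto
  qed
  have uniq: "n' = n" if "n' \<in> first_indices lam" "lam n' = lam k" for n'
  proof (rule ccontr)
    assume "n' \<noteq> n"
    then have "n < n'" using n_le[OF that(2)] by simp
    then have "lam n' \<noteq> lam n" using that(1) by (simp add: first_indices_def)
    then show False using that(2) n_eq by simp
  qed
  have lt: "enat (k - n) < occurrences lam n"
  proof (rule ccontr)
    assume neg: "\<not> enat (k - n) < occurrences lam n"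
    let ?A = "{j. lam j = lam n}"
    have fin: "finite ?A" and le: "card ?A \<le> k - n"
      using neg by (auto simp: occurrences_def ecard_def split: if_splits)
    have sub: "{n..<n + card ?A} \<subseteq> ?A"
    proof
      fix j assume j: "j \<in> {n..<n + card ?A}"
      have "enat (j - n) < occurrences lam n"
        using j fin by (simp add: occurrences_def ecard_def, linarith)
      then have "lam (n + (j - n)) = lam n"
        using assms nF unfolding equal_values_consecutive_def by blast
      then show "j \<in> ?A" using j by simp
    qed
    have "k \<notin> {n..<n + card ?A}" using le n_le[of k] by auto
    moreover have "k \<in> ?A" using n_eq by simp
    ultimately have "insert k {n..<n + card ?A} \<subseteq> ?A"
      and "card (insert k {n..<n + card ?A}) = Suc (card ?A)" using sub by auto
    then have "Suc (card ?A) \<le> card ?A" using card_mono[OF fin] by metis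
    then show False by simp
  qed
  have k_eq: "k = n + (k - n)" using n_le[of k] by simp
  have k_uniq: "n' = n \<and> \<nu> = k - n"
    if "n' \<in> first_indices lam" "enat \<nu> < occurrences lam n'" "k = n' + \<nu>" for n' \<nu>
  proof -
    have "lam k = lam n'" using that assms unfolding equal_values_consecutive_def by blast
    then have "n' = n" using uniq that by simp
    then show ?thesis using that by simp
  qed
  show ?thesis
  proof (rule ex1I[of _ "(n, k - n)"])
    show "case (n, k - n) of
        (n, \<nu>) \<Rightarrow> n \<in> first_indices lam \<and> enat \<nu> < occurrences lam n \<and> k = n + \<nu>"
      unfolding prod.case using nF lt k_eq by blast
  next
    fix r assume "case r of
        (n, \<nu>) \<Rightarrow> n \<in> first_indices lam \<and> enat \<nu> < occurrences lam n \<and> k = n + \<nu>"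
    then show "r = (n, k - n)" using k_uniq by (cases r) blast
  qed
qed

text \<open>
  Elements of \<open>L\<^sub>2(-\<pi>, \<pi>) \<oplus> L\<^sub>2(-\<pi>, \<pi>)\<close> are represented by pair-valued functions.
\<close>

definition in_H :: "(real \<Rightarrow> complex \<times> complex) \<Rightarrow> bool" where
  "in_H g \<longleftrightarrow> L2_on (-pi) pi (\<lambda>t. fst (g t)) \<and> L2_on (-pi) pi (\<lambda>t. snd (g t))"

definition inner_H :: "(real \<Rightarrow> complex \<times> complex) \<Rightarrow> (real \<Rightarrow> complex \<times> complex) \<Rightarrow> complex" where
  "inner_H g h = (LINT t|lebesgue_on {-pi<..<pi}.
     cnj (fst (g t)) * fst (h t) + cnj (snd (g t)) * snd (h t))"

definition norm_H :: "(real \<Rightarrow> complex \<times> complex) \<Rightarrow> real" where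
  "norm_H g = sqrt (Re (inner_H g g))"

definition lin_comb ::
    "(nat \<Rightarrow> complex) \<Rightarrow> nat \<Rightarrow> (nat \<Rightarrow> real \<Rightarrow> complex \<times> complex) \<Rightarrow> real \<Rightarrow> complex \<times> complex" where
  "lin_comb c N v t = (\<Sum>k<N. c k * fst (v k t), \<Sum>k<N. c k * snd (v k t))"

definition complete_in_H :: "(nat \<Rightarrow> real \<Rightarrow> complex \<times> complex) \<Rightarrow> bool" where
  "complete_in_H v \<longleftrightarrow>
     (\<forall>k. in_H (v k)) \<and>
     (\<forall>g. in_H g \<longrightarrow> (\<forall>\<epsilon>>0. \<exists>c N. norm_H (\<lambda>t. g t - lin_comb c N v t) < \<epsilon>))"

definition omega0 :: "(real \<Rightarrow> complex) \<Rightarrow> complex" where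
  "omega0 p = of_real (1 / pi) * (LINT s|lebesgue_on {0<..<pi}. p s)"

end

theory Submission
  imports Defs
begin

text \<open>
  Let \<open>y = S(x, z)\<close> with quasi-derivative \<open>y1\<close>, and let \<open>\<theta>(x)\<close> be the integral of \<open>p\<close> over \<open>(0, x)\<close>; a
  suffix \<open>t\<close> refers to the second problem. Then \<open>y1 - cos (z x - \<theta>)\<close> and \<open>z y - sin (z x - \<theta>)\<close> are
  Fourier transforms of functions in \<open>L\<^sub>2(-x, x)\<close>. Since \<open>(\<theta>(\<pi>) - \<theta>t(\<pi>)) / \<pi>\<close> is an integer \<open>k\<close>,
  the trigonometric parts of the two problems agree at \<open>\<pi>\<close> up to the sign \<open>c = (-1)\<^sup>k\<close>, so
  \<open>D1 = y1 - c y1t\<close> and \<open>D2 = z (y - c yt)\<close> at \<open>\<pi>\<close> define a bounded functional on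
  \<open>L\<^sub>2(-\<pi>, \<pi>) \<oplus> L\<^sub>2(-\<pi>, \<pi>)\<close>. The common subspectrum says that it annihilates all \<open>v\<^sub>k\<close>; by
  completeness \<open>D1 = D2 = 0\<close>.

  The Wronskian of the two solutions then vanishes at \<open>0\<close> and \<open>\<pi>\<close>, hence its derivative, a combination of
  \<open>(\<sigma>t - \<sigma>) (y yt)'\<close> and \<open>2 z (p - pt) y yt\<close>, has integral \<open>0\<close> for every \<open>z\<close>. Inserting the
  representations of the solutions turns this into a homogeneous Volterra equation, in weak form, for the
  pair \<open>\<sigma>t - \<sigma>\<close>, \<open>p - pt\<close>.

  No kernel is constructed: being the Fourier transform of an \<open>L\<^sub>2\<close> function is expressed by an inequality
  for finite sums of exponentials. The exponentials are dense in \<open>L\<^sub>2(-\<pi>, \<pi>)\<close> because the \<open>v\<^sub>k\<close>, whose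
  components are limits of exponential sums, are complete.
\<close>

section \<open>Absolutely continuous functions\<close>

text \<open>The obstacle is low regularity: \<open>\<sigma>\<close> is only square integrable, so
  \<open>\<sigma>\<^sup>2\<close> is only integrable. A sum of exponentials is controlled only in L2
  along a characteristic line, hence an L1 coefficient must not multiply one. The solution
  \<open>y\<close> without the factor \<open>z\<close> has no leading exponential; it is carried as
  a third unknown that absorbs \<open>\<sigma>\<^sup>2\<close>. The Wronskian is multiplied by
  \<open>z\<close>, because the boundary relation concerns \<open>z y\<close> and because
  \<open>y1\<close> and \<open>z y\<close> have trigonometric leading parts. Their products
  oscillate like \<open>exp (2 i z x)\<close>, up to one non-oscillating term whose integral
  vanishes because the same \<open>c\<close> serves \<open>exp (i \<theta>)\<close> and
  \<open>exp (- i \<theta>)\<close> at \<open>\<pi>\<close>. What remains at \<open>x\<close> is a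
  transform of a function on \<open>(-2x, 2x)\<close>; at half frequencies it sees the test function
  on \<open>(-x, x)\<close> only. This is the Volterra structure: a test function vanishing on
  \<open>(-a, a)\<close> feels no remainder from \<open>[0, a]\<close>. The extra vector
  \<open>v\<^sub>0 = [0, 1]\<close> fits because \<open>D2\<close> carries the factor
  \<open>z\<close> and so vanishes at \<open>0\<close>.\<close>

definition small_increments :: "real \<Rightarrow> real \<Rightarrow> (real \<Rightarrow> complex) \<Rightarrow> real \<Rightarrow> real \<Rightarrow> bool" where
  "small_increments a b F \<delta> \<epsilon> \<longleftrightarrow> (\<forall>(N::nat) u w.
        (\<forall>i<N. a \<le> u i \<and> u i \<le> w i \<and> w i \<le> b) \<and>
        (\<forall>i<N. \<forall>j<N. i \<noteq> j \<longrightarrow> {u i<..<w i} \<inter> {u j<..<w j} = {}) \<and>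
        (\<Sum>i<N. w i - u i) < \<delta>
        \<longrightarrow> (\<Sum>i<N. cmod (F (w i) - F (u i))) < \<epsilon>)"

lemma abs_cont_on_iff:
  "abs_cont_on a b F \<longleftrightarrow> (\<forall>\<epsilon>>0. \<exists>\<delta>>0. small_increments a b F \<delta> \<epsilon>)"
  unfolding abs_cont_on_def small_increments_def ..

lemma small_incrementsD:
  fixes N :: nat
  assumes "small_increments a b F \<delta> \<epsilon>"
    and "\<And>i. i < N \<Longrightarrow> a \<le> u i \<and> u i \<le> w i \<and> w i \<le> b"
    and "\<And>i j. i < N \<Longrightarrow> j < N \<Longrightarrow> i \<noteq> j \<Longrightarrow> {u i<..<w i} \<inter> {u j<..<w j} = {}"
    and "(\<Sum>i<N. w i - u i) < \<delta>"
  shows "(\<Sum>i<N. cmod (F (w i) - F (u i))) < \<epsilon>"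
  using assms(1)[unfolded small_increments_def, THEN spec, THEN spec, THEN spec, of N u w, THEN mp]
    assms(2-) by simp

text \<open>The subintervals of a tagged division are indexed by the pairs of the division itself,
  not by an initial segment of the naturals.\<close>

lemma small_increments_finite:
  fixes S :: "'i set"
  assumes "small_increments a b F \<delta> \<epsilon>" and "finite S"
    and uw: "\<And>i. i \<in> S \<Longrightarrow> a \<le> u i \<and> u i \<le> w i \<and> w i \<le> b"
    and disj: "\<And>i j. i \<in> S \<Longrightarrow> j \<in> S \<Longrightarrow> i \<noteq> j \<Longrightarrow> {u i<..<w i} \<inter> {u j<..<w j} = {}"
    and "(\<Sum>i\<in>S. w i - u i) < \<delta>"
  shows "(\<Sum>i\<in>S. cmod (F (w i) - F (u i))) < \<epsilon>"
proof -
  obtain h where "bij_betw h {0..<card S} S"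
    using \<open>finite S\<close> ex_bij_betw_nat_finite by blast
  then have h: "bij_betw h {..<card S} S" by (simp add: atLeast0LessThan)
  have hS: "h i \<in> S" if "i < card S" for i using h that by (auto simp: bij_betw_def)
  have hi: "h i \<noteq> h j" if "i < card S" "j < card S" "i \<noteq> j" for i j
    using h that by (auto simp: bij_betw_def inj_on_def)
  have s1: "(\<Sum>i\<in>S. w i - u i) = (\<Sum>i<card S. w (h i) - u (h i))"
    using sum.reindex_bij_betw[OF h, of "\<lambda>i. w i - u i"] by simp
  have s2: "(\<Sum>i\<in>S. cmod (F (w i) - F (u i))) = (\<Sum>i<card S. cmod (F (w (h i)) - F (u (h i))))"
    using sum.reindex_bij_betw[OF h, of "\<lambda>i. cmod (F (w i) - F (u i))"] by simp
  show ?thesis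
    unfolding s2
    by (rule small_incrementsD[OF assms(1)]) (use assms hS hi s1 in auto)
qed

lemma abs_cont_on_continuous:
  assumes "abs_cont_on a b F"
  shows "continuous_on {a..b} F"
  unfolding continuous_on_iff dist_norm
proof (intro ballI allI impI)
  fix x and e :: real assume x: "x \<in> {a..b}" and "e > 0"
  then obtain \<delta> where d: "\<delta> > 0" "small_increments a b F \<delta> e"
    using assms unfolding abs_cont_on_iff by blast
  show "\<exists>d>0. \<forall>x'\<in>{a..b}. norm (x' - x) < d \<longrightarrow> norm (F x' - F x) < e"
  proof (intro exI conjI ballI impI)
    fix x' assume x': "x' \<in> {a..b}" "norm (x' - x) < \<delta>"
    show "norm (F x' - F x) < e"
    proof (cases "x \<le> x'")
      case True
      then show ?thesis
        using small_incrementsD[OF d(2), of 1 "\<lambda>_. x" "\<lambda>_. x'"] x x' by auto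
    next
      case False
      then show ?thesis
        using small_incrementsD[OF d(2), of 1 "\<lambda>_. x'" "\<lambda>_. x"] x x'
        by (auto simp: norm_minus_commute)
    qed
  qed (rule d)
qed

lemma abs_cont_on_subset:
  assumes "abs_cont_on a b F" "a \<le> a'" "b' \<le> b"
  shows "abs_cont_on a' b' F"
  unfolding abs_cont_on_iff
proof (intro allI impI)
  fix e :: real assume "e > 0"
  then obtain d where d: "d > 0" "small_increments a b F d e"
    using assms unfolding abs_cont_on_iff by blast
  have "small_increments a' b' F d e"
    unfolding small_increments_def
  proof (intro allI impI)
    fix N :: nat and u w :: "nat \<Rightarrow> real"
    assume U: "(\<forall>i<N. a' \<le> u i \<and> u i \<le> w i \<and> w i \<le> b') \<and>
        (\<forall>i<N. \<forall>j<N. i \<noteq> j \<longrightarrow> {u i<..<w i} \<inter> {u j<..<w j} = {}) \<and>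
        (\<Sum>i<N. w i - u i) < d"
    show "(\<Sum>i<N. cmod (F (w i) - F (u i))) < e"
    proof (rule small_incrementsD[OF d(2)])
      fix i assume "i < N"
      then have "a' \<le> u i \<and> u i \<le> w i \<and> w i \<le> b'" using U by blast
      then show "a \<le> u i \<and> u i \<le> w i \<and> w i \<le> b" using assms by linarith
    qed (use U in blast)+
  qed
  then show "\<exists>\<delta>>0. small_increments a' b' F \<delta> e" using d by blast
qed

text \<open>One criterion serves sums, products, exponentials and, through the term with
  \<open>L\<close>, Lipschitz functions.\<close>

lemma abs_cont_on_dominated:
  assumes F: "abs_cont_on a b F" and G: "abs_cont_on a b G"
    and "A \<ge> 0" "B \<ge> 0" "L \<ge> 0"
    and dom: "\<And>u w. a \<le> u \<Longrightarrow> u \<le> w \<Longrightarrow> w \<le> b \<Longrightarrow>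
      cmod (H w - H u) \<le> A * cmod (F w - F u) + B * cmod (G w - G u) + L * (w - u)"
  shows "abs_cont_on a b H"
  unfolding abs_cont_on_iff
proof (intro allI impI)
  fix e :: real assume e: "e > 0"
  \<comment> \<open>A third of \<open>e\<close> goes to each of the three terms; the added
    \<open>1\<close> keeps the quotient meaningful when a constant is \<open>0\<close>.\<close>
  define e1 where "e1 = e / (3 * (A + 1))"
  define e2 where "e2 = e / (3 * (B + 1))"
  have e1: "e1 > 0" "A * e1 < e/3" using e assms(3) unfolding e1_def by (auto simp: field_simps)
  have e2: "e2 > 0" "B * e2 < e/3" using e assms(4) unfolding e2_def by (auto simp: field_simps)
  obtain d1 where d1: "d1 > 0" "small_increments a b F d1 e1"
    using F e1(1) unfolding abs_cont_on_iff by blast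
  obtain d2 where d2: "d2 > 0" "small_increments a b G d2 e2"
    using G e2(1) unfolding abs_cont_on_iff by blast
  define d where "d = min d1 (min d2 (e / (3 * (L + 1))))"
  have d: "d > 0" using d1 d2 e assms(5) by (auto simp: d_def)
  have "small_increments a b H d e"
    unfolding small_increments_def
  proof (intro allI impI)
    fix N :: nat and u w :: "nat \<Rightarrow> real"
    assume U: "(\<forall>i<N. a \<le> u i \<and> u i \<le> w i \<and> w i \<le> b) \<and>
        (\<forall>i<N. \<forall>j<N. i \<noteq> j \<longrightarrow> {u i<..<w i} \<inter> {u j<..<w j} = {}) \<and>
        (\<Sum>i<N. w i - u i) < d"
    have U1: "a \<le> u i \<and> u i \<le> w i \<and> w i \<le> b" if "i < N" for i using U that by blast
    have U2: "{u i<..<w i} \<inter> {u j<..<w j} = {}" if "i < N" "j < N" "i \<noteq> j" for i j using U that by blast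
    have U3: "(\<Sum>i<N. w i - u i) < d1" "(\<Sum>i<N. w i - u i) < d2" "(\<Sum>i<N. w i - u i) < e / (3 * (L + 1))"
      using U by (auto simp: d_def)
    have "(\<Sum>i<N. cmod (H (w i) - H (u i))) \<le>
       (\<Sum>i<N. A * cmod (F (w i) - F (u i)) + B * cmod (G (w i) - G (u i)) + L * (w i - u i))"
      by (intro sum_mono dom) (use U1 in auto)
    also have "\<dots> = A * (\<Sum>i<N. cmod (F (w i) - F (u i))) + B * (\<Sum>i<N. cmod (G (w i) - G (u i)))
        + L * (\<Sum>i<N. w i - u i)"
      by (simp add: sum.distrib sum_distrib_left)
    also have "\<dots> \<le> A * e1 + B * e2 + L * (e / (3 * (L + 1)))"
    proof -
      have "(\<Sum>i<N. cmod (F (w i) - F (u i))) \<le> e1"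
        by (rule less_imp_le, rule small_incrementsD[OF d1(2) U1 U2 U3(1)])
      moreover have "(\<Sum>i<N. cmod (G (w i) - G (u i))) \<le> e2"
        by (rule less_imp_le, rule small_incrementsD[OF d2(2) U1 U2 U3(2)])
      ultimately show ?thesis
        by (intro add_mono mult_left_mono) (use assms U3 in auto)
    qed
    also have "\<dots> < e"
    proof -
      have "L * (e / (3 * (L + 1))) \<le> e / 3" using e assms(5) by (auto simp: field_simps)
      then show ?thesis using e1 e2 by linarith
    qed
    finally show "(\<Sum>i<N. cmod (H (w i) - H (u i))) < e" .
  qed
  then show "\<exists>\<delta>>0. small_increments a b H \<delta> e" using d by blast
qed

lemma abs_cont_on_const: "abs_cont_on a b (\<lambda>_. c)"
  unfolding abs_cont_on_iff small_increments_def by (auto intro: exI[of _ 1])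

text \<open>The derivative is prescribed off a null set, so \<open>f\<close> can be any
  representative, for instance an expression in \<open>\<sigma>\<close>. Integrability of
  \<open>f\<close> comes out as a conclusion in \<open>ac_deriv_has_integral\<close>.\<close>

definition ac_deriv :: "real \<Rightarrow> real \<Rightarrow> (real \<Rightarrow> complex) \<Rightarrow> (real \<Rightarrow> complex) \<Rightarrow> bool" where
  "ac_deriv a b F f \<longleftrightarrow> abs_cont_on a b F \<and>
     (\<exists>N. negligible N \<and> (\<forall>x\<in>{a<..<b} - N. (F has_vector_derivative f x) (at x)))"

text \<open>The points of the exceptional null set are handled by a gauge that confines their
  subintervals to an open set of small measure, where absolute continuity applies.\<close>

theorem ac_deriv_has_integral:
  assumes F: "ac_deriv a b F f" and "a \<le> b"
  shows "(f has_integral (F b - F a)) {a..b}"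
proof -
  obtain N where N: "negligible N" and der: "\<And>x. x \<in> {a<..<b} - N \<Longrightarrow> (F has_vector_derivative f x) (at x)"
    using F unfolding ac_deriv_def by blast
  \<comment> \<open>The endpoints join the exceptional set because the derivative is known only
    inside the interval.\<close>
  define N' where "N' = N \<union> {a, b}"
  have N': "negligible N'" unfolding N'_def using N by (simp add: negligible_Un negligible_finite)
  \<comment> \<open>With the value \<open>0\<close> on the null set, the cells tagged there
    contribute only increments of \<open>F\<close>, whose total absolute continuity makes
    small.\<close>
  define g where "g = (\<lambda>x. if x \<in> N' then 0 else f x)"
  have "(g has_integral (F b - F a)) (cbox a b)"
    unfolding has_integral
  proof (intro allI impI)
    fix e :: real assume e: "e > 0"
    define \<eta> where "\<eta> = e / (2 * (b - a + 1))"
    have \<eta>: "\<eta> > 0" "\<eta> * (b - a) < e / 2" using e \<open>a \<le> b\<close> unfolding \<eta>_def by (auto simp: field_simps)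
    obtain \<delta> where d: "\<delta> > 0" and AC: "small_increments a b F \<delta> (e / 2)"
      using F e unfolding ac_deriv_def abs_cont_on_iff by (meson half_gt_zero)
    have N'0: "N' \<in> null_sets lebesgue" using N' by (simp add: negligible_iff_null_sets)
    then obtain T where T: "open T" "N' \<subseteq> T" "(T - N') \<in> lmeasurable" "emeasure lebesgue (T - N') < ennreal \<delta>"
      using sets_lebesgue_outer_open[of N' \<delta>] d by (metis null_setsD2)
    have Tm: "T \<in> lmeasurable"
    proof -
      have "T = (T - N') \<union> N'" using T by auto
      then show ?thesis using T(3) N' negligible_imp_measurable fmeasurable.Un by metis
    qed
    have "measure lebesgue T = measure lebesgue (T - N')"
      using N'0 by (simp add: measure_Diff_null_set Tm fmeasurableD)
    then have mT: "measure lebesgue T < \<delta>"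
      using T(3,4) d by (simp add: emeasure_eq_measure2 ennreal_less_iff)
    have "\<exists>r>0. x \<in> {a<..<b} - N' \<longrightarrow> (\<forall>y. norm (y-x) < r \<longrightarrow> norm (F y - F x - (y-x) *\<^sub>R f x) \<le> \<eta> * norm (y-x))" for x
    proof (cases "x \<in> {a<..<b} - N'")
      case True
      then have "(F has_vector_derivative f x) (at x)" using der by (auto simp: N'_def)
      then show ?thesis using \<eta>(1) unfolding has_vector_derivative_def has_derivative_at_alt by blast
    qed (auto intro: exI[of _ 1])
    then obtain r where r: "\<And>x. r x > 0"
      "\<And>x y. x \<in> {a<..<b} - N' \<Longrightarrow> norm (y-x) < r x \<Longrightarrow> norm (F y - F x - (y-x) *\<^sub>R f x) \<le> \<eta> * norm (y-x)"
      by metis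
    define \<gamma> where "\<gamma> = (\<lambda>x. if x \<in> N' then T else ball x (r x))"
    show "\<exists>\<gamma>. gauge \<gamma> \<and> (\<forall>\<D>. \<D> tagged_division_of cbox a b \<and> \<gamma> fine \<D> \<longrightarrow>
             norm ((\<Sum>(x, k)\<in>\<D>. measure lborel k *\<^sub>R g x) - (F b - F a)) < e)"
    proof (intro exI conjI allI impI)
      show "gauge \<gamma>" unfolding gauge_def \<gamma>_def using T r(1) by auto
      fix p assume p: "p tagged_division_of cbox a b \<and> \<gamma> fine p"
      then have ptag: "p tagged_division_of cbox a b" and fine: "\<gamma> fine p" by auto
      have fin: "finite p" using ptag by blast
      have sumF: "F b - F a = (\<Sum>(x,K)\<in>p. F (Sup K) - F (Inf K))"
        using additive_tagged_division_1[where f=F] \<open>a \<le> b\<close> ptag by auto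
      have ba: "b - a = (\<Sum>(x,K)\<in>p. Sup K - Inf K)"
        using additive_tagged_division_1[where f="\<lambda>x. x"] \<open>a \<le> b\<close> ptag by auto
      have Kform: "\<exists>u v. K = {u..v} \<and> u \<le> v \<and> a \<le> u \<and> v \<le> b \<and> x \<in> {u..v} \<and> Sup K = v \<and> Inf K = u" if "(x,K) \<in> p" for x K
      proof -
        have "x \<in> K" "K \<subseteq> cbox a b" "\<exists>u v. K = cbox u v" using ptag that by blast+
        then obtain u v where "K = {u..v}" "u \<le> v" "a \<le> u" "v \<le> b" "x \<in> {u..v}" by auto
        then show ?thesis by auto
      qed
      define q where "q = {xK \<in> p. fst xK \<in> N'}"
      have q: "q \<subseteq> p" by (auto simp: q_def)
      have finq: "finite q" using fin q finite_subset by blast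
      have smallq: "(\<Sum>xK\<in>q. cmod (F (Sup (snd xK)) - F (Inf (snd xK)))) < e / 2"
      proof (rule small_increments_finite[OF AC])
        show "finite q" by (rule finq)
        fix i assume i: "i \<in> q"
        then have ip: "(fst i, snd i) \<in> p" using q by auto
        show "a \<le> Inf (snd i) \<and> Inf (snd i) \<le> Sup (snd i) \<and> Sup (snd i) \<le> b"
          using Kform[OF ip] by auto
        fix j assume j: "j \<in> q" "i \<noteq> j"
        then have jp: "(fst j, snd j) \<in> p" using q by auto
        obtain u v where uv: "snd i = {u..v}" "Sup (snd i) = v" "Inf (snd i) = u" using Kform[OF ip] by auto
        obtain u' v' where uv': "snd j = {u'..v'}" "Sup (snd j) = v'" "Inf (snd j) = u'" using Kform[OF jp] by auto
        have "interior (snd i) \<inter> interior (snd j) = {}"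
          using tagged_division_ofD(5)[OF ptag ip jp] j(2) by (metis prod.collapse)
        then show "{Inf (snd i)<..<Sup (snd i)} \<inter> {Inf (snd j)<..<Sup (snd j)} = {}"
          using uv uv' by (simp add: interior_atLeastAtMost_real)
      next
        have "(\<Sum>xK\<in>q. Sup (snd xK) - Inf (snd xK)) = (\<Sum>(x,K)\<in>q. measure lborel K)"
        proof (rule sum.cong)
          fix xK assume "xK \<in> q"
          then have "(fst xK, snd xK) \<in> p" using q by auto
          from Kform[OF this] obtain u v where "snd xK = {u..v}" "u \<le> v" "Sup (snd xK) = v" "Inf (snd xK) = u"
            by auto
          then show "Sup (snd xK) - Inf (snd xK) = (case xK of (x, K) \<Rightarrow> measure lborel K)"
            by (simp add: case_prod_beta del: cbox_interval)
        qed simp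
        also have "\<dots> = (\<Sum>K\<in>snd ` q. measure lborel K)"
        proof -
          have "q tagged_partial_division_of cbox a b"
            using ptag q tagged_partial_division_subset tagged_division_of_def by blast
          then have "q tagged_division_of \<Union>(snd ` q)"
            by (rule tagged_partial_division_of_Union_self)
          then show ?thesis
            by (rule sum.over_tagged_division_lemma) (simp add: content_eq_0_interior)
        qed
        also have "\<dots> = measure lebesgue (\<Union>(snd ` q))"
        proof -
          have "q tagged_partial_division_of cbox a b"
            using ptag q tagged_partial_division_subset tagged_division_of_def by blast
          then have div: "snd ` q division_of \<Union>(snd ` q)" by (rule partial_division_of_tagged_division)
          have "measure lborel K = measure lebesgue K" if K: "K \<in> snd ` q" for K
          proof -
            obtain x where "(x, K) \<in> p" using K q by force
            from Kform[OF this] obtain u v where "K = cbox u v" by auto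
            then show ?thesis by (simp add: measure_completion del: cbox_interval)
          qed
          then show ?thesis using content_division[OF div] by simp
        qed
        also have "\<dots> \<le> measure lebesgue T"
        proof (rule measure_mono_fmeasurable)
          show "\<Union>(snd ` q) \<subseteq> T"
          proof
            fix y assume "y \<in> \<Union>(snd ` q)"
            then obtain x K where xK: "(x,K) \<in> q" "y \<in> K" by auto
            then have "K \<subseteq> \<gamma> x" "x \<in> N'" using fine q by (auto simp: q_def)
            then show "y \<in> T" using xK by (auto simp: \<gamma>_def)
          qed
          have "snd xK \<in> sets lebesgue" if "xK \<in> q" for xK
          proof -
            have "(fst xK, snd xK) \<in> p" using that q by auto
            from Kform[OF this] obtain u v where "snd xK = cbox u v" by auto
            then show ?thesis by (simp del: cbox_interval)
          qed
          then show "\<Union>(snd ` q) \<in> sets lebesgue" using finq by auto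
        qed (rule Tm)
        finally show "(\<Sum>xK\<in>q. Sup (snd xK) - Inf (snd xK)) < \<delta>" using mT by linarith
      qed
      have small: "norm ((\<Sum>(x,K)\<in>p - q. measure lborel K *\<^sub>R g x - (F (Sup K) - F (Inf K)))) \<le> \<eta> * (b - a)"
      proof -
        have "norm ((\<Sum>(x,K)\<in>p - q. measure lborel K *\<^sub>R g x - (F (Sup K) - F (Inf K)))) \<le>
           (\<Sum>xK\<in>p - q. \<eta> * (case xK of (x, K) \<Rightarrow> Sup K - Inf K))"
        proof (rule sum_norm_le, safe)
          fix x K assume xK: "(x, K) \<in> p" "(x,K) \<notin> q"
          obtain u v where uv: "K = {u..v}" "u \<le> v" "a \<le> u" "v \<le> b" "x \<in> {u..v}" "Sup K = v" "Inf K = u"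
            using Kform[OF xK(1)] by auto
          have xN: "x \<notin> N'" using xK by (auto simp: q_def)
          then have xab: "x \<in> {a<..<b} - N'" using uv by (force simp: N'_def)
          have "K \<subseteq> ball x (r x)" using fineD[OF fine xK(1)] xN by (simp add: \<gamma>_def)
          moreover have "u \<in> K" "v \<in> K" using uv by simp_all
          ultimately have "u \<in> ball x (r x)" "v \<in> ball x (r x)" by (simp_all only: subsetD)
          then have "norm (u - x) < r x" "norm (v - x) < r x"
            by (simp_all add: dist_norm norm_minus_commute)
          then have "norm (F u - F x - (u - x) *\<^sub>R f x) \<le> \<eta> * norm (u - x)"
             "norm (F v - F x - (v - x) *\<^sub>R f x) \<le> \<eta> * norm (v - x)" using r(2)[OF xab] by auto
          \<comment> \<open>The increment of \<open>F\<close> over the cell is split at the tag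
            \<open>x\<close>; since \<open>x\<close> lies in the cell, the two errors add up to
            \<open>\<eta>\<close> times its length.\<close>
          moreover have eq: "(v - u) *\<^sub>R f x - (F v - F u) = (F u - F x - (u - x) *\<^sub>R f x) - (F v - F x - (v - x) *\<^sub>R f x)"
            by (auto simp: algebra_simps)
          ultimately have "norm ((v - u) *\<^sub>R f x - (F v - F u)) \<le> \<eta> * norm (u - x) + \<eta> * norm (v - x)"
            unfolding eq by (intro order_trans[OF norm_triangle_ineq4 add_mono])
          also have "\<dots> = \<eta> * (v - u)" using uv by (auto simp: algebra_simps)
          finally show "norm (measure lborel K *\<^sub>R g x - (F (Sup K) - F (Inf K))) \<le> \<eta> * (Sup K - Inf K)"
            using uv xN by (simp add: g_def)
        qed
        also have "\<dots> \<le> (\<Sum>xK\<in>p. \<eta> * (case xK of (x, K) \<Rightarrow> Sup K - Inf K))"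
        proof (rule sum_mono2)
          fix xK assume "xK \<in> p - (p - q)"
          then have "(fst xK, snd xK) \<in> p" by auto
          from Kform[OF this] show "0 \<le> \<eta> * (case xK of (x, K) \<Rightarrow> Sup K - Inf K)"
            using \<eta>(1) by (auto simp: case_prod_beta)
        qed (use fin in auto)
        also have "\<dots> = \<eta> * (b - a)" unfolding ba by (simp add: sum_distrib_left)
        finally show ?thesis .
      qed
      have "(\<Sum>(x, k)\<in>p. measure lborel k *\<^sub>R g x) - (F b - F a) =
          (\<Sum>(x,K)\<in>p. measure lborel K *\<^sub>R g x - (F (Sup K) - F (Inf K)))"
        unfolding sumF by (simp add: sum_subtractf case_prod_beta)
      also have "\<dots> = (\<Sum>(x,K)\<in>p - q. measure lborel K *\<^sub>R g x - (F (Sup K) - F (Inf K)))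
         + (\<Sum>(x,K)\<in>q. measure lborel K *\<^sub>R g x - (F (Sup K) - F (Inf K)))"
        using fin q by (simp add: sum.subset_diff)
      also have "(\<Sum>(x,K)\<in>q. measure lborel K *\<^sub>R g x - (F (Sup K) - F (Inf K))) = (\<Sum>(x,K)\<in>q. - (F (Sup K) - F (Inf K)))"
        by (rule sum.cong) (auto simp: q_def g_def)
      finally have "norm ((\<Sum>(x, k)\<in>p. measure lborel k *\<^sub>R g x) - (F b - F a)) \<le> \<eta> * (b - a)
         + norm (\<Sum>(x,K)\<in>q. - (F (Sup K) - F (Inf K)))"
        using order_trans[OF norm_triangle_ineq add_right_mono[OF small]] by simp
      also have "norm (\<Sum>(x,K)\<in>q. - (F (Sup K) - F (Inf K))) \<le> (\<Sum>xK\<in>q. cmod (F (Sup (snd xK)) - F (Inf (snd xK))))"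
        by (rule sum_norm_le) (auto simp: norm_minus_commute)
      finally show "norm ((\<Sum>(x, k)\<in>p. measure lborel k *\<^sub>R g x) - (F b - F a)) < e"
        using smallq \<eta> by linarith
    qed
  qed
  then show ?thesis
    by (subst (asm) box_real, elim has_integral_spike[OF N', rotated]) (auto simp: g_def)
qed

section \<open>Rules for absolutely continuous functions and their derivatives\<close>

lemma ac_deriv_continuous: "ac_deriv a b F f \<Longrightarrow> continuous_on {a..b} F"
  by (simp add: ac_deriv_def abs_cont_on_continuous)

lemma ac_deriv_subset:
  assumes "ac_deriv a b F f" "a \<le> a'" "b' \<le> b"
  shows "ac_deriv a' b' F f"
proof -
  obtain N where "negligible N" "\<forall>x\<in>{a<..<b} - N. (F has_vector_derivative f x) (at x)"
    using assms unfolding ac_deriv_def by blast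
  moreover have "{a'<..<b'} \<subseteq> {a<..<b}" using assms by auto
  ultimately show ?thesis
    using assms abs_cont_on_subset[of a b F a' b'] unfolding ac_deriv_def by blast
qed

lemma ac_deriv_integral:
  assumes "ac_deriv a b F f" "a \<le> x" "x \<le> b"
  shows "integral {a..x} f = F x - F a" "f integrable_on {a..x}"
proof -
  have "(f has_integral (F x - F a)) {a..x}"
    using ac_deriv_has_integral[OF ac_deriv_subset[OF assms(1), of a x]] assms by auto
  then show "integral {a..x} f = F x - F a" "f integrable_on {a..x}"
    by (auto simp: integral_unique has_integral_integrable)
qed

lemma ac_deriv_cong:
  assumes "ac_deriv a b F f" "\<And>x. x \<in> {a<..<b} \<Longrightarrow> f x = g x"
  shows "ac_deriv a b F g"
  using assms unfolding ac_deriv_def by (metis DiffE)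

lemma ac_deriv_const: "ac_deriv a b (\<lambda>_. c) (\<lambda>_. 0)"
  unfolding ac_deriv_def by (auto simp: abs_cont_on_const intro!: exI[of _ "{}"])

lemma ac_deriv_ident: "ac_deriv a b (\<lambda>x. of_real x) (\<lambda>_. 1)"
  unfolding ac_deriv_def
proof (intro conjI exI ballI)
  show "abs_cont_on a b (\<lambda>x. of_real x)"
    by (rule abs_cont_on_dominated[where A=0 and B=0 and L=1 and F="\<lambda>_. 0" and G="\<lambda>_. 0"])
      (auto simp: abs_cont_on_const simp flip: of_real_diff)
  show "negligible ({} :: real set)" by simp
  fix x :: real assume "x \<in> {a<..<b} - {}"
  show "((\<lambda>x. complex_of_real x) has_vector_derivative 1) (at x)"
    using has_vector_derivative_of_real[of "\<lambda>x. x" 1 "at x"] by simp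
qed

lemma ac_deriv_add:
  assumes F: "ac_deriv a b F f" and G: "ac_deriv a b G g"
  shows "ac_deriv a b (\<lambda>x. F x + G x) (\<lambda>x. f x + g x)"
proof -
  obtain N M where N: "negligible N" "\<forall>x\<in>{a<..<b} - N. (F has_vector_derivative f x) (at x)"
     "negligible M" "\<forall>x\<in>{a<..<b} - M. (G has_vector_derivative g x) (at x)"
    using F G unfolding ac_deriv_def by metis
  have "abs_cont_on a b (\<lambda>x. F x + G x)"
  proof (rule abs_cont_on_dominated[where A=1 and B=1 and L=0])
    fix u w :: real
    show "cmod (F w + G w - (F u + G u)) \<le> 1 * cmod (F w - F u) + 1 * cmod (G w - G u) + 0 * (w - u)"
      by (simp add: add_diff_add norm_triangle_ineq)
  qed (use F G in \<open>auto simp: ac_deriv_def\<close>)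
  moreover have "\<forall>x\<in>{a<..<b} - (N \<union> M). ((\<lambda>x. F x + G x) has_vector_derivative f x + g x) (at x)"
    using N by (auto intro!: has_vector_derivative_add)
  ultimately show ?thesis
    using N unfolding ac_deriv_def by (blast intro: negligible_Un)
qed

lemma ac_deriv_mult:
  assumes F: "ac_deriv a b F f" and G: "ac_deriv a b G g"
  shows "ac_deriv a b (\<lambda>x. F x * G x) (\<lambda>x. F x * g x + f x * G x)"
proof -
  obtain N M where N: "negligible N" "\<forall>x\<in>{a<..<b} - N. (F has_vector_derivative f x) (at x)"
     "negligible M" "\<forall>x\<in>{a<..<b} - M. (G has_vector_derivative g x) (at x)"
    using F G unfolding ac_deriv_def by metis
  have bdd: "\<exists>A\<ge>0. \<forall>x\<in>{a..b}. cmod (H x) \<le> A" if "continuous_on {a..b} H" for H :: "real \<Rightarrow> complex"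
  proof -
    have "bounded (H ` {a..b})" using compact_continuous_image[OF that] compact_imp_bounded by auto
    then show ?thesis unfolding bounded_pos by (meson imageI less_imp_le)
  qed
  obtain A where A: "A \<ge> 0" "\<forall>x\<in>{a..b}. cmod (G x) \<le> A"
    using bdd[OF ac_deriv_continuous[OF G]] by blast
  obtain B where B: "B \<ge> 0" "\<forall>x\<in>{a..b}. cmod (F x) \<le> B"
    using bdd[OF ac_deriv_continuous[OF F]] by blast
  have "abs_cont_on a b (\<lambda>x. F x * G x)"
  proof (rule abs_cont_on_dominated[where A=A and B=B and L=0])
    fix u w :: real assume u: "a \<le> u" "u \<le> w" "w \<le> b"
    have "F w * G w - F u * G u = (F w - F u) * G w + F u * (G w - G u)"
      by (simp add: algebra_simps)
    then have "cmod (F w * G w - F u * G u) \<le> cmod (G w) * cmod (F w - F u) + cmod (F u) * cmod (G w - G u)"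
      by (metis norm_triangle_ineq norm_mult mult.commute)
    also have "\<dots> \<le> A * cmod (F w - F u) + B * cmod (G w - G u)"
      using A B u by (intro add_mono mult_right_mono) auto
    finally show "cmod (F w * G w - F u * G u) \<le> A * cmod (F w - F u) + B * cmod (G w - G u) + 0 * (w - u)"
      by simp
  qed (use F G A B in \<open>auto simp: ac_deriv_def\<close>)
  moreover have "\<forall>x\<in>{a<..<b} - (N \<union> M). ((\<lambda>x. F x * G x) has_vector_derivative F x * g x + f x * G x) (at x)"
    using N by (auto intro!: has_vector_derivative_mult)
  ultimately show ?thesis
    using N unfolding ac_deriv_def by (blast intro: negligible_Un)
qed

lemma ac_deriv_cmult:
  assumes "ac_deriv a b F f"
  shows "ac_deriv a b (\<lambda>x. c * F x) (\<lambda>x. c * f x)"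
  using ac_deriv_mult[OF ac_deriv_const[of a b c] assms] by simp

lemma norm_exp_diff_le:
  fixes w z :: complex
  assumes "cmod w \<le> B" "cmod z \<le> B"
  shows "cmod (exp w - exp z) \<le> exp B * cmod (w - z)"
proof (rule field_differentiable_bound[of "cball 0 B" exp exp])
  fix u :: complex assume "u \<in> cball 0 B"
  then show "cmod (exp u) \<le> exp B"
    using norm_exp[of u] by (simp add: order_trans)
qed (use assms in \<open>auto intro!: derivative_eq_intros\<close>)

lemma ac_deriv_exp:
  assumes F: "ac_deriv a b F f"
  shows "ac_deriv a b (\<lambda>x. exp (F x)) (\<lambda>x. f x * exp (F x))"
proof -
  obtain N where N: "negligible N" "\<forall>x\<in>{a<..<b} - N. (F has_vector_derivative f x) (at x)"
    using F unfolding ac_deriv_def by metis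
  have "bounded (F ` {a..b})"
    using compact_continuous_image[OF ac_deriv_continuous[OF F]] compact_imp_bounded by auto
  then obtain B where B: "\<forall>x\<in>{a..b}. cmod (F x) \<le> B"
    unfolding bounded_pos by (meson imageI)
  have "abs_cont_on a b (\<lambda>x. exp (F x))"
  proof (rule abs_cont_on_dominated[where A="exp B" and B=0 and L=0 and F=F and G=F])
    fix u w :: real assume u: "a \<le> u" "u \<le> w" "w \<le> b"
    show "cmod (exp (F w) - exp (F u)) \<le> exp B * cmod (F w - F u) + 0 * cmod (F w - F u) + 0 * (w - u)"
      using norm_exp_diff_le[of "F w" B "F u"] B u by auto
  qed (use F in \<open>auto simp: ac_deriv_def\<close>)
  moreover have "\<forall>x\<in>{a<..<b} - N. ((\<lambda>x. exp (F x)) has_vector_derivative f x * exp (F x)) (at x)"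
    using N field_vector_diff_chain_at[of F _ _ exp] by (fastforce simp: o_def)
  ultimately show ?thesis
    using N unfolding ac_deriv_def by blast
qed

section \<open>Indefinite integrals\<close>

lemma abs_int_subinterval:
  fixes f :: "real \<Rightarrow> 'a::euclidean_space"
  assumes "f absolutely_integrable_on {a..b}" "a \<le> a'" "b' \<le> b"
  shows "f absolutely_integrable_on {a'..b'}"
  by (rule absolutely_integrable_on_subinterval[OF assms(1)]) (use assms in auto)

lemma integral_disjoint_intervals_le:
  fixes g :: "real \<Rightarrow> real"
  assumes g: "g absolutely_integrable_on {a..b}" and nn: "\<And>x. x \<in> {a..b} \<Longrightarrow> 0 \<le> g x"
    and uw: "\<And>i. i < (N::nat) \<Longrightarrow> a \<le> u i \<and> u i \<le> w i \<and> w i \<le> b"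
    and disj: "\<And>i j. i < N \<Longrightarrow> j < N \<Longrightarrow> i \<noteq> j \<Longrightarrow> {u i<..<w i} \<inter> {u j<..<w j} = {}"
  shows "(\<Sum>i<N. integral {u i..w i} g) \<le> integral {a..b} g"
proof -
  define h where "h = (\<lambda>i x. if x \<in> {u i<..<w i} then g x else 0)"
  have hi: "(h i has_integral integral {u i..w i} g) {a..b}" if i: "i < N" for i
  proof -
    have "g integrable_on {u i..w i}"
      using abs_int_subinterval[OF g, of "u i" "w i"] uw[OF i] absolutely_integrable_on_def by auto
    then have "(g has_integral integral {u i..w i} g) (cbox (u i) (w i))"
      by (simp add: integrable_integral)
    then have "((\<lambda>x. if x \<in> box (u i) (w i) then g x else 0) has_integral integral {u i..w i} g) (cbox a b)"
      using uw[OF i] by (intro has_integral_restrict_open_subinterval) auto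
    then show ?thesis by (simp add: h_def)
  qed
  have "(\<Sum>i<N. integral {u i..w i} g) = (\<Sum>i<N. integral {a..b} (h i))"
    by (rule sum.cong) (simp_all add: integral_unique[OF hi])
  also have "\<dots> = integral {a..b} (\<lambda>x. \<Sum>i<N. h i x)"
    by (rule Henstock_Kurzweil_Integration.integral_sum[symmetric]) (use hi in \<open>auto simp: has_integral_integrable\<close>)
  also have "\<dots> \<le> integral {a..b} g"
  proof (rule Henstock_Kurzweil_Integration.integral_le)
    show "(\<lambda>x. \<Sum>i<N. h i x) integrable_on {a..b}"
      using hi by (intro integrable_sum) (auto simp: has_integral_integrable)
    show "g integrable_on {a..b}" using g absolutely_integrable_on_def by blast
    fix x assume x: "x \<in> {a..b}"
    show "(\<Sum>i<N. h i x) \<le> g x"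
    proof (cases "\<exists>i<N. x \<in> {u i<..<w i}")
      case True
      then obtain i where i: "i < N" "x \<in> {u i<..<w i}" by blast
      have "h j x = 0" if "j \<in> {..<N} - {i}" for j
        using disj[of i j] that i unfolding h_def by auto
      then have "(\<Sum>i<N. h i x) = h i x"
        using i by (subst sum.remove[of _ i]) auto
      then show ?thesis using i by (simp add: h_def)
    next
      case False
      then have "(\<Sum>i<N. h i x) = 0" by (intro sum.neutral) (auto simp: h_def)
      then show ?thesis using nn x by simp
    qed
  qed
  finally show ?thesis .
qed

text \<open>Truncate \<open>cmod (f x)\<close> at height \<open>M\<close>: by dominated convergence
  the excess has integral below \<open>e / 2\<close> for large \<open>M\<close>, and the truncated
  part contributes at most \<open>M\<close> times the total length.\<close>

lemma abs_cont_on_indefinite_integral: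
  fixes f :: "real \<Rightarrow> complex"
  assumes f: "f absolutely_integrable_on {a..b}"
  shows "abs_cont_on a b (\<lambda>x. integral {a..x} f)"
  unfolding abs_cont_on_iff
proof (intro allI impI)
  fix e :: real assume e: "e > 0"
  have nf: "(\<lambda>x. cmod (f x)) absolutely_integrable_on {a..b}"
    using f by (rule absolutely_integrable_norm[unfolded o_def])
  have mf: "(\<lambda>x. min (cmod (f x)) (real M)) absolutely_integrable_on {a..b}" for M
    using absolutely_integrable_min_1[OF nf, of "\<lambda>_. real M"] by simp
  have g: "(\<lambda>x. cmod (f x) - min (cmod (f x)) (real M)) absolutely_integrable_on {a..b}" for M
    using nf mf by (rule set_integral_diff(1))
  have "(\<lambda>M. integral {a..b} (\<lambda>x. cmod (f x) - min (cmod (f x)) (real M))) \<longlonglongrightarrow> integral {a..b} (\<lambda>x. 0)"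
  proof (rule dominated_convergence(2))
    fix M show "(\<lambda>x. cmod (f x) - min (cmod (f x)) (real M)) integrable_on {a..b}"
      using g absolutely_integrable_on_def by blast
  next
    show "(\<lambda>x. cmod (f x)) integrable_on {a..b}" using nf absolutely_integrable_on_def by blast
    fix x
    have "\<forall>\<^sub>F M in sequentially. cmod (f x) \<le> real M"
      using filterlim_real_sequentially by (simp add: filterlim_at_top)
    then have "\<forall>\<^sub>F M in sequentially. cmod (f x) - min (cmod (f x)) (real M) = 0"
      by eventually_elim auto
    then show "(\<lambda>M. cmod (f x) - min (cmod (f x)) (real M)) \<longlonglongrightarrow> 0"
      by (simp add: tendsto_eventually)
  qed auto
  from order_tendstoD(2)[OF this, of "e / 2"] e
  have "\<forall>\<^sub>F M in sequentially. integral {a..b} (\<lambda>x. cmod (f x) - min (cmod (f x)) (real M)) < e / 2"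
    by simp
  then obtain M where M: "integral {a..b} (\<lambda>x. cmod (f x) - min (cmod (f x)) (real M)) < e / 2"
    by (meson eventually_sequentially order_refl)
  define d where "d = e / (2 * (real M + 1))"
  have d: "d > 0" "real M * d < e / 2" using e by (auto simp: d_def field_simps)
  have "small_increments a b (\<lambda>x. integral {a..x} f) d e"
    unfolding small_increments_def
  proof (intro allI impI)
    fix N :: nat and u w :: "nat \<Rightarrow> real"
    assume U: "(\<forall>i<N. a \<le> u i \<and> u i \<le> w i \<and> w i \<le> b) \<and>
        (\<forall>i<N. \<forall>j<N. i \<noteq> j \<longrightarrow> {u i<..<w i} \<inter> {u j<..<w j} = {}) \<and>
        (\<Sum>i<N. w i - u i) < d"
    have U1: "a \<le> u i \<and> u i \<le> w i \<and> w i \<le> b" if "i < N" for i using U that by blast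
    have U2: "{u i<..<w i} \<inter> {u j<..<w j} = {}" if "i < N" "j < N" "i \<noteq> j" for i j using U that by blast
    have "cmod (integral {a..w i} f - integral {a..u i} f) \<le>
        integral {u i..w i} (\<lambda>x. cmod (f x) - min (cmod (f x)) (real M)) + real M * (w i - u i)" if i: "i < N" for i
    proof -
      have fi: "f integrable_on {a..w i}"
        using abs_int_subinterval[OF f, of a "w i"] U1[OF i] absolutely_integrable_on_def by auto
      have "integral {a..w i} f - integral {a..u i} f = integral {u i..w i} f"
        using Henstock_Kurzweil_Integration.integral_combine[OF _ _ fi, of "u i"] U1[OF i] by (simp add: algebra_simps)
      also have "cmod \<dots> \<le> integral {u i..w i} (\<lambda>x. (cmod (f x) - min (cmod (f x)) (real M)) + real M)"
      proof (rule Henstock_Kurzweil_Integration.integral_norm_bound_integral)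
        show "f integrable_on {u i..w i}"
          using abs_int_subinterval[OF f, of "u i" "w i"] U1[OF i] absolutely_integrable_on_def by auto
        show "(\<lambda>x. (cmod (f x) - min (cmod (f x)) (real M)) + real M) integrable_on {u i..w i}"
          using abs_int_subinterval[OF g, of "u i" "w i"] U1[OF i] absolutely_integrable_on_def
          by (intro integrable_add) auto
      qed auto
      also have "\<dots> = integral {u i..w i} (\<lambda>x. cmod (f x) - min (cmod (f x)) (real M)) + real M * (w i - u i)"
        using abs_int_subinterval[OF g, of "u i" "w i"] U1[OF i] absolutely_integrable_on_def
        by (subst Henstock_Kurzweil_Integration.integral_add) auto
      finally show ?thesis .
    qed
    then have "(\<Sum>i<N. cmod (integral {a..w i} f - integral {a..u i} f)) \<le>
      (\<Sum>i<N. integral {u i..w i} (\<lambda>x. cmod (f x) - min (cmod (f x)) (real M)) + real M * (w i - u i))"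
      by (intro sum_mono) auto
    also have "\<dots> = (\<Sum>i<N. integral {u i..w i} (\<lambda>x. cmod (f x) - min (cmod (f x)) (real M))) + real M * (\<Sum>i<N. w i - u i)"
      by (simp add: sum.distrib sum_distrib_left)
    also have "\<dots> \<le> integral {a..b} (\<lambda>x. cmod (f x) - min (cmod (f x)) (real M)) + real M * d"
      by (intro add_mono integral_disjoint_intervals_le[OF g _ U1 U2] mult_left_mono) (use U in auto)
    also have "\<dots> < e" using M d by linarith
    finally show "(\<Sum>i<N. cmod (integral {a..w i} f - integral {a..u i} f)) < e" .
  qed
  then show "\<exists>\<delta>>0. small_increments a b (\<lambda>x. integral {a..x} f) \<delta> e" using d by blast
qed

text \<open>Lebesgue's differentiation theorem is used from the right, once for \<open>g\<close> and
  once for its reflection; the second use gives the left derivative off the reflected null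
  set.\<close>

theorem ac_deriv_indefinite_integral:
  fixes f :: "real \<Rightarrow> complex"
  assumes f: "f absolutely_integrable_on {a..b}"
  shows "ac_deriv a b (\<lambda>x. integral {a..x} f) f"
proof -
  define g where "g = (\<lambda>x. if x \<in> {a..b} then f x else 0)"
  have gU: "g absolutely_integrable_on UNIV"
    using f absolutely_integrable_restrict_UNIV unfolding g_def by blast
  have gi: "g integrable_on cbox c d" for c d
    using absolutely_integrable_on_subcbox[OF gU, of c d] absolutely_integrable_on_def by auto
  have gr: "(\<lambda>x. g (-x)) integrable_on cbox c d" for c d :: real
    using Henstock_Kurzweil_Integration.integrable_reflect_real[of g "-c" "-d"] gi[of "-d" "-c"] by simp
  obtain N where N: "negligible N" "\<And>x e. \<lbrakk>x \<notin> N; 0 < e\<rbrakk> \<Longrightarrow>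
               \<exists>d>0. \<forall>h. 0 < h \<and> h < d \<longrightarrow> norm(integral (cbox x (x + h *\<^sub>R One)) g /\<^sub>R h ^ DIM(real) - g x) < e"
    using integrable_ccontinuous_explicit[of g] gi by metis
  obtain M where M: "negligible M" "\<And>x e. \<lbrakk>x \<notin> M; 0 < e\<rbrakk> \<Longrightarrow>
               \<exists>d>0. \<forall>h. 0 < h \<and> h < d \<longrightarrow> norm(integral (cbox x (x + h *\<^sub>R One)) (\<lambda>x. g (-x)) /\<^sub>R h ^ DIM(real) - g (-x)) < e"
    using integrable_ccontinuous_explicit[of "\<lambda>x. g (-x)"] gr by metis
  have negM: "negligible (uminus ` M)"
    using M(1) by (intro negligible_differentiable_image_negligible) (auto intro!: derivative_intros simp: differentiable_on_def)
  have "((\<lambda>x. integral {a..x} f) has_vector_derivative f x) (at x)" if x: "x \<in> {a<..<b} - (N \<union> uminus ` M)" for x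
    unfolding has_vector_derivative_def has_derivative_at_alt
  proof (intro conjI allI impI)
    show "bounded_linear (\<lambda>h. h *\<^sub>R f x)" by (rule bounded_linear_scaleR_left)
    fix e :: real assume e: "e > 0"
    have xM: "- x \<notin> M" using x by force
    obtain d1 where d1: "d1 > 0" "\<And>h. 0 < h \<Longrightarrow> h < d1 \<Longrightarrow> norm (integral {x..x+h} g /\<^sub>R h - g x) < e"
      using N(2)[of x e] x e by auto
    obtain d2 where d2: "d2 > 0" "\<And>h. 0 < h \<Longrightarrow> h < d2 \<Longrightarrow> norm (integral {-x..-x+h} (\<lambda>x. g (-x)) /\<^sub>R h - g x) < e"
      using M(2)[of "-x" e] xM e by auto
    define d where "d = min (min d1 d2) (min (x - a) (b - x))"
    have d: "d > 0" using d1 d2 x by (auto simp: d_def)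
    have fint: "f integrable_on {c..y}" if "a \<le> c" "y \<le> b" for c y
      using abs_int_subinterval[OF f that] absolutely_integrable_on_def by auto
    have gf: "integral {c..y} g = integral {c..y} f" if "a \<le> c" "y \<le> b" for c y
      by (rule Henstock_Kurzweil_Integration.integral_cong) (use that in \<open>auto simp: g_def\<close>)
    have gx: "g x = f x" using x by (auto simp: g_def)
    have key: "norm (v - h *\<^sub>R f x) \<le> e * h" if "h > 0" "norm (v /\<^sub>R h - g x) < e" for v h
    proof -
      have "v - h *\<^sub>R f x = h *\<^sub>R (v /\<^sub>R h - g x)" using that(1) gx by (simp add: scaleR_diff_right)
      then have "norm (v - h *\<^sub>R f x) = h * norm (v /\<^sub>R h - g x)" using that(1) by simp
      also have "\<dots> \<le> h * e" using that by (intro mult_left_mono) auto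
      finally show ?thesis by (simp add: mult.commute)
    qed
    show "\<exists>d>0. \<forall>y. norm (y - x) < d \<longrightarrow>
       norm (integral {a..y} f - integral {a..x} f - (y - x) *\<^sub>R f x) \<le> e * norm (y - x)"
    proof (intro exI conjI allI impI)
      fix y assume y: "norm (y - x) < d"
      then have yab: "a \<le> y" "y \<le> b" by (auto simp: d_def)
      consider "y = x" | "y > x" | "y < x" by linarith
      then show "norm (integral {a..y} f - integral {a..x} f - (y - x) *\<^sub>R f x) \<le> e * norm (y - x)"
      proof cases
        case 2
        have "integral {a..y} f - integral {a..x} f = integral {x..x + (y - x)} g"
          using Henstock_Kurzweil_Integration.integral_combine[OF _ _ fint[of a y], of x] x 2 yab
            gf[of x y] by (auto simp: algebra_simps)
        then show ?thesis
          using key[of "y - x" "integral {x..x + (y - x)} g"] d1(2)[of "y - x"] 2 y by (auto simp: d_def)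
      next
        case 3
        have "integral {-x..-x+(x - y)} (\<lambda>x. g (-x)) = integral {y..x} g"
          using Henstock_Kurzweil_Integration.integral_reflect_real[of x y g] by simp
        moreover have "integral {a..x} f - integral {a..y} f = integral {y..x} g"
          using Henstock_Kurzweil_Integration.integral_combine[OF _ _ fint[of a x], of y] x 3 yab
            gf[of y x] by (auto simp: algebra_simps)
        ultimately have "norm (integral {a..x} f - integral {a..y} f - (x - y) *\<^sub>R f x) \<le> e * (x - y)"
          using key[of "x - y" "integral {-x..-x+(x - y)} (\<lambda>x. g (-x))"] d2(2)[of "x - y"] 3 y by (auto simp: d_def)
        moreover have "integral {a..y} f - integral {a..x} f - (y - x) *\<^sub>R f x = - (integral {a..x} f - integral {a..y} f - (x - y) *\<^sub>R f x)"
          by (simp add: algebra_simps)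
        ultimately show ?thesis using 3 by (metis norm_minus_cancel abs_of_neg diff_less_0_iff_less minus_diff_eq real_norm_def)
      qed simp
    qed (rule d)
  qed
  then show ?thesis
    unfolding ac_deriv_def using abs_cont_on_indefinite_integral[OF f] N(1) negM negligible_Un by blast
qed

section \<open>Square integrable functions\<close>

text \<open>Closed intervals and the gauge integral fit the calculus of \<open>ac_deriv\<close>. The
  passage to and from \<open>L2_on\<close>, which has open intervals and the Lebesgue integral, is
  made by \<open>L2_on_imp_sq_int\<close> and \<open>sq_int_imp_L2_on\<close>.\<close>

definition sq_int :: "real \<Rightarrow> real \<Rightarrow> (real \<Rightarrow> complex) \<Rightarrow> bool" where
  "sq_int a b f \<longleftrightarrow> f \<in> borel_measurable (lebesgue_on {a..b}) \<and> (\<lambda>x. (cmod (f x))\<^sup>2) integrable_on {a..b}"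

definition l2norm :: "real \<Rightarrow> real \<Rightarrow> (real \<Rightarrow> complex) \<Rightarrow> real" where
  "l2norm a b f = sqrt (integral {a..b} (\<lambda>x. (cmod (f x))\<^sup>2))"

lemma l2norm_nonneg: "l2norm a b f \<ge> 0"
proof -
  have "integral {a..b} (\<lambda>x. (cmod (f x))\<^sup>2) \<ge> 0"
    by (cases "(\<lambda>x. (cmod (f x))\<^sup>2) integrable_on {a..b}")
      (auto intro: Henstock_Kurzweil_Integration.integral_nonneg simp: not_integrable_integral)
  then show ?thesis by (simp add: l2norm_def)
qed

lemma l2norm_power2: "(l2norm a b f)\<^sup>2 = integral {a..b} (\<lambda>x. (cmod (f x))\<^sup>2)"
proof -
  have "integral {a..b} (\<lambda>x. (cmod (f x))\<^sup>2) \<ge> 0"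
    by (cases "(\<lambda>x. (cmod (f x))\<^sup>2) integrable_on {a..b}")
      (auto intro: Henstock_Kurzweil_Integration.integral_nonneg simp: not_integrable_integral)
  then show ?thesis by (simp add: l2norm_def)
qed

lemma sq_int_norm_mult:
  assumes "sq_int a b f" "sq_int a b g"
  shows "(\<lambda>x. f x * g x) absolutely_integrable_on {a..b}"
    "(\<lambda>x. cmod (f x) * cmod (g x)) integrable_on {a..b}"
proof -
  have b: "(\<lambda>x. (cmod (f x))\<^sup>2 + (cmod (g x))\<^sup>2) integrable_on {a..b}"
    using assms by (intro integrable_add) (auto simp: sq_int_def)
  have "cmod (f x) * cmod (g x) \<le> (cmod (f x))\<^sup>2 + (cmod (g x))\<^sup>2" for x
  proof -
    have "2 * (cmod (f x) * cmod (g x)) \<le> (cmod (f x))\<^sup>2 + (cmod (g x))\<^sup>2"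
      using sum_squares_bound[of "cmod (f x)" "cmod (g x)"] by simp
    moreover have "0 \<le> cmod (f x) * cmod (g x)" by simp
    ultimately show ?thesis by linarith
  qed
  then show "(\<lambda>x. f x * g x) absolutely_integrable_on {a..b}"
    by (intro measurable_bounded_by_integrable_imp_absolutely_integrable[OF _ _ b] borel_measurable_times)
      (use assms in \<open>auto simp: sq_int_def norm_mult\<close>)
  from absolutely_integrable_norm[OF this]
  show "(\<lambda>x. cmod (f x) * cmod (g x)) integrable_on {a..b}"
    by (simp add: o_def norm_mult absolutely_integrable_on_def)
qed

lemma sq_int_bound:
  assumes "sq_int a b f" "g \<in> borel_measurable (lebesgue_on {a..b})"
    and le: "\<And>x. x \<in> {a..b} \<Longrightarrow> cmod (g x) \<le> cmod (f x)"
  shows "sq_int a b g" "l2norm a b g \<le> l2norm a b f"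
proof -
  have 1: "(\<lambda>x. (cmod (g x))\<^sup>2) integrable_on {a..b}"
  proof (rule measurable_bounded_by_integrable_imp_integrable)
    show "(\<lambda>x. (cmod (g x))\<^sup>2) \<in> borel_measurable (lebesgue_on {a..b})"
      using assms(2) by measurable
    show "(\<lambda>x. (cmod (f x))\<^sup>2) integrable_on {a..b}" using assms(1) by (simp add: sq_int_def)
    show "norm ((cmod (g x))\<^sup>2) \<le> (cmod (f x))\<^sup>2" if "x \<in> {a..b}" for x
      using le[OF that] by (simp add: power_mono)
  qed simp
  then show "sq_int a b g" using assms(2) by (simp add: sq_int_def)
  show "l2norm a b g \<le> l2norm a b f" unfolding l2norm_def
    using assms(1) 1 le
    by (intro real_sqrt_le_mono Henstock_Kurzweil_Integration.integral_le) (auto simp: sq_int_def power_mono)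
qed

lemma sq_int_cmult:
  assumes "sq_int a b f"
  shows "sq_int a b (\<lambda>x. c * f x)" "l2norm a b (\<lambda>x. c * f x) = cmod c * l2norm a b f"
  using assms unfolding sq_int_def l2norm_def norm_mult power_mult_distrib
  by (auto simp: real_sqrt_mult integrable_on_mult_right intro!: borel_measurable_times)

lemma sq_int_add:
  assumes "sq_int a b f" "sq_int a b g"
  shows "sq_int a b (\<lambda>x. f x + g x)"
  unfolding sq_int_def
proof
  show m: "(\<lambda>x. f x + g x) \<in> borel_measurable (lebesgue_on {a..b})"
    using assms by (auto simp: sq_int_def)
  show "(\<lambda>x. (cmod (f x + g x))\<^sup>2) integrable_on {a..b}"
  proof (rule measurable_bounded_by_integrable_imp_integrable)
    show "(\<lambda>x. (cmod (f x + g x))\<^sup>2) \<in> borel_measurable (lebesgue_on {a..b})"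
      using m by measurable
    show "(\<lambda>x. (cmod (f x))\<^sup>2 + 2 * (cmod (f x) * cmod (g x)) + (cmod (g x))\<^sup>2) integrable_on {a..b}"
      using assms sq_int_norm_mult(2)[OF assms] by (intro integrable_add integrable_on_mult_right) (auto simp: sq_int_def)
    show "norm ((cmod (f x + g x))\<^sup>2) \<le> (cmod (f x))\<^sup>2 + 2 * (cmod (f x) * cmod (g x)) + (cmod (g x))\<^sup>2" for x
    proof -
      have "(cmod (f x + g x))\<^sup>2 \<le> (cmod (f x) + cmod (g x))\<^sup>2"
        by (intro power_mono norm_triangle_ineq) simp
      then show ?thesis by (simp add: power2_eq_square algebra_simps)
    qed
  qed simp
qed

lemma sq_int_diff:
  assumes "sq_int a b f" "sq_int a b g"
  shows "sq_int a b (\<lambda>x. f x - g x)"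
  using sq_int_add[OF assms(1) sq_int_cmult(1)[OF assms(2), of "-1"]] by simp

lemma sq_int_zero: "sq_int a b (\<lambda>_. 0)" "l2norm a b (\<lambda>_. 0) = 0"
  by (auto simp: sq_int_def l2norm_def)

lemma sq_int_sum:
  assumes "\<And>i. i \<in> I \<Longrightarrow> sq_int a b (f i)"
  shows "sq_int a b (\<lambda>x. \<Sum>i\<in>I. f i x)"
  using assms
proof (induction I rule: infinite_finite_induct)
  case (insert i I)
  then show ?case using sq_int_add[of a b "f i" "\<lambda>x. \<Sum>i\<in>I. f i x"] by simp
qed (simp_all add: sq_int_zero)

text \<open>The integral of \<open>(cmod (f x) - t * cmod (g x))\<^sup>2\<close> is a nonnegative
  polynomial of degree at most two in \<open>t\<close>; \<open>t = B / C\<close> gives the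
  inequality when \<open>C > 0\<close>.\<close>

theorem cauchy_schwarz_integral:
  assumes f: "sq_int a b f" and g: "sq_int a b g"
  shows "integral {a..b} (\<lambda>x. cmod (f x) * cmod (g x)) \<le> l2norm a b f * l2norm a b g"
proof -
  define A where "A = integral {a..b} (\<lambda>x. (cmod (f x))\<^sup>2)"
  define B where "B = integral {a..b} (\<lambda>x. cmod (f x) * cmod (g x))"
  define C where "C = integral {a..b} (\<lambda>x. (cmod (g x))\<^sup>2)"
  have fi: "(\<lambda>x. (cmod (f x))\<^sup>2) integrable_on {a..b}" "(\<lambda>x. (cmod (g x))\<^sup>2) integrable_on {a..b}"
    using f g by (auto simp: sq_int_def)
  note fg = sq_int_norm_mult(2)[OF f g]
  have q: "0 \<le> A - 2 * t * B + t\<^sup>2 * C" for t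
  proof -
    have "((\<lambda>x. (cmod (f x))\<^sup>2 - (2 * t) * (cmod (f x) * cmod (g x)) + t\<^sup>2 * (cmod (g x))\<^sup>2) has_integral
       (A - (2 * t) * B + t\<^sup>2 * C)) {a..b}"
      unfolding A_def B_def C_def
      by (intro has_integral_add has_integral_diff has_integral_mult_right integrable_integral fi fg)
    moreover have "(cmod (f x))\<^sup>2 - (2 * t) * (cmod (f x) * cmod (g x)) + t\<^sup>2 * (cmod (g x))\<^sup>2 = (cmod (f x) - t * cmod (g x))\<^sup>2" for x
      by (simp add: power2_eq_square algebra_simps)
    ultimately show ?thesis
      using has_integral_nonneg[of "\<lambda>x. (cmod (f x) - t * cmod (g x))\<^sup>2"] by (simp add: mult.assoc)
  qed
  have AC: "A \<ge> 0" "C \<ge> 0" unfolding A_def C_def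
    by (auto intro!: Henstock_Kurzweil_Integration.integral_nonneg fi)
  have "B\<^sup>2 \<le> A * C"
  proof (cases "C = 0")
    case True
    have "B \<le> 0"
    proof (rule ccontr)
      assume "\<not> B \<le> 0"
      \<comment> \<open>For \<open>C = 0\<close> the polynomial is linear, and at
        \<open>t = (A + 1) / B\<close> it would equal \<open>- A - 2 < 0\<close>.\<close>
      then have "2 * ((A + 1) / B) * B = 2 * (A + 1)" by simp
      then show False using q[of "(A + 1) / B"] True AC by simp
    qed
    moreover have "B \<ge> 0" unfolding B_def
      by (auto intro!: Henstock_Kurzweil_Integration.integral_nonneg fg)
    ultimately show ?thesis using True by simp
  next
    case False
    then have "C > 0" using AC by simp
    then show ?thesis using q[of "B / C"] by (simp add: power2_eq_square field_simps)
  qed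
  then have "sqrt (B\<^sup>2) \<le> sqrt (A * C)" by (rule real_sqrt_le_mono)
  then have "\<bar>B\<bar> \<le> sqrt A * sqrt C" by (simp add: real_sqrt_mult)
  then show ?thesis by (simp add: l2norm_def A_def B_def C_def)
qed

lemma cauchy_schwarz_cmod:
  assumes f: "sq_int a b f" and g: "sq_int a b g"
  shows "cmod (integral {a..b} (\<lambda>x. f x * g x)) \<le> l2norm a b f * l2norm a b g"
proof -
  have "cmod (integral {a..b} (\<lambda>x. f x * g x)) \<le> integral {a..b} (\<lambda>x. cmod (f x) * cmod (g x))"
    using sq_int_norm_mult[OF f g]
    by (intro Henstock_Kurzweil_Integration.integral_norm_bound_integral) (auto simp: norm_mult absolutely_integrable_on_def)
  then show ?thesis using cauchy_schwarz_integral[OF f g] by linarith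
qed

lemma l2norm_triangle:
  assumes f: "sq_int a b f" and g: "sq_int a b g"
  shows "l2norm a b (\<lambda>x. f x + g x) \<le> l2norm a b f + l2norm a b g"
proof (rule power2_le_imp_le)
  have fi: "(\<lambda>x. (cmod (f x))\<^sup>2) integrable_on {a..b}" "(\<lambda>x. (cmod (g x))\<^sup>2) integrable_on {a..b}"
    "(\<lambda>x. (cmod (f x + g x))\<^sup>2) integrable_on {a..b}"
    using f g sq_int_add[OF f g] by (auto simp: sq_int_def)
  note fg = sq_int_norm_mult(2)[OF f g]
  have h: "((\<lambda>x. (cmod (f x))\<^sup>2 + 2 * (cmod (f x) * cmod (g x)) + (cmod (g x))\<^sup>2) has_integral
    (integral {a..b} (\<lambda>x. (cmod (f x))\<^sup>2) + 2 * integral {a..b} (\<lambda>x. cmod (f x) * cmod (g x)) + integral {a..b} (\<lambda>x. (cmod (g x))\<^sup>2))) {a..b}"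
    by (intro has_integral_add has_integral_mult_right integrable_integral fi fg)
  have "(l2norm a b (\<lambda>x. f x + g x))\<^sup>2 \<le> (l2norm a b f)\<^sup>2 + 2 * integral {a..b} (\<lambda>x. cmod (f x) * cmod (g x)) + (l2norm a b g)\<^sup>2"
    unfolding l2norm_power2
  proof (rule has_integral_le[OF integrable_integral[OF fi(3)] h])
    fix x
    have "(cmod (f x + g x))\<^sup>2 \<le> (cmod (f x) + cmod (g x))\<^sup>2"
      by (intro power_mono norm_triangle_ineq) simp
    then show "(cmod (f x + g x))\<^sup>2 \<le> (cmod (f x))\<^sup>2 + 2 * (cmod (f x) * cmod (g x)) + (cmod (g x))\<^sup>2"
      by (simp add: power2_eq_square algebra_simps)
  qed
  also have "\<dots> \<le> (l2norm a b f)\<^sup>2 + 2 * (l2norm a b f * l2norm a b g) + (l2norm a b g)\<^sup>2"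
    using cauchy_schwarz_integral[OF f g] by simp
  also have "\<dots> = (l2norm a b f + l2norm a b g)\<^sup>2" by (simp add: power2_eq_square algebra_simps)
  finally show "(l2norm a b (\<lambda>x. f x + g x))\<^sup>2 \<le> (l2norm a b f + l2norm a b g)\<^sup>2" .
qed (simp add: l2norm_nonneg)

lemma l2norm_minus_commute: "l2norm a b (\<lambda>x. f x - g x) = l2norm a b (\<lambda>x. g x - f x)"
  by (simp add: l2norm_def norm_minus_commute)

lemma sq_int_continuous:
  assumes "continuous_on {a..b} f"
  shows "sq_int a b f"
  unfolding sq_int_def
  using assms by (auto intro!: continuous_imp_measurable_on_sets_lebesgue integrable_continuous_real continuous_intros)

lemma sq_int_times_continuous:
  assumes f: "sq_int a b f" and h: "continuous_on {a..b} h"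
  shows "sq_int a b (\<lambda>x. f x * h x)"
proof -
  have "bounded (h ` {a..b})"
    using compact_continuous_image[OF h] compact_imp_bounded by auto
  then obtain B where B: "B > 0" "\<forall>x\<in>{a..b}. cmod (h x) \<le> B"
    unfolding bounded_pos by (meson imageI)
  show ?thesis
  proof (rule sq_int_bound(1)[OF sq_int_cmult(1)[OF f, of "of_real B"]])
    show "(\<lambda>x. f x * h x) \<in> borel_measurable (lebesgue_on {a..b})"
      using f continuous_imp_measurable_on_sets_lebesgue[OF h] by (auto simp: sq_int_def)
    fix x assume "x \<in> {a..b}"
    then show "cmod (f x * h x) \<le> cmod (complex_of_real B * f x)"
      using B by (simp add: norm_mult mult.commute[of "cmod (f x)"] mult_right_mono)
  qed
qed

lemma abs_int_times_continuous:
  fixes f h :: "real \<Rightarrow> complex"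
  assumes f: "f absolutely_integrable_on {a..b}" and h: "continuous_on {a..b} h"
  shows "(\<lambda>x. f x * h x) absolutely_integrable_on {a..b}"
proof -
  have "bounded (h ` {a..b})"
    using compact_continuous_image[OF h] compact_imp_bounded by auto
  then obtain B where B: "B > 0" "\<forall>x\<in>{a..b}. cmod (h x) \<le> B"
    unfolding bounded_pos by (meson imageI)
  show ?thesis
  proof (rule measurable_bounded_by_integrable_imp_absolutely_integrable)
    show "(\<lambda>x. f x * h x) \<in> borel_measurable (lebesgue_on {a..b})"
      using absolutely_integrable_imp_borel_measurable[OF f] continuous_imp_measurable_on_sets_lebesgue[OF h] by auto
    show "(\<lambda>x. B * cmod (f x)) integrable_on {a..b}"
      using absolutely_integrable_norm[OF f] by (intro integrable_on_mult_right) (simp add: absolutely_integrable_on_def o_def)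
    fix x assume "x \<in> {a..b}"
    then show "cmod (f x * h x) \<le> B * cmod (f x)"
      using B by (simp add: norm_mult mult.commute[of "cmod (f x)"] mult_right_mono)
  qed simp
qed

lemma sq_int_abs_int:
  assumes "sq_int a b f"
  shows "f absolutely_integrable_on {a..b}"
  using sq_int_norm_mult(1)[OF assms sq_int_continuous[of a b "\<lambda>_. 1"]] by simp

lemma sq_int_subinterval:
  assumes f: "sq_int a b f" and "a \<le> a'" "b' \<le> b"
  shows "sq_int a' b' f" "l2norm a' b' f \<le> l2norm a b f"
proof -
  have sub: "{a'..b'} \<subseteq> {a..b}" using assms by auto
  have int: "(\<lambda>x. (cmod (f x))\<^sup>2) integrable_on {a'..b'}"
    by (rule integrable_on_subinterval[OF _ sub]) (use f in \<open>simp add: sq_int_def\<close>)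
  then show "sq_int a' b' f"
    using f measurable_restrict_mono[OF _ sub] by (auto simp: sq_int_def)
  show "l2norm a' b' f \<le> l2norm a b f" unfolding l2norm_def
    using f int sub by (intro real_sqrt_le_mono integral_subset_le) (auto simp: sq_int_def)
qed

lemma l2norm_le_sup:
  assumes f: "sq_int a b f" and "a \<le> b" "M \<ge> 0" and le: "\<And>x. x \<in> {a..b} \<Longrightarrow> cmod (f x) \<le> M"
  shows "l2norm a b f \<le> sqrt (b - a) * M"
proof -
  have "integral {a..b} (\<lambda>x. (cmod (f x))\<^sup>2) \<le> integral {a..b} (\<lambda>x. M\<^sup>2)"
    using f le by (intro Henstock_Kurzweil_Integration.integral_le) (auto simp: sq_int_def power_mono)
  then have "l2norm a b f \<le> sqrt ((b - a) * M\<^sup>2)"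
    unfolding l2norm_def using \<open>a \<le> b\<close> by simp
  then show ?thesis using \<open>M \<ge> 0\<close> by (simp add: real_sqrt_mult)
qed

section \<open>Gronwall's inequality with an integrable kernel\<close>

text \<open>The integrand is half the derivative of \<open>exp (2 K)\<close>, with \<open>K\<close>
  the integral of \<open>k\<close>; this is the origin of the factor \<open>1 / 2\<close> in the
  contraction estimates below. Complex values enter because \<open>ac_deriv\<close> is stated for
  them.\<close>

lemma exp_weight_integral:
  fixes k :: "real \<Rightarrow> real"
  assumes k: "k absolutely_integrable_on {0..X}" and x: "0 \<le> x" "x \<le> X"
  shows "((\<lambda>s. k s * exp (2 * integral {0..s} k)) has_integral (exp (2 * integral {0..x} k) - 1) / 2) {0..x}"
proof -
  define kc where "kc = (\<lambda>s. complex_of_real (k s))"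
  have kc: "kc absolutely_integrable_on {0..X}"
    using absolutely_integrable_linear[OF k bounded_linear_of_real[where 'a=complex]] by (simp add: kc_def o_def)
  have K: "integral {0..s} kc = complex_of_real (integral {0..s} k)" if "s \<le> X" for s
  proof -
    have "k integrable_on {0..s}"
      using abs_int_subinterval[OF k, of 0 s] that absolutely_integrable_on_def by auto
    then show ?thesis unfolding kc_def
      using integral_linear[of k "{0..s}" complex_of_real] bounded_linear_of_real by (auto simp: o_def)
  qed
  have "ac_deriv 0 X (\<lambda>s. exp (2 * integral {0..s} kc)) (\<lambda>s. (2 * kc s) * exp (2 * integral {0..s} kc))"
    by (intro ac_deriv_exp ac_deriv_cmult ac_deriv_indefinite_integral kc)
  from ac_deriv_has_integral[OF ac_deriv_subset[OF this, of 0 x]] x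
  have "((\<lambda>s. (2 * kc s) * exp (2 * integral {0..s} kc)) has_integral (exp (2 * integral {0..x} kc) - 1)) {0..x}"
    by simp
  from has_integral_linear[OF this bounded_linear_Re]
  have h: "((\<lambda>s. Re ((2 * kc s) * exp (2 * integral {0..s} kc))) has_integral Re (exp (2 * integral {0..x} kc) - 1)) {0..x}"
    by (simp only: o_def)
  have e: "exp (2 * complex_of_real r) = complex_of_real (exp (2 * r))" for r
    by (simp flip: exp_of_real)
  have r: "Re ((2 * kc s) * exp (2 * integral {0..s} kc)) = 2 * (k s * exp (2 * integral {0..s} k))" if "s \<le> X" for s
    unfolding K[OF that] e by (simp add: kc_def)
  have "((\<lambda>s. 2 * (k s * exp (2 * integral {0..s} k))) has_integral Re (exp (2 * integral {0..x} kc) - 1)) {0..x}"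
    by (rule has_integral_eq[OF _ h]) (use x in \<open>auto simp only: r atLeastAtMost_iff\<close>)
  then have "((\<lambda>s. 2 * (k s * exp (2 * integral {0..s} k))) has_integral (exp (2 * integral {0..x} k) - 1)) {0..x}"
    unfolding K[OF x(2)] e by simp
  from has_integral_mult_right[OF this, of "1/2"] show ?thesis by simp
qed

text \<open>With the weight \<open>exp (2 K)\<close> one application of the integral operator halves the optimal
  constant in the bound, so no iteration is needed.\<close>

theorem gronwall_family:
  fixes k :: "real \<Rightarrow> real" and f :: "real \<Rightarrow> 'i \<Rightarrow> real"
  defines "E \<equiv> \<lambda>s. exp (2 * integral {0..s} k)"
  assumes k: "k absolutely_integrable_on {0..X}" and knn: "\<And>s. s \<in> {0..X} \<Longrightarrow> 0 \<le> k s"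
    and bound: "\<And>s i. s \<in> {0..X} \<Longrightarrow> i \<in> I s \<Longrightarrow> f s i \<le> B" and A: "A \<ge> 0"
    and step: "\<And>D x i. D \<ge> 0 \<Longrightarrow> (\<And>s j. s \<in> {0..X} \<Longrightarrow> j \<in> I s \<Longrightarrow> f s j \<le> D * E s) \<Longrightarrow>
       x \<in> {0..X} \<Longrightarrow> i \<in> I x \<Longrightarrow> f x i \<le> A + integral {0..x} (\<lambda>s. k s * (D * E s))"
    and x: "x \<in> {0..X}" "i \<in> I x"
  shows "f x i \<le> 2 * A * E x"
proof -
  have Knn: "integral {0..s} k \<ge> 0" if "s \<in> {0..X}" for s
  proof (rule Henstock_Kurzweil_Integration.integral_nonneg)
    show "k integrable_on {0..s}"
      using abs_int_subinterval[OF k, of 0 s] that absolutely_integrable_on_def by auto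
  qed (use that knn in auto)
  have E1: "E s \<ge> 1" if "s \<in> {0..X}" for s
    using Knn[OF that] by (simp add: E_def)
  \<comment> \<open>The admissible constants \<open>D\<close>. The a priori bound \<open>B\<close>
    makes this set nonempty, so that its infimum can be taken.\<close>
  define S where "S = {D. D \<ge> 0 \<and> (\<forall>s\<in>{0..X}. \<forall>j\<in>I s. f s j \<le> D * E s)}"
  have "max B 0 \<in> S"
  proof -
    have "f s j \<le> max B 0 * E s" if s: "s \<in> {0..X}" "j \<in> I s" for s j
    proof -
      have "f s j \<le> max B 0 * 1" using bound[OF s] by simp
      also have "\<dots> \<le> max B 0 * E s" using E1[OF s(1)] by (intro mult_left_mono) auto
      finally show ?thesis .
    qed
    then show ?thesis by (simp add: S_def)
  qed
  then have Sne: "S \<noteq> {}" by auto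
  have Sbdd: "bdd_below S" by (rule bdd_belowI[of _ 0]) (simp add: S_def)
  define D where "D = Inf S"
  have D0: "D \<ge> 0" unfolding D_def by (rule cInf_greatest[OF Sne]) (simp add: S_def)
  \<comment> \<open>The infimum is itself admissible, because each single bound is a closed
    condition on the constant.\<close>
  have D: "f s j \<le> D * E s" if s: "s \<in> {0..X}" "j \<in> I s" for s j
  proof -
    have Epos: "E s > 0" by (simp add: E_def)
    have "f s j / E s \<le> Inf S"
      by (rule cInf_greatest[OF Sne]) (use s Epos in \<open>simp add: S_def divide_le_eq\<close>)
    then show ?thesis using Epos by (simp add: D_def divide_le_eq)
  qed
  \<comment> \<open>One application of \<open>step\<close> to the optimal constant yields
    \<open>A + D / 2\<close>, so minimality forces \<open>D \<le> 2 * A\<close>.\<close>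
  have "A + D / 2 \<in> S"
  proof -
    have "f s j \<le> (A + D / 2) * E s" if s: "s \<in> {0..X}" "j \<in> I s" for s j
    proof -
      have "integral {0..s} (\<lambda>s. k s * (D * E s)) = D * ((E s - 1) / 2)"
      proof (rule integral_unique)
        have "((\<lambda>r. D * (k r * exp (2 * integral {0..r} k))) has_integral D * ((exp (2 * integral {0..s} k) - 1) / 2)) {0..s}"
          by (rule has_integral_mult_right, rule exp_weight_integral[OF k]) (use s in auto)
        then show "((\<lambda>s. k s * (D * E s)) has_integral D * ((E s - 1) / 2)) {0..s}"
          by (simp add: E_def mult.left_commute)
      qed
      then have "f s j \<le> A + D * ((E s - 1) / 2)" using step[OF D0 D s] by simp
      also have "\<dots> \<le> A * E s + D / 2 * E s"
      proof -
        have "D * ((E s - 1) / 2) = D / 2 * E s - D / 2" by (simp add: field_simps)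
        then show ?thesis using mult_left_mono[OF E1[OF s(1)] A] D0 by linarith
      qed
      finally show ?thesis by (simp add: algebra_simps)
    qed
    then show ?thesis using A D0 by (simp add: S_def)
  qed
  then have "D \<le> A + D / 2" unfolding D_def by (rule cInf_lower[OF _ Sbdd])
  then have "D \<le> 2 * A" by simp
  then have "D * E x \<le> 2 * A * E x" by (intro mult_right_mono) (simp_all add: E_def)
  then show ?thesis using D[OF x] by linarith
qed

section \<open>The initial value problem\<close>

lemma AE_lebesgue_on_iff_negligible:
  assumes "S \<in> sets lebesgue"
  shows "(AE x in lebesgue_on S. P x) \<longleftrightarrow> (\<exists>N. negligible N \<and> (\<forall>x\<in>S - N. P x))"
proof
  assume "AE x in lebesgue_on S. P x"
  then have "AE x in lebesgue. x \<in> S \<longrightarrow> P x"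
    using assms by (simp add: AE_restrict_space_iff)
  then obtain N where "N \<in> null_sets lebesgue" "{x. \<not> (x \<in> S \<longrightarrow> P x)} \<subseteq> N"
    by (auto simp: eventually_ae_filter)
  then show "\<exists>N. negligible N \<and> (\<forall>x\<in>S - N. P x)"
    by (intro exI[of _ N]) (auto simp: negligible_iff_null_sets)
next
  assume "\<exists>N. negligible N \<and> (\<forall>x\<in>S - N. P x)"
  then obtain N where "N \<in> null_sets lebesgue" "\<forall>x\<in>S - N. P x"
    by (auto simp: negligible_iff_null_sets)
  then have "AE x in lebesgue. x \<in> S \<longrightarrow> P x"
    unfolding eventually_ae_filter by (intro bexI[of _ N]) auto
  then show "AE x in lebesgue_on S. P x"
    using assms by (simp add: AE_restrict_space_iff)
qed

lemma L2_on_imp_sq_int: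
  assumes "L2_on a b f"
  shows "sq_int a b f"
proof -
  have eq: "{a..b} - {a, b} = {a<..<b}" by auto
  have "{a, b} \<inter> {a..b} \<in> null_sets (lebesgue_on {a..b})"
    by (subst null_sets_restrict_space) (auto intro!: finite_imp_null_set_lborel[THEN null_sets_completionI])
  then have "f \<in> borel_measurable (lebesgue_on {a..b})"
    using borel_measurable_diff_null[of "{a, b} \<inter> {a..b}" "{a..b}" f] assms eq
    by (simp add: L2_on_def Diff_Int_distrib2 Diff_Int)
  moreover have "(\<lambda>x. (cmod (f x))\<^sup>2) integrable_on {a..b}"
    using assms integrable_on_lebesgue_on[of "{a<..<b}" "\<lambda>x. (cmod (f x))\<^sup>2"]
    by (auto simp: L2_on_def integrable_on_open_interval_real)
  ultimately show ?thesis by (simp add: sq_int_def)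
qed

lemma sq_int_imp_L2_on:
  assumes "sq_int a b f"
  shows "L2_on a b f"
proof -
  have sub: "{a<..<b} \<subseteq> {a..b}" by auto
  have m: "f \<in> borel_measurable (lebesgue_on {a<..<b})"
    using assms measurable_restrict_mono[OF _ sub] by (auto simp: sq_int_def)
  have "(\<lambda>x. (cmod (f x))\<^sup>2) integrable_on {a<..<b}"
    using assms by (simp add: sq_int_def integrable_on_open_interval_real)
  then have "(\<lambda>x. (cmod (f x))\<^sup>2) absolutely_integrable_on {a<..<b}"
    by (rule nonnegative_absolutely_integrable_1) simp
  then show ?thesis using m
    by (simp add: L2_on_def absolutely_integrable_on_iff_nonneg integrable_restrict_space set_integrable_def)
qed

lemma L2_on_cong_negligible:
  assumes f: "L2_on a b f" and N: "negligible N" and eq: "\<And>x. x \<in> {a<..<b} - N \<Longrightarrow> g x = f x"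
  shows "L2_on a b g"
proof -
  have nN: "N \<inter> {a<..<b} \<in> null_sets (lebesgue_on {a<..<b})"
    using N negligible_Int[of N "{a<..<b}"]
    by (subst null_sets_restrict_space) (auto simp: negligible_iff_null_sets negligible_Int)
  have D: "{a<..<b} - N \<inter> {a<..<b} = {a<..<b} - N" by auto
  have "f \<in> borel_measurable (lebesgue_on ({a<..<b} - N))"
    by (rule measurable_restrict_mono[of f lebesgue "{a<..<b}"]) (use f in \<open>simp_all add: L2_on_def\<close>)
  moreover have "g \<in> borel_measurable (lebesgue_on ({a<..<b} - N)) \<longleftrightarrow> f \<in> borel_measurable (lebesgue_on ({a<..<b} - N))"
    by (rule measurable_cong) (use eq in simp)
  ultimately have "g \<in> borel_measurable (lebesgue_on ({a<..<b} - N))" by simp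
  then have m: "g \<in> borel_measurable (lebesgue_on {a<..<b})"
    using borel_measurable_diff_null[OF nN, of g] D by simp
  have "AE x in lebesgue_on {a<..<b}. (cmod (f x))\<^sup>2 = (cmod (g x))\<^sup>2"
    using N eq by (subst AE_lebesgue_on_iff_negligible) (auto intro!: exI[of _ N])
  then have "integrable (lebesgue_on {a<..<b}) (\<lambda>x. (cmod (f x))\<^sup>2) \<longleftrightarrow> integrable (lebesgue_on {a<..<b}) (\<lambda>x. (cmod (g x))\<^sup>2)"
    using f m by (intro integrable_cong_AE) (auto simp: L2_on_def)
  then show ?thesis using f m by (simp add: L2_on_def)
qed

section \<open>The first order system for a solution and its quasi-derivative\<close>

locale pencil =
  fixes p \<sigma> :: "real \<Rightarrow> complex"
  assumes L2_p: "L2_on 0 pi p" and L2_\<sigma>: "L2_on 0 pi \<sigma>"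
begin

lemma sq_p: "sq_int 0 pi p" and sq_\<sigma>: "sq_int 0 pi \<sigma>"
  using L2_p L2_\<sigma> by (auto intro: L2_on_imp_sq_int)

text \<open>The coefficient of \<open>y\<close> when the equation is solved for the derivative of
  the quasi-derivative: the system is \<open>y' = \<sigma> y + y1\<close>,
  \<open>y1' = q y - \<sigma> y1\<close>.\<close>

definition q :: "complex \<Rightarrow> real \<Rightarrow> complex" where
  "q z s = 2 * z * p s - (\<sigma> s)\<^sup>2 - z\<^sup>2"

definition T1 :: "(real \<Rightarrow> complex) \<Rightarrow> (real \<Rightarrow> complex) \<Rightarrow> real \<Rightarrow> complex" where
  "T1 u v x = integral {0..x} (\<lambda>s. \<sigma> s * u s + v s)"

definition T2 :: "complex \<Rightarrow> (real \<Rightarrow> complex) \<Rightarrow> (real \<Rightarrow> complex) \<Rightarrow> real \<Rightarrow> complex" where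
  "T2 z u v x = integral {0..x} (\<lambda>s. q z s * u s - \<sigma> s * v s)"

text \<open>For \<open>cmod z \<le> R\<close> it dominates
  \<open>cmod (\<sigma> s) + cmod (q z s)\<close>, the total weight of \<open>u\<close> in the
  integrands of \<open>T1\<close> and \<open>T2\<close>, and \<open>1 + cmod (\<sigma> s)\<close>,
  the weight of \<open>v\<close>. One bound is thus uniform on a disc of spectral
  parameters.\<close>

definition kernel :: "real \<Rightarrow> real \<Rightarrow> real" where
  "kernel R s = 1 + 2 * cmod (\<sigma> s) + (cmod (\<sigma> s))\<^sup>2 + 2 * R * cmod (p s) + R\<^sup>2"

definition E :: "real \<Rightarrow> real \<Rightarrow> real" where
  "E R s = exp (2 * integral {0..s} (kernel R))"

definition volterra_sol :: "complex \<Rightarrow> (real \<Rightarrow> complex) \<Rightarrow> (real \<Rightarrow> complex) \<Rightarrow> bool" where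
  "volterra_sol z u v \<longleftrightarrow> continuous_on {0..pi} u \<and> continuous_on {0..pi} v \<and>
     (\<forall>x\<in>{0..pi}. u x = T1 u v x \<and> v x = 1 + T2 z u v x)"

lemma abs_int_\<sigma>: "\<sigma> absolutely_integrable_on {0..pi}"
  and abs_int_p: "p absolutely_integrable_on {0..pi}"
  and abs_int_\<sigma>2: "(\<lambda>s. (\<sigma> s)\<^sup>2) absolutely_integrable_on {0..pi}"
  using sq_int_abs_int[OF sq_\<sigma>] sq_int_abs_int[OF sq_p] sq_int_norm_mult(1)[OF sq_\<sigma> sq_\<sigma>]
  by (simp_all add: power2_eq_square)

lemma abs_int_q: "q z absolutely_integrable_on {0..pi}"
proof -
  have "(\<lambda>s. 2 * z * p s) absolutely_integrable_on {0..pi}"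
    using abs_int_p by (rule set_integrable_mult_right)
  then have "(\<lambda>s. 2 * z * p s - (\<sigma> s)\<^sup>2 - z\<^sup>2) absolutely_integrable_on {0..pi}"
    using abs_int_\<sigma>2 by (intro set_integral_diff(1)) (auto intro: absolutely_integrable_continuous_real)
  moreover have "q z = (\<lambda>s. 2 * z * p s - (\<sigma> s)\<^sup>2 - z\<^sup>2)" by (simp add: fun_eq_iff q_def)
  ultimately show ?thesis by simp
qed

lemma abs_int_kernel: "kernel R absolutely_integrable_on {0..pi}"
proof -
  have "(\<lambda>s. cmod (\<sigma> s)) absolutely_integrable_on {0..pi}" "(\<lambda>s. cmod (p s)) absolutely_integrable_on {0..pi}"
    "(\<lambda>s. (cmod (\<sigma> s))\<^sup>2) absolutely_integrable_on {0..pi}"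
    using absolutely_integrable_norm[OF abs_int_\<sigma>] absolutely_integrable_norm[OF abs_int_p]
     absolutely_integrable_norm[OF abs_int_\<sigma>2] by (simp_all add: o_def norm_power)
  then have "(\<lambda>s. 1 + 2 * cmod (\<sigma> s) + (cmod (\<sigma> s))\<^sup>2 + (2 * R) * cmod (p s) + R\<^sup>2) absolutely_integrable_on {0..pi}"
    by (intro set_integral_add(1) set_integrable_mult_right) (auto intro: absolutely_integrable_continuous_real)
  moreover have "kernel R = (\<lambda>s. 1 + 2 * cmod (\<sigma> s) + (cmod (\<sigma> s))\<^sup>2 + (2 * R) * cmod (p s) + R\<^sup>2)"
    by (simp add: fun_eq_iff kernel_def)
  ultimately show ?thesis by simp
qed

lemma kernel_nonneg: "R \<ge> 0 \<Longrightarrow> kernel R s \<ge> 0"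
  by (simp add: kernel_def)

lemma
  assumes "continuous_on {0..pi} u" "continuous_on {0..pi} v"
  shows abs_int_1: "(\<lambda>s. \<sigma> s * u s + v s) absolutely_integrable_on {0..pi}"
    and abs_int_2: "(\<lambda>s. q z s * u s - \<sigma> s * v s) absolutely_integrable_on {0..pi}"
  by (rule set_integral_add(1)[OF abs_int_times_continuous[OF abs_int_\<sigma> assms(1)]
        absolutely_integrable_continuous_real[OF assms(2)]])
    (rule set_integral_diff(1)[OF abs_int_times_continuous[OF abs_int_q assms(1)]
        abs_int_times_continuous[OF abs_int_\<sigma> assms(2)]])

lemma abs_intD:
  fixes f :: "real \<Rightarrow> 'a::euclidean_space"
  assumes "f absolutely_integrable_on {0..pi}" "x \<le> pi"
  shows "f integrable_on {0..x}" "(\<lambda>s. norm (f s)) integrable_on {0..x}"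
  using abs_int_subinterval[OF assms(1), of 0 x] assms(2) by (auto simp: absolutely_integrable_on_def)

lemma
  assumes "continuous_on {0..pi} u" "continuous_on {0..pi} v"
  shows continuous_T1: "continuous_on {0..pi} (T1 u v)"
    and continuous_T2: "continuous_on {0..pi} (T2 z u v)"
  unfolding T1_def T2_def
  by (intro indefinite_integral_continuous_1 abs_intD abs_int_1 abs_int_2 assms order_refl)+

lemma
  assumes "continuous_on {0..pi} u" "continuous_on {0..pi} v"
    "continuous_on {0..pi} u'" "continuous_on {0..pi} v'" "x \<in> {0..pi}"
  shows T1_diff: "T1 u v x - T1 u' v' x = T1 (\<lambda>s. u s - u' s) (\<lambda>s. v s - v' s) x"
    and T2_diff: "T2 z u v x - T2 z u' v' x = T2 z (\<lambda>s. u s - u' s) (\<lambda>s. v s - v' s) x"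
proof -
  have x: "x \<le> pi" using assms by simp
  have "T1 u v x - T1 u' v' x = integral {0..x} (\<lambda>s. (\<sigma> s * u s + v s) - (\<sigma> s * u' s + v' s))"
    unfolding T1_def
    by (rule Henstock_Kurzweil_Integration.integral_diff[symmetric]) (rule abs_intD(1)[OF abs_int_1 x] assms)+
  also have "\<dots> = T1 (\<lambda>s. u s - u' s) (\<lambda>s. v s - v' s) x"
    unfolding T1_def by (rule arg_cong[where f="integral {0..x}"]) (simp add: fun_eq_iff algebra_simps)
  finally show "T1 u v x - T1 u' v' x = T1 (\<lambda>s. u s - u' s) (\<lambda>s. v s - v' s) x" .
  have "T2 z u v x - T2 z u' v' x = integral {0..x} (\<lambda>s. (q z s * u s - \<sigma> s * v s) - (q z s * u' s - \<sigma> s * v' s))"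
    unfolding T2_def
    by (rule Henstock_Kurzweil_Integration.integral_diff[symmetric]) (rule abs_intD(1)[OF abs_int_2 x] assms)+
  also have "\<dots> = T2 z (\<lambda>s. u s - u' s) (\<lambda>s. v s - v' s) x"
    unfolding T2_def by (rule arg_cong[where f="integral {0..x}"]) (simp add: fun_eq_iff algebra_simps)
  finally show "T2 z u v x - T2 z u' v' x = T2 z (\<lambda>s. u s - u' s) (\<lambda>s. v s - v' s) x" .
qed

text \<open>In the norm weighted by \<open>E R\<close> the operator \<open>(T1, T2)\<close> is a
  contraction with factor \<open>1 / 2\<close>, uniformly for \<open>cmod z \<le> R\<close>. The
  Gronwall argument for uniqueness uses the integral form; the iteration uses the consequence
  \<open>T_weight\<close>.\<close>

lemma T_weight_integral:
  assumes u: "continuous_on {0..pi} u" "continuous_on {0..pi} v" and z: "cmod z \<le> R"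
    and D: "D \<ge> 0" "\<And>s. s \<in> {0..pi} \<Longrightarrow> cmod (u s) + cmod (v s) \<le> D * E R s" and x: "x \<in> {0..pi}"
  shows "cmod (T1 u v x) + cmod (T2 z u v x) \<le> integral {0..x} (\<lambda>s. kernel R s * (D * E R s))"
    "integral {0..x} (\<lambda>s. kernel R s * (D * E R s)) = D * (E R x - 1) / 2"
proof -
  have xp: "x \<le> pi" and x0: "0 \<le> x" using x by auto
  have R: "R \<ge> 0" using z norm_ge_zero order_trans by blast
  have hk: "((\<lambda>s. kernel R s * (D * E R s)) has_integral D * ((E R x - 1) / 2)) {0..x}"
    using has_integral_mult_right[OF exp_weight_integral[OF abs_int_kernel x0 xp], of D]
    by (simp add: E_def mult.left_commute)
  then show "integral {0..x} (\<lambda>s. kernel R s * (D * E R s)) = D * (E R x - 1) / 2"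
    by (simp add: integral_unique)
  have "cmod (T1 u v x) \<le> integral {0..x} (\<lambda>s. cmod (\<sigma> s * u s + v s))"
    unfolding T1_def
    by (intro Henstock_Kurzweil_Integration.integral_norm_bound_integral abs_intD abs_int_1 u xp order_refl)
  moreover have "cmod (T2 z u v x) \<le> integral {0..x} (\<lambda>s. cmod (q z s * u s - \<sigma> s * v s))"
    unfolding T2_def
    by (intro Henstock_Kurzweil_Integration.integral_norm_bound_integral abs_intD abs_int_2 u xp order_refl)
  moreover have "integral {0..x} (\<lambda>s. cmod (\<sigma> s * u s + v s)) + integral {0..x} (\<lambda>s. cmod (q z s * u s - \<sigma> s * v s))
     = integral {0..x} (\<lambda>s. cmod (\<sigma> s * u s + v s) + cmod (q z s * u s - \<sigma> s * v s))"
    by (intro Henstock_Kurzweil_Integration.integral_add[symmetric] abs_intD abs_int_1 abs_int_2 u xp)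
  moreover have "\<dots> \<le> integral {0..x} (\<lambda>s. kernel R s * (D * E R s))"
  proof (rule Henstock_Kurzweil_Integration.integral_le)
    show "(\<lambda>s. kernel R s * (D * E R s)) integrable_on {0..x}" using hk by (rule has_integral_integrable)
    show "(\<lambda>s. cmod (\<sigma> s * u s + v s) + cmod (q z s * u s - \<sigma> s * v s)) integrable_on {0..x}"
      by (intro integrable_add abs_intD abs_int_1 abs_int_2 u xp)
    fix s assume s: "s \<in> {0..x}"
    have "cmod (q z s) \<le> 2 * R * cmod (p s) + (cmod (\<sigma> s))\<^sup>2 + R\<^sup>2"
    proof -
      have "cmod (q z s) \<le> cmod (2 * z * p s) + cmod ((\<sigma> s)\<^sup>2) + cmod (z\<^sup>2)"
        unfolding q_def
        by (rule order_trans[OF norm_triangle_ineq4 add_right_mono[OF norm_triangle_ineq4]])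
      also have "\<dots> \<le> 2 * R * cmod (p s) + (cmod (\<sigma> s))\<^sup>2 + R\<^sup>2"
        using z by (auto simp: norm_mult norm_power intro!: add_mono mult_right_mono power_mono)
      finally show ?thesis .
    qed
    then have "cmod (q z s) * cmod (u s) \<le> (2 * R * cmod (p s) + (cmod (\<sigma> s))\<^sup>2 + R\<^sup>2) * cmod (u s)"
      by (rule mult_right_mono) simp
    moreover have "cmod (\<sigma> s * u s + v s) \<le> cmod (\<sigma> s) * cmod (u s) + cmod (v s)"
      using norm_triangle_ineq[of "\<sigma> s * u s" "v s"] by (simp add: norm_mult)
    moreover have "cmod (q z s * u s - \<sigma> s * v s) \<le> cmod (q z s) * cmod (u s) + cmod (\<sigma> s) * cmod (v s)"
      using norm_triangle_ineq4[of "q z s * u s" "\<sigma> s * v s"] by (simp add: norm_mult)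
    ultimately have "cmod (\<sigma> s * u s + v s) + cmod (q z s * u s - \<sigma> s * v s) \<le>
       (cmod (\<sigma> s) + (2 * R * cmod (p s) + (cmod (\<sigma> s))\<^sup>2 + R\<^sup>2)) * cmod (u s) + (1 + cmod (\<sigma> s)) * cmod (v s)"
      by (simp add: algebra_simps)
    also have "\<dots> \<le> kernel R s * cmod (u s) + kernel R s * cmod (v s)"
      using R by (intro add_mono mult_right_mono) (auto simp: kernel_def)
    also have "\<dots> = kernel R s * (cmod (u s) + cmod (v s))" by (simp add: algebra_simps)
    also have "\<dots> \<le> kernel R s * (D * E R s)"
      using D(2)[of s] s xp kernel_nonneg[OF R] by (intro mult_left_mono) auto
    finally show "cmod (\<sigma> s * u s + v s) + cmod (q z s * u s - \<sigma> s * v s) \<le> kernel R s * (D * E R s)" .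
  qed
  ultimately show "cmod (T1 u v x) + cmod (T2 z u v x) \<le> integral {0..x} (\<lambda>s. kernel R s * (D * E R s))"
    by linarith
qed

lemma E_ge_1:
  assumes "R \<ge> 0" "s \<in> {0..pi}"
  shows "E R s \<ge> 1"
proof -
  have "integral {0..s} (kernel R) \<ge> 0"
    using assms by (intro Henstock_Kurzweil_Integration.integral_nonneg abs_intD abs_int_kernel kernel_nonneg) auto
  then show ?thesis by (simp add: E_def)
qed

lemma T_weight:
  assumes u: "continuous_on {0..pi} u" "continuous_on {0..pi} v" and z: "cmod z \<le> R"
    and D: "D \<ge> 0" "\<And>s. s \<in> {0..pi} \<Longrightarrow> cmod (u s) + cmod (v s) \<le> D * E R s" and x: "x \<in> {0..pi}"
  shows "cmod (T1 u v x) + cmod (T2 z u v x) \<le> D / 2 * E R x"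
proof -
  have "D * (E R x - 1) / 2 \<le> D / 2 * E R x" using D(1) by (simp add: algebra_simps)
  then show ?thesis using T_weight_integral[OF assms] by linarith
qed

lemma volterra_sol_unique:
  assumes "volterra_sol z u v" "volterra_sol z u' v'" "x \<in> {0..pi}"
  shows "u x = u' x \<and> v x = v' x"
proof -
  define a where "a = (\<lambda>s. u s - u' s)"
  define b where "b = (\<lambda>s. v s - v' s)"
  define R where "R = cmod z"
  have c: "continuous_on {0..pi} a" "continuous_on {0..pi} b"
    using assms unfolding a_def b_def volterra_sol_def by (auto intro!: continuous_intros)
  have eq: "a s = T1 a b s" "b s = T2 z a b s" if "s \<in> {0..pi}" for s
    using assms that T1_diff[of u v u' v' s] T2_diff[of u v u' v' s z]
    unfolding a_def b_def volterra_sol_def by auto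
  have "continuous_on {0..pi} (\<lambda>s. cmod (a s) + cmod (b s))" using c by (intro continuous_intros)
  from compact_imp_bounded[OF compact_continuous_image[OF this compact_Icc]]
  obtain B where "\<forall>s\<in>{0..pi}. \<bar>cmod (a s) + cmod (b s)\<bar> \<le> B"
    unfolding bounded_iff by auto
  then have B: "cmod (a s) + cmod (b s) \<le> B" if "s \<in> {0..pi}" for s
    using that abs_le_D1 by blast
  have "cmod (a x) + cmod (b x) \<le> 2 * 0 * exp (2 * integral {0..x} (kernel R))"
  proof (rule gronwall_family[where I="\<lambda>_. {()}" and f="\<lambda>s _. cmod (a s) + cmod (b s)" and X=pi and B=B])
    show "kernel R absolutely_integrable_on {0..pi}" by (rule abs_int_kernel)
    fix D y i assume *: "D \<ge> 0" "\<And>s j. s \<in> {0..pi} \<Longrightarrow> j \<in> {()} \<Longrightarrow> cmod (a s) + cmod (b s) \<le> D * exp (2 * integral {0..s} (kernel R))"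
      "y \<in> {0..pi}"
    show "cmod (a y) + cmod (b y) \<le> 0 + integral {0..y} (\<lambda>s. kernel R s * (D * exp (2 * integral {0..s} (kernel R))))"
      using T_weight_integral(1)[OF c, of z R D y] * eq[OF *(3)] by (simp add: E_def R_def)
  qed (use assms B in \<open>auto simp: R_def kernel_nonneg\<close>)
  then have "cmod (a x) + cmod (b x) \<le> 0" by simp
  then have "cmod (a x) = 0" "cmod (b x) = 0" using norm_ge_zero[of "a x"] norm_ge_zero[of "b x"] by linarith+
  then show ?thesis by (simp add: a_def b_def)
qed

section \<open>Picard iteration\<close>

primrec picard :: "nat \<Rightarrow> complex \<Rightarrow> (real \<Rightarrow> complex) \<times> (real \<Rightarrow> complex)" where
  "picard 0 z = (\<lambda>_. 0, \<lambda>_. 1)"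
| "picard (Suc n) z = (T1 (fst (picard n z)) (snd (picard n z)), \<lambda>x. 1 + T2 z (fst (picard n z)) (snd (picard n z)) x)"

lemma continuous_picard:
  "continuous_on {0..pi} (fst (picard n z)) \<and> continuous_on {0..pi} (snd (picard n z))"
  by (induction n) (auto intro!: continuous_T1 continuous_T2 continuous_on_add)

definition inc1 :: "nat \<Rightarrow> complex \<Rightarrow> real \<Rightarrow> complex" where
  "inc1 n z x = fst (picard (Suc n) z) x - fst (picard n z) x"

definition inc2 :: "nat \<Rightarrow> complex \<Rightarrow> real \<Rightarrow> complex" where
  "inc2 n z x = snd (picard (Suc n) z) x - snd (picard n z) x"

lemma fst_picard_Suc: "fst (picard (Suc n) z) x = T1 (fst (picard n z)) (snd (picard n z)) x"
  and snd_picard_Suc: "snd (picard (Suc n) z) x = 1 + T2 z (fst (picard n z)) (snd (picard n z)) x"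
  by simp_all

text \<open>Each step halves the weighted norm by \<open>T_weight\<close>; the start
  \<open>(0, 1)\<close> has weighted norm at most \<open>1\<close> since
  \<open>E R \<ge> 1\<close>.\<close>

lemma inc_bound:
  assumes "cmod z \<le> R" "x \<in> {0..pi}"
  shows "cmod (inc1 n z x) + cmod (inc2 n z x) \<le> (1/2) ^ Suc n * E R x"
  using assms(2)
proof (induction n arbitrary: x)
  case 0
  have R: "R \<ge> 0" using assms norm_ge_zero order_trans by blast
  have "cmod (T1 (\<lambda>_. 0) (\<lambda>_. 1) x) + cmod (T2 z (\<lambda>_. 0) (\<lambda>_. 1) x) \<le> 1 / 2 * E R x"
    by (rule T_weight) (use assms 0 E_ge_1[OF R] in auto)
  then show ?case by (simp add: inc1_def inc2_def)
next
  case (Suc n)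
  have d: "inc1 n z = (\<lambda>s. fst (picard (Suc n) z) s - fst (picard n z) s)"
    "inc2 n z = (\<lambda>s. snd (picard (Suc n) z) s - snd (picard n z) s)"
    by (rule ext, rule inc1_def) (rule ext, rule inc2_def)
  have c: "continuous_on {0..pi} (inc1 n z)" "continuous_on {0..pi} (inc2 n z)"
    unfolding d using continuous_picard by (blast intro: continuous_on_diff)+
  have "inc1 (Suc n) z x = T1 (fst (picard (Suc n) z)) (snd (picard (Suc n) z)) x - T1 (fst (picard n z)) (snd (picard n z)) x"
    by (simp only: inc1_def fst_picard_Suc)
  also have "\<dots> = T1 (inc1 n z) (inc2 n z) x"
    unfolding d by (rule T1_diff) (use continuous_picard Suc.prems in blast)+
  finally have "inc1 (Suc n) z x = T1 (inc1 n z) (inc2 n z) x" .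
  moreover have "inc2 (Suc n) z x = T2 z (fst (picard (Suc n) z)) (snd (picard (Suc n) z)) x - T2 z (fst (picard n z)) (snd (picard n z)) x"
    by (simp only: inc2_def snd_picard_Suc add_diff_cancel_left)
  moreover have "\<dots> = T2 z (inc1 n z) (inc2 n z) x"
    unfolding d by (rule T2_diff) (use continuous_picard Suc.prems in blast)+
  ultimately show ?case
    using T_weight[OF c assms(1), of "(1/2) ^ Suc n" x] Suc by simp
qed

end

text \<open>Polynomials in \<open>z\<close> whose coefficients are continuous in \<open>x\<close>.
  All Picard iterates are of this kind on \<open>[0, pi]\<close>, so their holomorphy in
  \<open>z\<close> is evident without differentiation under an integral sign.\<close>

inductive poly_family :: "(complex \<Rightarrow> real \<Rightarrow> complex) \<Rightarrow> bool" where
  monomial: "continuous_on {0..pi} c \<Longrightarrow> poly_family (\<lambda>z x. z ^ k * c x)"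
| add: "poly_family g \<Longrightarrow> poly_family h \<Longrightarrow> poly_family (\<lambda>z x. g z x + h z x)"

lemma poly_family_times_power:
  assumes "poly_family g"
  shows "poly_family (\<lambda>z x. z ^ m * g z x)"
  using assms
proof induction
  case (monomial c k)
  have "(\<lambda>z x. z ^ m * (z ^ k * c x)) = (\<lambda>(z::complex) x. z ^ (m + k) * c x)"
    by (simp add: power_add mult.assoc)
  then show ?case using poly_family.monomial[OF monomial, of "m + k"] by simp
next
  case (add g h)
  have "(\<lambda>z x. z ^ m * (g z x + h z x)) = (\<lambda>z x. z ^ m * g z x + z ^ m * h z x)"
    by (simp add: distrib_left)
  then show ?case using poly_family.add[OF add.IH] by simp
qed

lemma poly_family_continuous: "poly_family g \<Longrightarrow> continuous_on {0..pi} (g z)"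
  by (induction rule: poly_family.induct) (auto intro!: continuous_intros)

lemma poly_family_holomorphic: "poly_family g \<Longrightarrow> (\<lambda>z. g z x) holomorphic_on UNIV"
  by (induction rule: poly_family.induct) (auto intro!: holomorphic_intros)

text \<open>The powers of \<open>z\<close> leave the integral, and only the coefficient functions
  are integrated.\<close>

lemma poly_family_integral:
  assumes "poly_family g" and r: "r absolutely_integrable_on {0..pi}"
  shows "\<exists>h. poly_family h \<and> (\<forall>z. \<forall>x\<in>{0..pi}. integral {0..x} (\<lambda>s. r s * g z s) = h z x)"
  using assms(1)
proof induction
  case (monomial c k)
  define C where "C = (\<lambda>x. integral {0..x} (\<lambda>s. r s * c s))"
  have rc: "(\<lambda>s. r s * c s) absolutely_integrable_on {0..pi}"
    by (rule abs_int_times_continuous[OF r monomial])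
  have "continuous_on {0..pi} C" unfolding C_def
    by (rule indefinite_integral_continuous_1) (use rc in \<open>simp add: absolutely_integrable_on_def\<close>)
  then have "poly_family (\<lambda>z x. z ^ k * C x)" by (rule poly_family.monomial)
  moreover have "integral {0..x} (\<lambda>s. r s * (z ^ k * c s)) = z ^ k * C x" for z x
  proof -
    have "(\<lambda>s. r s * (z ^ k * c s)) = (\<lambda>s. z ^ k * (r s * c s))" by (simp add: fun_eq_iff algebra_simps)
    then show ?thesis by (simp add: C_def)
  qed
  ultimately show ?case by blast
next
  case (add g h)
  then obtain G H where G: "poly_family G" "\<And>z x. x\<in>{0..pi} \<Longrightarrow> integral {0..x} (\<lambda>s. r s * g z s) = G z x"
    and H: "poly_family H" "\<And>z x. x\<in>{0..pi} \<Longrightarrow> integral {0..x} (\<lambda>s. r s * h z s) = H z x"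
    by blast
  have "integral {0..x} (\<lambda>s. r s * (g z s + h z s)) = G z x + H z x" if x: "x \<in> {0..pi}" for z x
  proof -
    have i: "(\<lambda>s. r s * g z s) integrable_on {0..x}" "(\<lambda>s. r s * h z s) integrable_on {0..x}"
      using abs_int_subinterval[OF abs_int_times_continuous[OF r poly_family_continuous[OF add.hyps(1), of z]], of 0 x]
        abs_int_subinterval[OF abs_int_times_continuous[OF r poly_family_continuous[OF add.hyps(2), of z]], of 0 x] x
      by (auto simp: absolutely_integrable_on_def)
    then show ?thesis
      by (simp add: distrib_left Henstock_Kurzweil_Integration.integral_add G(2)[OF x] H(2)[OF x])
  qed
  then show ?case using poly_family.add[OF G(1) H(1)] by blast
qed

lemma ac_deriv_transform:
  assumes F: "ac_deriv a b F f" and eq: "\<And>x. x \<in> {a..b} \<Longrightarrow> F x = G x"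
  shows "ac_deriv a b G f"
proof -
  obtain N where N: "negligible N" "\<forall>x\<in>{a<..<b} - N. (F has_vector_derivative f x) (at x)"
    using F unfolding ac_deriv_def by blast
  have "abs_cont_on a b G"
    using abs_cont_on_dominated[of a b F F 1 0 0 G] F eq by (simp add: ac_deriv_def)
  moreover have "(G has_vector_derivative f x) (at x)" if x: "x \<in> {a<..<b} - N" for x
    by (rule has_vector_derivative_transform_within_open[of F _ _ "{a<..<b}"]) (use x N eq in auto)
  ultimately show ?thesis using N(1) unfolding ac_deriv_def by blast
qed

context pencil
begin

lemma E_mono:
  assumes "R \<ge> 0" "x \<in> {0..pi}"
  shows "E R x \<le> E R pi"
proof -
  have "integral {0..x} (kernel R) \<le> integral {0..pi} (kernel R)"
    using assms by (intro integral_subset_le abs_intD abs_int_kernel) (auto simp: kernel_nonneg)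
  then show ?thesis by (simp add: E_def)
qed

definition ysol :: "complex \<Rightarrow> real \<Rightarrow> complex" where
  "ysol z x = (\<Sum>n. inc1 n z x)"

definition y1sol :: "complex \<Rightarrow> real \<Rightarrow> complex" where
  "y1sol z x = 1 + (\<Sum>n. inc2 n z x)"

text \<open>Telescoping series with the majorant \<open>(1/2) ^ Suc n * E R pi\<close>. Uniformity
  is joint in \<open>x\<close> and \<open>z\<close>, so it yields both continuity in
  \<open>x\<close> and holomorphy in \<open>z\<close>.\<close>

lemma picard_uniform_limit:
  assumes "R \<ge> 0"
  shows "uniform_limit ({0..pi} \<times> cball 0 R) (\<lambda>n (x, z). fst (picard n z) x) (\<lambda>(x, z). ysol z x) sequentially"
    and "uniform_limit ({0..pi} \<times> cball 0 R) (\<lambda>n (x, z). snd (picard n z) x) (\<lambda>(x, z). y1sol z x) sequentially"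
proof -
  define M where "M = (\<lambda>n. (1/2) ^ Suc n * E R pi)"
  have M: "summable M" unfolding M_def
    by (intro summable_mult2 summable_ignore_initial_segment[where k=1, simplified] summable_geometric) simp
  have b: "cmod (inc1 n z x) \<le> M n \<and> cmod (inc2 n z x) \<le> M n" if "(x, z) \<in> {0..pi} \<times> cball 0 R" for n x z
  proof -
    have "cmod (inc1 n z x) + cmod (inc2 n z x) \<le> (1/2) ^ Suc n * E R x"
      using that by (intro inc_bound) auto
    also have "\<dots> \<le> M n" unfolding M_def
      using that assms by (intro mult_left_mono E_mono) auto
    finally show ?thesis
      using norm_ge_zero[of "inc1 n z x"] norm_ge_zero[of "inc2 n z x"] by linarith
  qed
  have s: "(\<Sum>i<n. inc1 i z x) = fst (picard n z) x" "1 + (\<Sum>i<n. inc2 i z x) = snd (picard n z) x" for n z x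
    using sum_lessThan_telescope[of "\<lambda>i. fst (picard i z) x" n] sum_lessThan_telescope[of "\<lambda>i. snd (picard i z) x" n]
    by (simp_all add: inc1_def inc2_def del: picard.simps(2))
  have "uniform_limit ({0..pi} \<times> cball 0 R) (\<lambda>n xz. \<Sum>i<n. inc1 i (snd xz) (fst xz)) (\<lambda>xz. \<Sum>i. inc1 i (snd xz) (fst xz)) sequentially"
    by (rule Weierstrass_m_test[OF _ M]) (use b in force)
  then show "uniform_limit ({0..pi} \<times> cball 0 R) (\<lambda>n (x, z). fst (picard n z) x) (\<lambda>(x, z). ysol z x) sequentially"
    by (simp add: s ysol_def case_prod_unfold)
  have "uniform_limit ({0..pi} \<times> cball 0 R) (\<lambda>n xz. \<Sum>i<n. inc2 i (snd xz) (fst xz)) (\<lambda>xz. \<Sum>i. inc2 i (snd xz) (fst xz)) sequentially"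
    by (rule Weierstrass_m_test[OF _ M]) (use b in force)
  then have "uniform_limit ({0..pi} \<times> cball 0 R) (\<lambda>n xz. 1 + (\<Sum>i<n. inc2 i (snd xz) (fst xz)))
      (\<lambda>xz. 1 + (\<Sum>i. inc2 i (snd xz) (fst xz))) sequentially"
    by (intro uniform_limit_add uniform_limit_const)
  then show "uniform_limit ({0..pi} \<times> cball 0 R) (\<lambda>n (x, z). snd (picard n z) x) (\<lambda>(x, z). y1sol z x) sequentially"
    by (simp add: s y1sol_def case_prod_unfold)
qed

lemma picard_uniform_limit_x:
  shows "uniform_limit {0..pi} (\<lambda>n. fst (picard n z)) (ysol z) sequentially"
    and "uniform_limit {0..pi} (\<lambda>n. snd (picard n z)) (y1sol z) sequentially"
proof -
  show "uniform_limit {0..pi} (\<lambda>n. fst (picard n z)) (ysol z) sequentially"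
    using uniform_limit_compose'[OF picard_uniform_limit(1)[of "cmod z"], of "\<lambda>x. (x, z)" "{0..pi}"] by simp
  show "uniform_limit {0..pi} (\<lambda>n. snd (picard n z)) (y1sol z) sequentially"
    using uniform_limit_compose'[OF picard_uniform_limit(2)[of "cmod z"], of "\<lambda>x. (x, z)" "{0..pi}"] by simp
qed

lemma continuous_ysol: "continuous_on {0..pi} (ysol z)"
  and continuous_y1sol: "continuous_on {0..pi} (y1sol z)"
  using continuous_picard
  by (auto intro!: uniform_limit_theorem[OF _ picard_uniform_limit_x(1)] uniform_limit_theorem[OF _ picard_uniform_limit_x(2)])

text \<open>By \<open>T_weight\<close> the operators are continuous under uniform convergence, so
  the recursion passes to the limit.\<close>

lemma volterra_sol_ysol: "volterra_sol z (ysol z) (y1sol z)"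
  unfolding volterra_sol_def
proof (intro conjI ballI continuous_ysol continuous_y1sol)
  fix x assume x: "x \<in> {0..pi}"
  define R where "R = cmod z"
  have R: "R \<ge> 0" by (simp add: R_def)
  have lim: "(\<lambda>n. T1 (fst (picard n z)) (snd (picard n z)) x) \<longlonglongrightarrow> T1 (ysol z) (y1sol z) x \<and>
     (\<lambda>n. T2 z (fst (picard n z)) (snd (picard n z)) x) \<longlonglongrightarrow> T2 z (ysol z) (y1sol z) x"
    unfolding LIMSEQ_iff
  proof (intro conjI allI impI)
    have key: "\<exists>N. \<forall>n\<ge>N. cmod (T1 (fst (picard n z)) (snd (picard n z)) x - T1 (ysol z) (y1sol z) x) +
       cmod (T2 z (fst (picard n z)) (snd (picard n z)) x - T2 z (ysol z) (y1sol z) x) < e" if e: "e > 0" for e :: real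
    proof -
      define \<delta> where "\<delta> = e / (2 * E R pi)"
      have Epos: "E R pi > 0" by (simp add: E_def)
      have \<delta>: "\<delta> > 0" using e Epos by (simp add: \<delta>_def)
      have "\<forall>\<^sub>F n in sequentially. (\<forall>s\<in>{0..pi}. dist (fst (picard n z) s) (ysol z s) < \<delta>) \<and>
         (\<forall>s\<in>{0..pi}. dist (snd (picard n z) s) (y1sol z s) < \<delta>)"
        using uniform_limitD[OF picard_uniform_limit_x(1) \<delta>] uniform_limitD[OF picard_uniform_limit_x(2) \<delta>]
        by (rule eventually_conj)
      then obtain N where N: "\<And>n s. n \<ge> N \<Longrightarrow> s \<in> {0..pi} \<Longrightarrow> dist (fst (picard n z) s) (ysol z s) < \<delta> \<and> dist (snd (picard n z) s) (y1sol z s) < \<delta>"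
        unfolding eventually_sequentially by blast
      have "cmod (T1 (fst (picard n z)) (snd (picard n z)) x - T1 (ysol z) (y1sol z) x) +
         cmod (T2 z (fst (picard n z)) (snd (picard n z)) x - T2 z (ysol z) (y1sol z) x) < e" if n: "n \<ge> N" for n
      proof -
        define u where "u = (\<lambda>s. fst (picard n z) s - ysol z s)"
        define v where "v = (\<lambda>s. snd (picard n z) s - y1sol z s)"
        have c: "continuous_on {0..pi} u" "continuous_on {0..pi} v"
          unfolding u_def v_def using continuous_picard[of n z] continuous_ysol continuous_y1sol by (auto intro!: continuous_on_diff)
        have "cmod (T1 u v x) + cmod (T2 z u v x) \<le> (2 * \<delta>) / 2 * E R x"
        proof (rule T_weight[OF c])
          fix s assume s: "s \<in> {0..pi}"
          have "cmod (u s) + cmod (v s) \<le> 2 * \<delta> * 1"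
            using N[OF n s] by (simp add: u_def v_def dist_norm)
          also have "\<dots> \<le> 2 * \<delta> * E R s" using E_ge_1[OF R s] \<delta> by (intro mult_left_mono) auto
          finally show "cmod (u s) + cmod (v s) \<le> 2 * \<delta> * E R s" .
        qed (use \<delta> x in \<open>auto simp: R_def\<close>)
        also have "\<dots> \<le> \<delta> * E R pi" using E_mono[OF R x] \<delta> by simp
        also have "\<dots> < e" using e Epos by (simp add: \<delta>_def)
        finally show ?thesis
          unfolding u_def v_def
          using T1_diff[of "fst (picard n z)" "snd (picard n z)" "ysol z" "y1sol z" x]
            T2_diff[of "fst (picard n z)" "snd (picard n z)" "ysol z" "y1sol z" x z] continuous_picard[of n z] continuous_ysol continuous_y1sol x
          by simp
      qed
      then show ?thesis by blast
    qed
    fix e :: real assume e: "e > 0"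
    from key[OF e] obtain N where N: "\<And>n. n \<ge> N \<Longrightarrow> cmod (T1 (fst (picard n z)) (snd (picard n z)) x - T1 (ysol z) (y1sol z) x) +
       cmod (T2 z (fst (picard n z)) (snd (picard n z)) x - T2 z (ysol z) (y1sol z) x) < e" by blast
    show "\<exists>no. \<forall>n\<ge>no. cmod (T1 (fst (picard n z)) (snd (picard n z)) x - T1 (ysol z) (y1sol z) x) < e"
      using N by (meson norm_ge_zero add_increasing2 order_refl order_le_less_trans)
    show "\<exists>no. \<forall>n\<ge>no. cmod (T2 z (fst (picard n z)) (snd (picard n z)) x - T2 z (ysol z) (y1sol z) x) < e"
      using N by (meson norm_ge_zero add_increasing order_refl order_le_less_trans)
  qed
  have l1: "(\<lambda>n. fst (picard (Suc n) z) x) \<longlonglongrightarrow> ysol z x"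
    using tendsto_uniform_limitI[OF picard_uniform_limit_x(1) x] by (rule LIMSEQ_Suc)
  have l2: "(\<lambda>n. snd (picard (Suc n) z) x) \<longlonglongrightarrow> y1sol z x"
    using tendsto_uniform_limitI[OF picard_uniform_limit_x(2) x] by (rule LIMSEQ_Suc)
  show "ysol z x = T1 (ysol z) (y1sol z) x"
    by (rule LIMSEQ_unique[OF l1]) (use lim in \<open>simp only: fst_picard_Suc\<close>)
  have "(\<lambda>n. 1 + T2 z (fst (picard n z)) (snd (picard n z)) x) \<longlonglongrightarrow> 1 + T2 z (ysol z) (y1sol z) x"
    using lim by (intro tendsto_intros) auto
  then show "y1sol z x = 1 + T2 z (ysol z) (y1sol z) x"
    by (intro LIMSEQ_unique[OF l2]) (simp only: snd_picard_Suc)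
qed

lemma picard_poly_family:
  "\<exists>g h. poly_family g \<and> poly_family h \<and> (\<forall>z. \<forall>x\<in>{0..pi}. fst (picard n z) x = g z x \<and> snd (picard n z) x = h z x)"
proof (induction n)
  case 0
  have "poly_family (\<lambda>z x. z ^ 0 * 0)" "poly_family (\<lambda>z x. z ^ 0 * 1)"
    by (rule poly_family.monomial, simp)+
  then show ?case by (intro exI[of _ "\<lambda>z x. 0"] exI[of _ "\<lambda>z x. 1"]) simp
next
  case (Suc n)
  then obtain g h where g: "poly_family g" and h: "poly_family h"
    and eq: "\<And>z x. x \<in> {0..pi} \<Longrightarrow> fst (picard n z) x = g z x \<and> snd (picard n z) x = h z x"
    by blast
  have one: "(\<lambda>s. 1 :: complex) absolutely_integrable_on {0..pi}"
    by (auto intro: absolutely_integrable_continuous_real)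
  obtain a1 where a1: "poly_family a1" "\<And>z x. x\<in>{0..pi} \<Longrightarrow> integral {0..x} (\<lambda>s. \<sigma> s * g z s) = a1 z x"
    using poly_family_integral[OF g abs_int_\<sigma>] by blast
  obtain a2 where a2: "poly_family a2" "\<And>z x. x\<in>{0..pi} \<Longrightarrow> integral {0..x} (\<lambda>s. 1 * h z s) = a2 z x"
    using poly_family_integral[OF h one] by blast
  obtain a3 where a3: "poly_family a3" "\<And>z x. x\<in>{0..pi} \<Longrightarrow> integral {0..x} (\<lambda>s. (2 * p s) * g z s) = a3 z x"
    using poly_family_integral[OF g set_integrable_mult_right[OF abs_int_p, of 2]] by blast
  obtain a4 where a4: "poly_family a4" "\<And>z x. x\<in>{0..pi} \<Longrightarrow> integral {0..x} (\<lambda>s. (-1 * (\<sigma> s)\<^sup>2) * g z s) = a4 z x"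
    using poly_family_integral[OF g set_integrable_mult_right[OF abs_int_\<sigma>2, of "-1"]] by blast
  obtain a5 where a5: "poly_family a5" "\<And>z x. x\<in>{0..pi} \<Longrightarrow> integral {0..x} (\<lambda>s. (-1 * 1) * g z s) = a5 z x"
    using poly_family_integral[OF g set_integrable_mult_right[OF one, of "-1"]] by blast
  obtain a6 where a6: "poly_family a6" "\<And>z x. x\<in>{0..pi} \<Longrightarrow> integral {0..x} (\<lambda>s. (-1 * \<sigma> s) * h z s) = a6 z x"
    using poly_family_integral[OF h set_integrable_mult_right[OF abs_int_\<sigma>, of "-1"]] by blast
  have i: "(\<lambda>s. r s * w z s) integrable_on {0..x}" if "poly_family w" "r absolutely_integrable_on {0..pi}" "x \<in> {0..pi}" for r w z x
    using abs_intD(1)[OF abs_int_times_continuous[OF that(2) poly_family_continuous[OF that(1)]], of x] that(3) by simp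
  have f: "fst (picard (Suc n) z) x = a1 z x + a2 z x" if x: "x \<in> {0..pi}" for z x
  proof -
    have "fst (picard (Suc n) z) x = integral {0..x} (\<lambda>s. \<sigma> s * g z s + 1 * h z s)"
      unfolding fst_picard_Suc T1_def
      by (rule Henstock_Kurzweil_Integration.integral_cong) (use eq x in auto)
    also have "\<dots> = a1 z x + a2 z x"
      by (subst Henstock_Kurzweil_Integration.integral_add) (auto simp only: a1(2)[OF x] a2(2)[OF x] intro!: i[OF g abs_int_\<sigma> x] i[OF h one x])
    finally show ?thesis .
  qed
  \<comment> \<open>\<open>q z\<close> is split by powers of \<open>z\<close>: \<open>a3\<close>,
    \<open>a4\<close>, \<open>a5\<close> come from its parts with the factors \<open>z\<close>,
    \<open>1\<close>, \<open>z\<^sup>2\<close>, and \<open>a6\<close> from the term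
    \<open>- \<sigma> v\<close>.\<close>
  have s: "snd (picard (Suc n) z) x = z ^ 0 * 1 + (z ^ 1 * a3 z x + (a4 z x + (z ^ 2 * a5 z x + a6 z x)))" if x: "x \<in> {0..pi}" for z x
  proof -
    have "snd (picard (Suc n) z) x = 1 + integral {0..x} (\<lambda>s. z * ((2 * p s) * g z s) + ((-1 * (\<sigma> s)\<^sup>2) * g z s + (z^2 * ((-1 * 1) * g z s) + (-1 * \<sigma> s) * h z s)))"
      unfolding snd_picard_Suc T2_def
      by (rule arg_cong[where f="\<lambda>w. 1 + w"], rule Henstock_Kurzweil_Integration.integral_cong) (use eq x in \<open>auto simp: q_def algebra_simps\<close>)
    also have "integral {0..x} (\<lambda>s. z * ((2 * p s) * g z s) + ((-1 * (\<sigma> s)\<^sup>2) * g z s + (z^2 * ((-1 * 1) * g z s) + (-1 * \<sigma> s) * h z s)))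
      = z * a3 z x + (a4 z x + (z ^ 2 * a5 z x + a6 z x))"
    proof (rule integral_unique)
      have "((\<lambda>s. (2 * p s) * g z s) has_integral a3 z x) {0..x}" "((\<lambda>s. (-1 * (\<sigma> s)\<^sup>2) * g z s) has_integral a4 z x) {0..x}"
        "((\<lambda>s. (-1 * 1) * g z s) has_integral a5 z x) {0..x}" "((\<lambda>s. (-1 * \<sigma> s) * h z s) has_integral a6 z x) {0..x}"
        unfolding has_integral_iff
        using a3(2)[OF x] a4(2)[OF x] a5(2)[OF x] a6(2)[OF x]
          i[OF g set_integrable_mult_right[OF abs_int_p, of 2] x] i[OF g set_integrable_mult_right[OF abs_int_\<sigma>2, of "-1"] x]
          i[OF g set_integrable_mult_right[OF one, of "-1"] x] i[OF h set_integrable_mult_right[OF abs_int_\<sigma>, of "-1"] x]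
        by blast+
      then show "((\<lambda>s. z * ((2 * p s) * g z s) + ((-1 * (\<sigma> s)\<^sup>2) * g z s + (z^2 * ((-1 * 1) * g z s) + (-1 * \<sigma> s) * h z s))) has_integral
         z * a3 z x + (a4 z x + (z ^ 2 * a5 z x + a6 z x))) {0..x}"
        by (intro has_integral_add has_integral_mult_right)
    qed
    finally show ?thesis by simp
  qed
  have "poly_family (\<lambda>z x. z ^ 0 * 1 + (z ^ 1 * a3 z x + (a4 z x + (z ^ 2 * a5 z x + a6 z x))))"
    using poly_family.monomial[of "\<lambda>_. 1" 0]
    by (intro poly_family.add poly_family_times_power a3 a4 a5 a6) simp
  then show ?case using poly_family.add[OF a1(1) a2(1)] f s by blast
qed

lemma ysol_holomorphic:
  assumes x: "x \<in> {0..pi}"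
  shows "(\<lambda>z. ysol z x) holomorphic_on UNIV" "(\<lambda>z. y1sol z x) holomorphic_on UNIV"
proof -
  have h: "(\<lambda>z. fst (picard n z) x) holomorphic_on UNIV" "(\<lambda>z. snd (picard n z) x) holomorphic_on UNIV" for n
  proof -
    obtain g h where gh: "poly_family g" "poly_family h"
      "\<forall>z. \<forall>x\<in>{0..pi}. fst (picard n z) x = g z x \<and> snd (picard n z) x = h z x"
      using picard_poly_family by blast
    then have "(\<lambda>z. fst (picard n z) x) = (\<lambda>z. g z x)" "(\<lambda>z. snd (picard n z) x) = (\<lambda>z. h z x)" using x by auto
    then show "(\<lambda>z. fst (picard n z) x) holomorphic_on UNIV" "(\<lambda>z. snd (picard n z) x) holomorphic_on UNIV"
      using poly_family_holomorphic gh by auto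
  qed
  have u: "uniform_limit (cball w 1) (\<lambda>n z. fst (picard n z) x) (\<lambda>z. ysol z x) sequentially"
    "uniform_limit (cball w 1) (\<lambda>n z. snd (picard n z) x) (\<lambda>z. y1sol z x) sequentially" for w
  proof -
    have sub: "(x, z) \<in> {0..pi} \<times> cball 0 (cmod w + 1)" if "z \<in> cball w 1" for z
      using that x norm_triangle_ineq2[of z w] by (auto simp: dist_norm norm_minus_commute)
    show "uniform_limit (cball w 1) (\<lambda>n z. fst (picard n z) x) (\<lambda>z. ysol z x) sequentially"
      using uniform_limit_compose'[OF picard_uniform_limit(1)[of "cmod w + 1"], of "\<lambda>z. (x, z)" "cball w 1"] sub by simp
    show "uniform_limit (cball w 1) (\<lambda>n z. snd (picard n z) x) (\<lambda>z. y1sol z x) sequentially"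
      using uniform_limit_compose'[OF picard_uniform_limit(2)[of "cmod w + 1"], of "\<lambda>z. (x, z)" "cball w 1"] sub by simp
  qed
  show "(\<lambda>z. ysol z x) holomorphic_on UNIV"
    by (rule holomorphic_uniform_sequence[OF open_UNIV h(1)]) (use u in \<open>auto intro!: exI[of _ 1]\<close>)
  show "(\<lambda>z. y1sol z x) holomorphic_on UNIV"
    by (rule holomorphic_uniform_sequence[OF open_UNIV h(2)]) (use u in \<open>auto intro!: exI[of _ 1]\<close>)
qed

section \<open>Volterra solutions and solutions of the differential equation coincide\<close>

lemma volterra_sol_ac_deriv:
  assumes "volterra_sol z u v"
  shows "ac_deriv 0 pi u (\<lambda>s. \<sigma> s * u s + v s)"
    and "ac_deriv 0 pi v (\<lambda>s. q z s * u s - \<sigma> s * v s)"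
    and "u 0 = 0" "v 0 = 1"
proof -
  have c: "continuous_on {0..pi} u" "continuous_on {0..pi} v"
    and eq: "\<And>x. x \<in> {0..pi} \<Longrightarrow> u x = T1 u v x \<and> v x = 1 + T2 z u v x"
    using assms by (auto simp: volterra_sol_def)
  show "ac_deriv 0 pi u (\<lambda>s. \<sigma> s * u s + v s)"
    by (rule ac_deriv_transform[OF ac_deriv_indefinite_integral[OF abs_int_1[OF c]]]) (use eq in \<open>auto simp: T1_def\<close>)
  have "ac_deriv 0 pi (\<lambda>x. 1 + T2 z u v x) (\<lambda>s. 0 + (q z s * u s - \<sigma> s * v s))"
    unfolding T2_def by (intro ac_deriv_add ac_deriv_const ac_deriv_indefinite_integral[OF abs_int_2[OF c]])
  then show "ac_deriv 0 pi v (\<lambda>s. q z s * u s - \<sigma> s * v s)"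
    by (intro ac_deriv_transform[of 0 pi _ _ v]) (use eq in auto)
  show "u 0 = 0" "v 0 = 1" using eq[of 0] by (auto simp: T1_def T2_def)
qed

lemma volterra_sol_imp_is_solution:
  assumes "volterra_sol z u v"
  shows "is_solution p \<sigma> z u v"
proof -
  note A = volterra_sol_ac_deriv[OF assms]
  have c: "continuous_on {0..pi} u" using assms by (simp add: volterra_sol_def)
  obtain N1 where N1: "negligible N1" "\<And>x. x \<in> {0<..<pi} - N1 \<Longrightarrow> (u has_vector_derivative \<sigma> x * u x + v x) (at x)"
    using A(1) unfolding ac_deriv_def by blast
  obtain N2 where N2: "negligible N2" "\<And>x. x \<in> {0<..<pi} - N2 \<Longrightarrow> (v has_vector_derivative q z x * u x - \<sigma> x * v x) (at x)"
    using A(2) unfolding ac_deriv_def by blast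
  \<comment> \<open>The term with \<open>\<sigma>\<^sup>2\<close> cancels against the same term in
    the derivative of \<open>v\<close>. Hence the expression is square integrable although that
    derivative is in general only integrable.\<close>
  have ell: "ell \<sigma> u v x = z\<^sup>2 * u x - 2 * z * (p x * u x)" if "x \<in> {0<..<pi} - N2" for x
    using vector_derivative_at[OF N2(2)[OF that]] by (simp add: ell_def q_def algebra_simps)
  have "sq_int 0 pi (\<lambda>x. z\<^sup>2 * u x - 2 * z * (p x * u x))"
    by (intro sq_int_diff sq_int_cmult sq_int_continuous[OF c] sq_int_times_continuous[OF sq_p c])
  then have "L2_on 0 pi (ell \<sigma> u v)"
    using L2_on_cong_negligible[OF sq_int_imp_L2_on N2(1), of 0 pi] ell by blast
  moreover have "is_quasi_deriv \<sigma> u v"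
    unfolding is_quasi_deriv_def
    by (subst AE_lebesgue_on_iff_negligible, simp, intro exI[of _ N1])
      (use N1 vector_derivative_at in \<open>fastforce intro: differentiableI_vector\<close>)
  moreover have "AE x in lebesgue_on {0<..<pi}. v differentiable (at x) \<and> ell \<sigma> u v x + 2 * z * p x * u x = z\<^sup>2 * u x"
    by (subst AE_lebesgue_on_iff_negligible, simp, intro exI[of _ N2])
      (use N2(1) ell differentiableI_vector[OF N2(2)] in auto)
  ultimately show ?thesis
    using A by (simp add: is_solution_def ac_deriv_def)
qed

lemma is_solution_imp_volterra_sol:
  assumes sol: "is_solution p \<sigma> z u v" and init: "u 0 = 0" "v 0 = 1"
  shows "volterra_sol z u v"
proof -
  have ac: "abs_cont_on 0 pi u" "abs_cont_on 0 pi v"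
    and q1: "AE x in lebesgue_on {0<..<pi}. u differentiable (at x) \<and> v x = vector_derivative u (at x) - \<sigma> x * u x"
    and q2: "AE x in lebesgue_on {0<..<pi}. v differentiable (at x) \<and> ell \<sigma> u v x + 2 * z * p x * u x = z\<^sup>2 * u x"
    using sol by (auto simp: is_solution_def is_quasi_deriv_def)
  obtain N1 where N1: "negligible N1" "\<And>x. x \<in> {0<..<pi} - N1 \<Longrightarrow> u differentiable (at x) \<and> v x = vector_derivative u (at x) - \<sigma> x * u x"
    using q1 by (subst (asm) AE_lebesgue_on_iff_negligible) auto
  obtain N2 where N2: "negligible N2" "\<And>x. x \<in> {0<..<pi} - N2 \<Longrightarrow> v differentiable (at x) \<and> ell \<sigma> u v x + 2 * z * p x * u x = z\<^sup>2 * u x"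
    using q2 by (subst (asm) AE_lebesgue_on_iff_negligible) auto
  have "(u has_vector_derivative \<sigma> x * u x + v x) (at x)" if "x \<in> {0<..<pi} - N1" for x
    using N1(2)[OF that] vector_derivative_works[of u "at x"] by simp
  then have A1: "ac_deriv 0 pi u (\<lambda>s. \<sigma> s * u s + v s)"
    unfolding ac_deriv_def using ac N1(1) by blast
  have "(v has_vector_derivative q z x * u x - \<sigma> x * v x) (at x)" if "x \<in> {0<..<pi} - N2" for x
  proof -
    have "vector_derivative v (at x) = q z x * u x - \<sigma> x * v x"
      using N2(2)[OF that] by (simp add: ell_def q_def algebra_simps)
    then show ?thesis using N2(2)[OF that] vector_derivative_works[of v "at x"] by simp
  qed
  then have A2: "ac_deriv 0 pi v (\<lambda>s. q z s * u s - \<sigma> s * v s)"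
    unfolding ac_deriv_def using ac N2(1) by blast
  show ?thesis
    unfolding volterra_sol_def T1_def T2_def
    using ac_deriv_integral(1)[OF A1] ac_deriv_integral(1)[OF A2] ac_deriv_continuous[OF A1] ac_deriv_continuous[OF A2] init
    by auto
qed

text \<open>The descriptions are well defined: every solution in the sense of
  \<open>is_solution\<close> with these initial values is a Volterra solution, and all of those
  agree on \<open>[0, pi]\<close>.\<close>

lemma
  assumes "x \<in> {0..pi}"
  shows S_sol_eq: "S_sol p \<sigma> x z = ysol z x" and S_quasi_eq: "S_quasi p \<sigma> x z = y1sol z x"
proof -
  note A = volterra_sol_imp_is_solution[OF volterra_sol_ysol[of z]] volterra_sol_ac_deriv(3,4)[OF volterra_sol_ysol[of z]]
  have u: "u x = ysol z x \<and> v x = y1sol z x" if "is_solution p \<sigma> z u v" "u 0 = 0" "v 0 = 1" for u v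
    using volterra_sol_unique[OF is_solution_imp_volterra_sol[OF that] volterra_sol_ysol assms] .
  show "S_sol p \<sigma> x z = ysol z x" unfolding S_sol_def
    by (rule the_equality) (use A u in blast)+
  show "S_quasi p \<sigma> x z = y1sol z x" unfolding S_quasi_def
    by (rule the_equality) (use A u in blast)+
qed

end

section \<open>Fourier transforms of square integrable functions\<close>

definition esum :: "nat \<Rightarrow> (nat \<Rightarrow> complex) \<Rightarrow> (nat \<Rightarrow> complex) \<Rightarrow> real \<Rightarrow> complex" where
  "esum n c l t = (\<Sum>j<n. c j * exp (\<i> * l j * of_real t))"

text \<open>The dual form of \<open>F l = \<integral> k(t) exp (i l t) dt\<close> over \<open>(-a, a)\<close> with \<open>k\<close> in \<open>L\<^sub>2\<close> of norm at most
  \<open>C\<close>. It is stable under the operations below without any mention of a kernel \<open>k\<close>.\<close>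

definition pw :: "real \<Rightarrow> real \<Rightarrow> (complex \<Rightarrow> complex) \<Rightarrow> bool" where
  "pw a C F \<longleftrightarrow> (\<forall>n c l. cmod (\<Sum>j<n. c j * F (l j)) \<le> C * l2norm (-a) a (esum n c l))"

lemma continuous_esum: "continuous_on S (esum n c l)"
  unfolding esum_def by (intro continuous_intros)

lemma sq_int_esum: "sq_int a b (esum n c l)"
  by (intro sq_int_continuous continuous_esum)

text \<open>Substitution gives a factor \<open>1 / \<bar>m\<bar> \<le> 1\<close>. The slopes that
  occur are \<open>1\<close>, \<open>-1\<close>, \<open>2\<close> and \<open>-2\<close>, from
  translations and from the characteristics of the hyperbolic system.\<close>

lemma l2norm_affine_le:
  fixes f :: "real \<Rightarrow> complex"
  assumes f: "continuous_on UNIV f" and m: "\<bar>m\<bar> \<ge> 1" and uv: "u \<le> v"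
    and img: "\<And>s. s \<in> {u..v} \<Longrightarrow> m * s + c \<in> {A..B}"
  shows "l2norm u v (\<lambda>s. f (m * s + c)) \<le> l2norm A B f"
proof -
  define g where "g = (\<lambda>t. (cmod (f t))\<^sup>2)"
  have cont: "continuous_on S g" for S unfolding g_def
    using continuous_on_subset[OF f] by (auto intro!: continuous_intros)
  define lo where "lo = min (m * u + c) (m * v + c)"
  define hi where "hi = max (m * u + c) (m * v + c)"
  have m0: "m \<noteq> 0" using m by auto
  have lohi: "lo \<le> hi" by (simp add: lo_def hi_def)
  have sub: "{lo..hi} \<subseteq> {A..B}"
    using img[of u] img[of v] uv by (auto simp: lo_def hi_def)
  have "(g has_integral integral {lo..hi} g) (cbox lo hi)"
    using integrable_continuous_real[OF cont, of lo hi] by (simp add: integrable_integral)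
  from has_integral_affinity[OF this m0, of c]
  have "((\<lambda>x. g (m * x + c)) has_integral (1 / \<bar>m\<bar>) * integral {lo..hi} g) ((\<lambda>x. (1 / m) * x + - ((1 / m) * c)) ` {lo..hi})"
    by simp
  moreover have "(\<lambda>x. (1 / m) * x + - ((1 / m) * c)) ` {lo..hi} = {u..v}"
  proof (cases "m > 0")
    case True
    then have "lo = m * u + c" "hi = m * v + c" using uv by (auto simp: lo_def hi_def)
    then show ?thesis using True uv lohi by (subst image_affinity_atLeastAtMost) (auto simp: field_simps)
  next
    case False
    then have "m < 0" using m0 by simp
    then have "lo = m * v + c" "hi = m * u + c" using uv by (auto simp: lo_def hi_def mult_left_mono_neg)
    then show ?thesis using \<open>m < 0\<close> uv lohi by (subst image_affinity_atLeastAtMost) (auto simp: field_simps)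
  qed
  ultimately have "integral {u..v} (\<lambda>s. g (m * s + c)) = (1 / \<bar>m\<bar>) * integral {lo..hi} g"
    by (simp add: integral_unique)
  also have "\<dots> \<le> 1 * integral {lo..hi} g"
    using m by (intro mult_right_mono Henstock_Kurzweil_Integration.integral_nonneg integrable_continuous_real cont) (auto simp: g_def)
  also have "\<dots> \<le> integral {A..B} g"
    using sub by (simp, intro integral_subset_le integrable_continuous_real cont) (auto simp: g_def)
  finally show ?thesis by (simp add: l2norm_def g_def)
qed

lemma sq_int_compose_affine:
  assumes "continuous_on UNIV f"
  shows "sq_int a b (\<lambda>s. f (m * s + c))"
  by (intro sq_int_continuous continuous_on_compose2[OF assms]) (auto intro!: continuous_intros)

lemma pwD:
  fixes n :: nat
  shows "pw a C F \<Longrightarrow> cmod (\<Sum>j<n. c j * F (l j)) \<le> C * l2norm (-a) a (esum n c l)"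
  by (simp add: pw_def)

lemma pw_mono:
  assumes "pw a C F" "a \<le> b" "C \<le> D" "0 \<le> D"
  shows "pw b D F"
  unfolding pw_def
proof (intro allI)
  fix n :: nat and c l :: "nat \<Rightarrow> complex"
  have "cmod (\<Sum>j<n. c j * F (l j)) \<le> C * l2norm (-a) a (esum n c l)" using assms(1) by (rule pwD)
  also have "\<dots> \<le> D * l2norm (-a) a (esum n c l)" using assms by (intro mult_right_mono l2norm_nonneg)
  also have "\<dots> \<le> D * l2norm (-b) b (esum n c l)"
    using assms by (intro mult_left_mono sq_int_subinterval(2) sq_int_esum) auto
  finally show "cmod (\<Sum>j<n. c j * F (l j)) \<le> D * l2norm (-b) b (esum n c l)" .
qed

lemma pw_add:
  assumes "pw a C F" "pw a D G"
  shows "pw a (C + D) (\<lambda>l. F l + G l)"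
  unfolding pw_def
proof (intro allI)
  fix n :: nat and c l :: "nat \<Rightarrow> complex"
  have "cmod (\<Sum>j<n. c j * (F (l j) + G (l j))) \<le> cmod (\<Sum>j<n. c j * F (l j)) + cmod (\<Sum>j<n. c j * G (l j))"
    by (simp add: distrib_left sum.distrib norm_triangle_ineq)
  then show "cmod (\<Sum>j<n. c j * (F (l j) + G (l j))) \<le> (C + D) * l2norm (-a) a (esum n c l)"
    using pwD[OF assms(1), where n=n and c=c and l=l] pwD[OF assms(2), where n=n and c=c and l=l] by (simp add: distrib_right)
qed

lemma pw_cmult:
  assumes "pw a C F"
  shows "pw a (cmod k * C) (\<lambda>l. k * F l)"
  unfolding pw_def
proof (intro allI)
  fix n :: nat and c l :: "nat \<Rightarrow> complex"
  have "cmod (\<Sum>j<n. c j * (k * F (l j))) = cmod k * cmod (\<Sum>j<n. c j * F (l j))"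
    unfolding norm_mult[symmetric] by (simp add: sum_distrib_left mult.left_commute)
  then show "cmod (\<Sum>j<n. c j * (k * F (l j))) \<le> cmod k * C * l2norm (-a) a (esum n c l)"
    using pwD[OF assms, where n=n and c=c and l=l] by (simp add: mult.assoc mult_left_mono)
qed

text \<open>The exponential factor can be moved into the coefficients, where it translates the
  exponential sum by \<open>s\<close>; the interval therefore grows by \<open>b\<close>.\<close>

lemma pw_shift:
  assumes "pw a C F" "C \<ge> 0" "\<bar>s\<bar> \<le> b" "a \<ge> 0"
  shows "pw (a + b) C (\<lambda>l. exp (\<i> * l * of_real s) * F l)"
  unfolding pw_def
proof (intro allI)
  fix n :: nat and c l :: "nat \<Rightarrow> complex"
  have e: "esum n (\<lambda>j. c j * exp (\<i> * l j * of_real s)) l = (\<lambda>t. esum n c l (1 * t + s))"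
    by (rule ext) (simp add: esum_def mult.assoc distrib_left exp_add mult_ac)
  have "cmod (\<Sum>j<n. c j * (exp (\<i> * l j * of_real s) * F (l j))) \<le> C * l2norm (-a) a (\<lambda>t. esum n c l (1 * t + s))"
    using pwD[OF assms(1), where n=n and c="\<lambda>j. c j * exp (\<i> * l j * of_real s)" and l=l] unfolding e by (simp add: mult.assoc)
  also have "\<dots> \<le> C * l2norm (-(a + b)) (a + b) (esum n c l)"
    by (intro mult_left_mono l2norm_affine_le continuous_esum) (use assms in auto)
  finally show "cmod (\<Sum>j<n. c j * (exp (\<i> * l j * of_real s) * F (l j))) \<le> C * l2norm (-(a + b)) (a + b) (esum n c l)" .
qed

text \<open>The dual form of a convolution. The bound for \<open>G\<close> is applied with
  coefficients \<open>c j * F (l j)\<close>; the resulting exponential sum is bounded pointwise on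
  \<open>[-b, b]\<close> by \<open>pw_shift\<close> for \<open>F\<close>, and
  \<open>sqrt (2 * b)\<close> passes from the supremum to the L2 norm.\<close>

lemma pw_mult:
  assumes F: "pw a C F" "C \<ge> 0" "a \<ge> 0" and G: "pw b D G" "D \<ge> 0" "b \<ge> 0"
  shows "pw (a + b) (D * (sqrt (2 * b) * C)) (\<lambda>l. F l * G l)"
  unfolding pw_def
proof (intro allI)
  fix n :: nat and c l :: "nat \<Rightarrow> complex"
  define N where "N = l2norm (-(a + b)) (a + b) (esum n c l)"
  have "l2norm (-b) b (esum n (\<lambda>j. c j * F (l j)) l) \<le> sqrt (b - (-b)) * (C * N)"
  proof (rule l2norm_le_sup)
    fix t assume t: "t \<in> {-b..b}"
    have "esum n (\<lambda>j. c j * F (l j)) l t = (\<Sum>j<n. c j * (exp (\<i> * l j * of_real t) * F (l j)))"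
      by (simp add: esum_def mult_ac)
    also have "cmod \<dots> \<le> C * N" unfolding N_def
      by (rule pwD[OF pw_shift]) (use F t in auto)
    finally show "cmod (esum n (\<lambda>j. c j * F (l j)) l t) \<le> C * N" .
  qed (use assms in \<open>auto simp: N_def l2norm_nonneg sq_int_esum\<close>)
  then have "D * l2norm (-b) b (esum n (\<lambda>j. c j * F (l j)) l) \<le> D * (sqrt (2 * b) * (C * N))"
    using G by (intro mult_left_mono) auto
  moreover have "cmod (\<Sum>j<n. c j * (F (l j) * G (l j))) \<le> D * l2norm (-b) b (esum n (\<lambda>j. c j * F (l j)) l)"
    using pwD[OF G(1), where n=n and c="\<lambda>j. c j * F (l j)" and l=l] by (simp add: mult.assoc)
  ultimately show "cmod (\<Sum>j<n. c j * (F (l j) * G (l j))) \<le> D * (sqrt (2 * b) * C) * l2norm (-(a + b)) (a + b) (esum n c l)"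
    by (simp add: N_def mult.assoc)
qed

lemma norm_integral_mult_le:
  fixes \<beta> Y :: "real \<Rightarrow> complex" and m :: "real \<Rightarrow> real"
  assumes \<beta>: "\<beta> absolutely_integrable_on {0..x}" and Y: "continuous_on {0..x} Y"
    and m: "continuous_on {0..x} m" and le: "\<And>s. s \<in> {0..x} \<Longrightarrow> cmod (Y s) \<le> m s"
  shows "cmod (integral {0..x} (\<lambda>s. \<beta> s * Y s)) \<le> integral {0..x} (\<lambda>s. cmod (\<beta> s) * m s)"
    "(\<lambda>s. cmod (\<beta> s) * m s) integrable_on {0..x}"
proof -
  have "(\<lambda>s. \<beta> s * of_real (m s)) absolutely_integrable_on {0..x}"
    using m by (intro abs_int_times_continuous[OF \<beta>] continuous_intros)
  from absolutely_integrable_norm[OF this]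
  have "(\<lambda>s. cmod (\<beta> s) * \<bar>m s\<bar>) integrable_on {0..x}"
    by (simp add: absolutely_integrable_on_def o_def norm_mult)
  then show i: "(\<lambda>s. cmod (\<beta> s) * m s) integrable_on {0..x}"
    by (rule integrable_eq) (use order_trans[OF norm_ge_zero le] in auto)
  show "cmod (integral {0..x} (\<lambda>s. \<beta> s * Y s)) \<le> integral {0..x} (\<lambda>s. cmod (\<beta> s) * m s)"
    by (rule Henstock_Kurzweil_Integration.integral_norm_bound_integral[OF _ i])
      (use abs_int_times_continuous[OF \<beta> Y] le in \<open>auto simp: absolutely_integrable_on_def norm_mult mult_left_mono\<close>)
qed

text \<open>The exponential sum is controlled only in L2 along the line
  \<open>\<mu> * s + k\<close>, so it is met by Cauchy-Schwarz and the L2 norm of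
  \<open>\<alpha>\<close>; the rest \<open>V\<close> has a pointwise majorant.\<close>

lemma norm_integral_esum_le:
  fixes \<alpha> V :: "real \<Rightarrow> complex" and m :: "real \<Rightarrow> real"
  assumes \<alpha>: "sq_int 0 b \<alpha>" and x: "0 \<le> x" "x \<le> b" and V: "continuous_on {0..x} V"
    and m: "continuous_on {0..x} m" and le: "\<And>s. s \<in> {0..x} \<Longrightarrow> cmod (V s) \<le> m s"
    and \<mu>: "\<bar>\<mu>\<bar> \<ge> 1" and img: "\<And>s. s \<in> {0..x} \<Longrightarrow> \<mu> * s + k \<in> {-X..X}"
  shows "cmod (integral {0..x} (\<lambda>s. \<alpha> s * (esum n c l (\<mu> * s + k) + V s))) \<le>
     l2norm 0 b \<alpha> * l2norm (-X) X (esum n c l) + integral {0..x} (\<lambda>s. cmod (\<alpha> s) * m s)"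
proof -
  have \<alpha>x: "sq_int 0 x \<alpha>" "l2norm 0 x \<alpha> \<le> l2norm 0 b \<alpha>" using sq_int_subinterval[OF \<alpha>, of 0 x] x by auto
  have sqe: "sq_int 0 x (\<lambda>s. esum n c l (\<mu> * s + k))" by (rule sq_int_compose_affine[OF continuous_esum])
  have i1: "(\<lambda>s. \<alpha> s * esum n c l (\<mu> * s + k)) integrable_on {0..x}"
    using sq_int_norm_mult(1)[OF \<alpha>x(1) sqe] by (simp add: absolutely_integrable_on_def)
  have i2: "(\<lambda>s. \<alpha> s * V s) integrable_on {0..x}"
    using abs_int_times_continuous[OF sq_int_abs_int[OF \<alpha>x(1)] V] by (simp add: absolutely_integrable_on_def)
  have "integral {0..x} (\<lambda>s. \<alpha> s * (esum n c l (\<mu> * s + k) + V s)) =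
     integral {0..x} (\<lambda>s. \<alpha> s * esum n c l (\<mu> * s + k)) + integral {0..x} (\<lambda>s. \<alpha> s * V s)"
    by (simp only: distrib_left Henstock_Kurzweil_Integration.integral_add[OF i1 i2])
  also have "cmod \<dots> \<le> cmod (integral {0..x} (\<lambda>s. \<alpha> s * esum n c l (\<mu> * s + k))) + cmod (integral {0..x} (\<lambda>s. \<alpha> s * V s))"
    by (rule norm_triangle_ineq)
  also have "cmod (integral {0..x} (\<lambda>s. \<alpha> s * esum n c l (\<mu> * s + k))) \<le> l2norm 0 x \<alpha> * l2norm 0 x (\<lambda>s. esum n c l (\<mu> * s + k))"
    by (rule cauchy_schwarz_cmod[OF \<alpha>x(1) sqe])
  also have "\<dots> \<le> l2norm 0 b \<alpha> * l2norm (-X) X (esum n c l)"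
    by (intro mult_mono l2norm_nonneg \<alpha>x l2norm_affine_le continuous_esum \<mu> x img)
  also have "cmod (integral {0..x} (\<lambda>s. \<alpha> s * V s)) \<le> integral {0..x} (\<lambda>s. cmod (\<alpha> s) * m s)"
    by (rule norm_integral_mult_le(1)[OF sq_int_abs_int[OF \<alpha>x(1)] V m le])
  finally show ?thesis by simp
qed

lemma sum_integral_pair:
  fixes \<alpha> \<beta> :: "real \<Rightarrow> complex" and A B :: "nat \<Rightarrow> real \<Rightarrow> complex"
  assumes \<alpha>: "\<alpha> absolutely_integrable_on {a..b}" and \<beta>: "\<beta> absolutely_integrable_on {a..b}"
    and A: "\<And>j. continuous_on {a..b} (A j)" and B: "\<And>j. continuous_on {a..b} (B j)"
  shows "(\<Sum>j<n. c j * integral {a..b} (\<lambda>s. \<alpha> s * A j s + \<beta> s * B j s)) =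
     integral {a..b} (\<lambda>s. \<alpha> s * (\<Sum>j<n. c j * A j s)) + integral {a..b} (\<lambda>s. \<beta> s * (\<Sum>j<n. c j * B j s))"
proof -
  have int: "((\<lambda>s. h s * g s) has_integral integral {a..b} (\<lambda>s. h s * g s)) {a..b}"
    if "h absolutely_integrable_on {a..b}" "continuous_on {a..b} g" for h g :: "real \<Rightarrow> complex"
    using abs_int_times_continuous[OF that] by (simp add: absolutely_integrable_on_def integrable_integral)
  have "((\<lambda>s. \<Sum>j<n. c j * (\<alpha> s * A j s + \<beta> s * B j s)) has_integral
      (\<Sum>j<n. c j * integral {a..b} (\<lambda>s. \<alpha> s * A j s + \<beta> s * B j s))) {a..b}"
    using has_integral_integrable[OF has_integral_add[OF int[OF \<alpha> A] int[OF \<beta> B]]]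
    by (intro has_integral_sum has_integral_mult_right integrable_integral) auto
  moreover have "((\<lambda>s. \<alpha> s * (\<Sum>j<n. c j * A j s) + \<beta> s * (\<Sum>j<n. c j * B j s)) has_integral
      (integral {a..b} (\<lambda>s. \<alpha> s * (\<Sum>j<n. c j * A j s)) + integral {a..b} (\<lambda>s. \<beta> s * (\<Sum>j<n. c j * B j s)))) {a..b}"
    by (intro has_integral_add int \<alpha> \<beta> continuous_intros A B)
  moreover have "(\<Sum>j<n. c j * (\<alpha> s * A j s + \<beta> s * B j s)) = \<alpha> s * (\<Sum>j<n. c j * A j s) + \<beta> s * (\<Sum>j<n. c j * B j s)" for s
    by (simp add: sum_distrib_left sum.distrib algebra_simps)
  ultimately show ?thesis by (simp add: has_integral_unique)
qed

text \<open>For a finite sum of exponentials the factor \<open>exp (i l (x - s))\<close> acts as a translation, so the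
  system becomes a hyperbolic one for functions of \<open>(x, t)\<close>. Gronwall's inequality on the cone
  \<open>\<bar>t\<bar> \<le> X - x\<close> bounds its solutions at \<open>(X, 0)\<close> by the \<open>L\<^sub>2\<close> norm of the data on \<open>[-X, X]\<close>.\<close>

theorem hyperbolic_pw:
  fixes q1 q2 a1 a2 r1 r2 :: "real \<Rightarrow> complex" and up um zz :: "complex \<Rightarrow> real \<Rightarrow> complex"
  assumes q: "sq_int 0 b q1" "sq_int 0 b q2" "sq_int 0 b a1" "sq_int 0 b a2"
    and r: "r1 absolutely_integrable_on {0..b}" "r2 absolutely_integrable_on {0..b}"
    and cont: "\<And>l. continuous_on {0..b} (up l)" "\<And>l. continuous_on {0..b} (um l)" "\<And>l. continuous_on {0..b} (zz l)"
    and up: "\<And>l x. x \<in> {0..b} \<Longrightarrow> up l x = exp (\<i> * l * of_real x) +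
        integral {0..x} (\<lambda>s. exp (\<i> * l * of_real (x - s)) * (q1 s * um l s - r1 s * zz l s))"
    and um: "\<And>l x. x \<in> {0..b} \<Longrightarrow> um l x = exp (\<i> * l * of_real (- x)) +
        integral {0..x} (\<lambda>s. exp (\<i> * l * of_real (s - x)) * (q2 s * up l s - r2 s * zz l s))"
    and zz: "\<And>l x. x \<in> {0..b} \<Longrightarrow> zz l x = integral {0..x} (\<lambda>s. a1 s * up l s + a2 s * um l s)"
  shows "\<exists>C\<ge>0. \<forall>x\<in>{0..b}. pw x C (\<lambda>l. up l x - exp (\<i> * l * of_real x)) \<and>
     pw x C (\<lambda>l. um l x - exp (\<i> * l * of_real (- x))) \<and> pw x C (\<lambda>l. zz l x)"
proof -
  define k where "k = (\<lambda>s. cmod (q1 s) + cmod (q2 s) + cmod (a1 s) + cmod (a2 s) + cmod (r1 s) + cmod (r2 s))"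
  have nai: "(\<lambda>s. cmod (h s)) absolutely_integrable_on {0..b}" if "h absolutely_integrable_on {0..b}" for h :: "real \<Rightarrow> complex"
    using absolutely_integrable_norm[OF that] by (simp add: o_def)
  have k: "k absolutely_integrable_on {0..b}"
    unfolding k_def by (intro set_integral_add(1) nai r sq_int_abs_int q)
  have k0: "k s \<ge> 0" for s by (simp add: k_def)
  define E where "E = (\<lambda>s. exp (2 * integral {0..s} k))"
  have contE: "continuous_on {0..b} E" unfolding E_def
    using indefinite_integral_continuous_1[of k 0 b] k by (auto intro!: continuous_intros simp: absolutely_integrable_on_def)
  define Q where "Q = l2norm 0 b q1 + l2norm 0 b q2 + (l2norm 0 b a1 + l2norm 0 b a2)"
  have Q: "Q \<ge> 0" by (simp add: Q_def l2norm_nonneg)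
  define C where "C = 2 * Q * E b"
  have C0: "C \<ge> 0" using Q by (simp add: C_def E_def)
  have main: "cmod (\<Sum>j<n. c j * (up (l j) X - exp (\<i> * l j * of_real X))) \<le> C * l2norm (-X) X (esum n c l) \<and>
     cmod (\<Sum>j<n. c j * (um (l j) X - exp (\<i> * l j * of_real (-X)))) \<le> C * l2norm (-X) X (esum n c l) \<and>
     cmod (\<Sum>j<n. c j * zz (l j) X) \<le> C * l2norm (-X) X (esum n c l)"
    if X: "X \<in> {0..b}" for X and n :: nat and c l :: "nat \<Rightarrow> complex"
  proof -
    define N where "N = l2norm (-X) X (esum n c l)"
    have N: "N \<ge> 0" by (simp add: N_def l2norm_nonneg)
    define e where "e = (\<lambda>j t. exp (\<i> * l j * of_real t))"
    have e_add: "e j s * e j t = e j (s + t)" for j s t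
      by (simp add: e_def exp_add distrib_left)
    \<comment> \<open>Differences from the free waves, as functions of position and time.
      \<open>Z\<close> has no free wave, so nothing is subtracted there.\<close>
    define Vp where "Vp = (\<lambda>s t. \<Sum>j<n. c j * ((up (l j) s - e j s) * e j t))"
    define Vm where "Vm = (\<lambda>s t. \<Sum>j<n. c j * ((um (l j) s - e j (-s)) * e j t))"
    define Z where "Z = (\<lambda>s t. \<Sum>j<n. c j * (zz (l j) s * e j t))"
    have esum: "esum n c l t = (\<Sum>j<n. c j * e j t)" for t by (simp add: esum_def e_def)
    have Up: "(\<Sum>j<n. c j * (up (l j) s * e j t)) = esum n c l (t + s) + Vp s t" for s t
      by (simp add: esum Vp_def right_diff_distrib left_diff_distrib sum_subtractf e_add mult.assoc add.commute)
    have Um: "(\<Sum>j<n. c j * (um (l j) s * e j t)) = esum n c l (t - s) + Vm s t" for s t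
      by (simp add: esum Vm_def right_diff_distrib left_diff_distrib sum_subtractf e_add mult.assoc add.commute)
    have ce: "continuous_on S (\<lambda>s. e j (f s))" if "continuous_on S f" for S :: "'z::topological_space set" and f j
      unfolding e_def using that by (intro continuous_intros)
    have cup: "continuous_on S (\<lambda>s. up (l j) (f s))" "continuous_on S (\<lambda>s. um (l j) (f s))" "continuous_on S (\<lambda>s. zz (l j) (f s))"
      if "continuous_on S f" "f ` S \<subseteq> {0..X}" for S :: "'z::topological_space set" and f j
      using that X by (auto intro!: continuous_on_compose2[OF cont(1)] continuous_on_compose2[OF cont(2)] continuous_on_compose2[OF cont(3)])
    have cV: "continuous_on S (\<lambda>s. Vp (f s) (g s))" "continuous_on S (\<lambda>s. Vm (f s) (g s))" "continuous_on S (\<lambda>s. Z (f s) (g s))"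
      if "continuous_on S f" "f ` S \<subseteq> {0..X}" "continuous_on S g" for S :: "'z::topological_space set" and f g
      unfolding Vp_def Vm_def Z_def using that
      by (auto intro!: continuous_on_sum continuous_on_mult continuous_on_diff continuous_on_const cup ce continuous_on_minus)
    \<comment> \<open>The first entry of an index names one of the three components, the second is
      the time; \<open>I s\<close> is the section at position \<open>s\<close> of the cone with apex
      \<open>(X, 0)\<close>.\<close>
    define f where "f = (\<lambda>s (i, t). if i = (0::nat) then cmod (Vp s t) else if i = 1 then cmod (Vm s t) else cmod (Z s t))"
    define I where "I = (\<lambda>s. {(i, t). i < (3::nat) \<and> \<bar>t\<bar> \<le> X - s})"
    have "\<exists>B. \<forall>st \<in> {0..X} \<times> {-X..X}. cmod (Vp (fst st) (snd st)) + cmod (Vm (fst st) (snd st)) + cmod (Z (fst st) (snd st)) \<le> B"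
    proof -
      have "continuous_on ({0..X} \<times> {-X..X}) (\<lambda>st. cmod (Vp (fst st) (snd st)) + cmod (Vm (fst st) (snd st)) + cmod (Z (fst st) (snd st)))"
        by (intro continuous_intros cV) auto
      from compact_imp_bounded[OF compact_continuous_image[OF this compact_Times[OF compact_Icc compact_Icc]]]
      obtain B where "\<forall>v\<in>(\<lambda>st. cmod (Vp (fst st) (snd st)) + cmod (Vm (fst st) (snd st)) + cmod (Z (fst st) (snd st))) ` ({0..X} \<times> {-X..X}). norm v \<le> B"
        unfolding bounded_iff by blast
      then show ?thesis
        by (intro exI[of _ B]) (auto dest!: bspec intro: order_trans[OF abs_ge_self])
    qed
    then obtain B where B: "\<And>s t. s \<in> {0..X} \<Longrightarrow> t \<in> {-X..X} \<Longrightarrow> cmod (Vp s t) + cmod (Vm s t) + cmod (Z s t) \<le> B"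
      by fastforce
    have gron: "f x i \<le> 2 * (Q * N) * E x" if xi: "x \<in> {0..X}" "i \<in> I x" for x i
      unfolding E_def
    proof (rule gronwall_family[where k=k and f=f and I=I and B=B and X=X])
      show "k absolutely_integrable_on {0..X}" using abs_int_subinterval[OF k, of 0 X] X by simp
      show "f s i \<le> B" if "s \<in> {0..X}" "i \<in> I s" for s i
      proof -
        obtain i' t where i: "i = (i', t)" by force
        have "t \<in> {-X..X}" using that i by (auto simp: I_def)
        from B[OF that(1) this] show ?thesis
          using norm_ge_zero[of "Vp s t"] norm_ge_zero[of "Vm s t"] norm_ge_zero[of "Z s t"]
          unfolding f_def i prod.case by (simp only: split: if_splits) linarith
      qed
      show "0 \<le> Q * N" using Q N by simp
      fix D x i assume D: "D \<ge> 0" and hyp: "\<And>s j. s \<in> {0..X} \<Longrightarrow> j \<in> I s \<Longrightarrow> f s j \<le> D * exp (2 * integral {0..s} k)"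
        and x: "x \<in> {0..X}" and i: "i \<in> I x"
      have xb: "0 \<le> x" "x \<le> b" "x \<in> {0..b}" using x X by auto
      define m where "m = (\<lambda>s. D * E s)"
      have m: "continuous_on {0..x} m" unfolding m_def
        using continuous_on_subset[OF contE, of "{0..x}"] xb by (intro continuous_intros) auto
      have mb: "cmod (Vp s t) \<le> m s" "cmod (Vm s t) \<le> m s" "cmod (Z s t) \<le> m s" if "s \<in> {0..x}" "\<bar>t\<bar> \<le> X - s" for s t
        using hyp[of s "(0, t)"] hyp[of s "(1, t)"] hyp[of s "(2, t)"] that x by (auto simp: f_def I_def m_def E_def)
      have ri: "r1 absolutely_integrable_on {0..x}" "r2 absolutely_integrable_on {0..x}"
        using abs_int_subinterval[OF r(1), of 0 x] abs_int_subinterval[OF r(2), of 0 x] xb by auto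
      have qi: "q1 absolutely_integrable_on {0..x}" "q2 absolutely_integrable_on {0..x}" "a1 absolutely_integrable_on {0..x}" "a2 absolutely_integrable_on {0..x}"
        using abs_int_subinterval[OF sq_int_abs_int[OF q(1)], of 0 x] abs_int_subinterval[OF sq_int_abs_int[OF q(2)], of 0 x]
          abs_int_subinterval[OF sq_int_abs_int[OF q(3)], of 0 x] abs_int_subinterval[OF sq_int_abs_int[OF q(4)], of 0 x] xb by auto
      have hm: "(\<lambda>s. cmod (h s) * m s) integrable_on {0..x}" if "h absolutely_integrable_on {0..x}" for h
        using norm_integral_mult_le(2)[OF that continuous_on_const[of _ 0] m] D by (simp add: m_def E_def)
      have km: "(\<lambda>s. k s * m s) integrable_on {0..x}"
      proof -
        have "(\<lambda>s. cmod (q1 s) * m s + cmod (q2 s) * m s + cmod (a1 s) * m s + cmod (a2 s) * m s + cmod (r1 s) * m s + cmod (r2 s) * m s) integrable_on {0..x}"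
          by (intro integrable_add hm ri qi)
        then show ?thesis by (simp add: k_def distrib_right)
      qed
      have m0: "m s \<ge> 0" for s using D by (simp add: m_def E_def)
      have two: "integral {0..x} (\<lambda>s. cmod (h1 s) * m s) + integral {0..x} (\<lambda>s. cmod (h2 s) * m s) \<le> integral {0..x} (\<lambda>s. k s * m s)"
        if h: "h1 absolutely_integrable_on {0..x}" "h2 absolutely_integrable_on {0..x}" "\<And>s. cmod (h1 s) + cmod (h2 s) \<le> k s" for h1 h2
      proof -
        have "integral {0..x} (\<lambda>s. cmod (h1 s) * m s) + integral {0..x} (\<lambda>s. cmod (h2 s) * m s) = integral {0..x} (\<lambda>s. cmod (h1 s) * m s + cmod (h2 s) * m s)"
          by (rule Henstock_Kurzweil_Integration.integral_add[symmetric]; rule hm; rule h)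
        also have "\<dots> \<le> integral {0..x} (\<lambda>s. k s * m s)"
          by (rule Henstock_Kurzweil_Integration.integral_le[OF integrable_add[OF hm[OF h(1)] hm[OF h(2)]] km])
            (use h(3) m0 in \<open>auto simp flip: distrib_right intro!: mult_right_mono\<close>)
        finally show ?thesis .
      qed
      have contx: "continuous_on {0..x} (up w)" "continuous_on {0..x} (um w)" "continuous_on {0..x} (zz w)" for w
        using continuous_on_subset[OF cont(1), of "{0..x}"] continuous_on_subset[OF cont(2), of "{0..x}"] continuous_on_subset[OF cont(3), of "{0..x}"] xb
        by auto
      have nri: "(\<lambda>s. - r1 s) absolutely_integrable_on {0..x}" "(\<lambda>s. - r2 s) absolutely_integrable_on {0..x}"
        using set_integrable_mult_right[OF ri(1), of "-1"] set_integrable_mult_right[OF ri(2), of "-1"] by simp_all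
      \<comment> \<open>The factor \<open>e j (x - s)\<close> moves the time from \<open>t\<close>
        to \<open>t + x - s\<close>. The free wave of \<open>um\<close> subtracts another
        \<open>s\<close>, hence the slope \<open>-2\<close>; the point \<open>(s, t + x - s)\<close>
        stays in the cone.\<close>
      have VpEq: "Vp x t = integral {0..x} (\<lambda>s. q1 s * (esum n c l ((-2) * s + (t + x)) + Vm s (t + x - s)))
           + integral {0..x} (\<lambda>s. - r1 s * Z s (t + x - s))" for t
      proof -
        have "Vp x t = (\<Sum>j<n. c j * integral {0..x} (\<lambda>s. q1 s * (um (l j) s * e j (t + x - s)) + - r1 s * (zz (l j) s * e j (t + x - s))))"
          unfolding Vp_def
        proof (rule sum.cong)
          fix j
          have "(up (l j) x - e j (x)) * e j t = integral {0..x} (\<lambda>s. e j t * (e j (x - s) * (q1 s * um (l j) s - r1 s * zz (l j) s)))"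
            using up[OF xb(3), of "l j"] by (simp add: e_def mult.commute)
          also have "\<dots> = integral {0..x} (\<lambda>s. q1 s * (um (l j) s * e j (t + x - s)) + - r1 s * (zz (l j) s * e j (t + x - s)))"
          proof (rule Henstock_Kurzweil_Integration.integral_cong)
            fix s
            have "e j (t + x - s) = e j t * e j (x - s)" by (simp add: e_add add_diff_eq)
            then show "e j t * (e j (x - s) * (q1 s * um (l j) s - r1 s * zz (l j) s)) =
                q1 s * (um (l j) s * e j (t + x - s)) + - r1 s * (zz (l j) s * e j (t + x - s))"
              by (simp add: algebra_simps)
          qed
          finally show "c j * ((up (l j) x - e j (x)) * e j t) =
              c j * integral {0..x} (\<lambda>s. q1 s * (um (l j) s * e j (t + x - s)) + - r1 s * (zz (l j) s * e j (t + x - s)))" by simp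
        qed simp
        also have "\<dots> = integral {0..x} (\<lambda>s. q1 s * (\<Sum>j<n. c j * (um (l j) s * e j (t + x - s))))
            + integral {0..x} (\<lambda>s. - r1 s * (\<Sum>j<n. c j * (zz (l j) s * e j (t + x - s))))"
          by (intro sum_integral_pair qi nri continuous_intros contx ce)
        moreover have a: "(-2) * s + (t + x) = (t + x - s) - s" for s by simp
        ultimately show ?thesis unfolding a Um[symmetric] by (simp only: Z_def)
      qed
      have VmEq: "Vm x t = integral {0..x} (\<lambda>s. q2 s * (esum n c l (2 * s + (t - x)) + Vp s (t + s - x)))
           + integral {0..x} (\<lambda>s. - r2 s * Z s (t + s - x))" for t
      proof -
        have "Vm x t = (\<Sum>j<n. c j * integral {0..x} (\<lambda>s. q2 s * (up (l j) s * e j (t + s - x)) + - r2 s * (zz (l j) s * e j (t + s - x))))"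
          unfolding Vm_def
        proof (rule sum.cong)
          fix j
          have "(um (l j) x - e j (-x)) * e j t = integral {0..x} (\<lambda>s. e j t * (e j (s - x) * (q2 s * up (l j) s - r2 s * zz (l j) s)))"
            using um[OF xb(3), of "l j"] by (simp add: e_def mult.commute)
          also have "\<dots> = integral {0..x} (\<lambda>s. q2 s * (up (l j) s * e j (t + s - x)) + - r2 s * (zz (l j) s * e j (t + s - x)))"
          proof (rule Henstock_Kurzweil_Integration.integral_cong)
            fix s
            have "e j (t + s - x) = e j t * e j (s - x)" by (simp add: e_add add_diff_eq)
            then show "e j t * (e j (s - x) * (q2 s * up (l j) s - r2 s * zz (l j) s)) =
                q2 s * (up (l j) s * e j (t + s - x)) + - r2 s * (zz (l j) s * e j (t + s - x))"
              by (simp add: algebra_simps)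
          qed
          finally show "c j * ((um (l j) x - e j (-x)) * e j t) =
              c j * integral {0..x} (\<lambda>s. q2 s * (up (l j) s * e j (t + s - x)) + - r2 s * (zz (l j) s * e j (t + s - x)))" by simp
        qed simp
        also have "\<dots> = integral {0..x} (\<lambda>s. q2 s * (\<Sum>j<n. c j * (up (l j) s * e j (t + s - x))))
            + integral {0..x} (\<lambda>s. - r2 s * (\<Sum>j<n. c j * (zz (l j) s * e j (t + s - x))))"
          by (intro sum_integral_pair qi nri continuous_intros contx ce)
        moreover have a: "2 * s + (t - x) = (t + s - x) + s" for s by simp
        ultimately show ?thesis unfolding a Up[symmetric] by (simp only: Z_def)
      qed
      have ZEq: "Z x t = integral {0..x} (\<lambda>s. a1 s * (esum n c l (1 * s + t) + Vp s t)) + integral {0..x} (\<lambda>s. a2 s * (esum n c l ((-1) * s + t) + Vm s t))" for t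
      proof -
        have "Z x t = (\<Sum>j<n. c j * integral {0..x} (\<lambda>s. a1 s * (up (l j) s * e j t) + a2 s * (um (l j) s * e j t)))"
          unfolding Z_def
        proof (rule sum.cong)
          fix j
          have "zz (l j) x * e j t = integral {0..x} (\<lambda>s. (a1 s * up (l j) s + a2 s * um (l j) s) * e j t)"
            using zz[OF xb(3), of "l j"] by simp
          then show "c j * (zz (l j) x * e j t) = c j * integral {0..x} (\<lambda>s. a1 s * (up (l j) s * e j t) + a2 s * (um (l j) s * e j t))"
            by (simp add: distrib_right mult.assoc)
        qed simp
        also have "\<dots> = integral {0..x} (\<lambda>s. a1 s * (\<Sum>j<n. c j * (up (l j) s * e j t))) + integral {0..x} (\<lambda>s. a2 s * (\<Sum>j<n. c j * (um (l j) s * e j t)))"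
          by (intro sum_integral_pair qi continuous_intros contx)
        moreover have a: "1 * s + t = t + s" "(-1) * s + t = t - s" for s by simp_all
        ultimately show ?thesis unfolding a Up[symmetric] Um[symmetric] by simp
      qed
      obtain i' t where it: "i = (i', t)" "i' < 3" "\<bar>t\<bar> \<le> X - x" using i by (auto simp: I_def)
      have sub: "(\<lambda>s. s) ` {0..x} \<subseteq> {0..X}" using x by auto
      have cVt: "continuous_on {0..x} (\<lambda>s. Vp s (g s))" "continuous_on {0..x} (\<lambda>s. Vm s (g s))" "continuous_on {0..x} (\<lambda>s. Z s (g s))"
        if "continuous_on {0..x} g" for g
        by (rule cV[OF continuous_on_id sub that])+
      \<comment> \<open>The coefficient \<open>r1\<close> is only integrable. It multiplies
        \<open>Z\<close>, for which the cone bound is pointwise, so no L2 norm of \<open>r1\<close>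
        enters.\<close>
      have b1: "cmod (Vp x t) \<le> l2norm 0 b q1 * N + integral {0..x} (\<lambda>s. k s * m s)"
      proof -
        have "cmod (Vp x t) \<le> cmod (integral {0..x} (\<lambda>s. q1 s * (esum n c l ((-2) * s + (t + x)) + Vm s (t + x - s))))
           + cmod (integral {0..x} (\<lambda>s. - r1 s * Z s (t + x - s)))"
          unfolding VpEq by (rule norm_triangle_ineq)
        also have "\<dots> \<le> (l2norm 0 b q1 * N + integral {0..x} (\<lambda>s. cmod (q1 s) * m s)) + integral {0..x} (\<lambda>s. cmod (- r1 s) * m s)"
          unfolding N_def
          by (intro add_mono norm_integral_esum_le norm_integral_mult_le(1) q xb cVt m mb nri) (use it x in \<open>auto intro!: continuous_intros\<close>)
        also have "\<dots> \<le> l2norm 0 b q1 * N + integral {0..x} (\<lambda>s. k s * m s)"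
          using two[OF qi(1) ri(1)] by (simp add: k_def)
        finally show ?thesis .
      qed
      have b2: "cmod (Vm x t) \<le> l2norm 0 b q2 * N + integral {0..x} (\<lambda>s. k s * m s)"
      proof -
        have "cmod (Vm x t) \<le> cmod (integral {0..x} (\<lambda>s. q2 s * (esum n c l (2 * s + (t - x)) + Vp s (t + s - x))))
           + cmod (integral {0..x} (\<lambda>s. - r2 s * Z s (t + s - x)))"
          unfolding VmEq by (rule norm_triangle_ineq)
        also have "\<dots> \<le> (l2norm 0 b q2 * N + integral {0..x} (\<lambda>s. cmod (q2 s) * m s)) + integral {0..x} (\<lambda>s. cmod (- r2 s) * m s)"
          unfolding N_def
          by (intro add_mono norm_integral_esum_le norm_integral_mult_le(1) q xb cVt m mb nri) (use it x in \<open>auto intro!: continuous_intros\<close>)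
        also have "\<dots> \<le> l2norm 0 b q2 * N + integral {0..x} (\<lambda>s. k s * m s)"
          using two[OF qi(2) ri(2)] by (simp add: k_def)
        finally show ?thesis .
      qed
      have b3: "cmod (Z x t) \<le> (l2norm 0 b a1 + l2norm 0 b a2) * N + integral {0..x} (\<lambda>s. k s * m s)"
      proof -
        have "cmod (Z x t) \<le> cmod (integral {0..x} (\<lambda>s. a1 s * (esum n c l (1 * s + t) + Vp s t)))
           + cmod (integral {0..x} (\<lambda>s. a2 s * (esum n c l ((-1) * s + t) + Vm s t)))"
          unfolding ZEq by (rule norm_triangle_ineq)
        also have "\<dots> \<le> (l2norm 0 b a1 * N + integral {0..x} (\<lambda>s. cmod (a1 s) * m s)) + (l2norm 0 b a2 * N + integral {0..x} (\<lambda>s. cmod (a2 s) * m s))"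
          unfolding N_def
          by (intro add_mono norm_integral_esum_le q xb cVt m mb) (use it x in \<open>auto intro!: continuous_intros\<close>)
        also have "\<dots> \<le> (l2norm 0 b a1 + l2norm 0 b a2) * N + integral {0..x} (\<lambda>s. k s * m s)"
          using two[OF qi(3) qi(4)] by (simp add: k_def distrib_right)
        finally show ?thesis .
      qed
      have "l2norm 0 b q1 * N \<le> Q * N" "l2norm 0 b q2 * N \<le> Q * N" "(l2norm 0 b a1 + l2norm 0 b a2) * N \<le> Q * N"
        using N by (auto intro!: mult_right_mono simp: Q_def l2norm_nonneg)
      then have "f x i \<le> Q * N + integral {0..x} (\<lambda>s. k s * m s)"
        using b1 b2 b3 it unfolding f_def it(1) prod.case by (simp only: split: if_splits) linarith
      then show "f x i \<le> Q * N + integral {0..x} (\<lambda>s. k s * (D * exp (2 * integral {0..s} k)))"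
        by (simp add: m_def E_def)
    qed (use xi k0 in auto)
    have "E X \<le> E b"
    proof -
      have "integral {0..X} k \<le> integral {0..b} k"
        using X k k0 abs_int_subinterval[OF k, of 0 X] by (intro integral_subset_le) (auto simp: absolutely_integrable_on_def)
      then show ?thesis by (simp add: E_def)
    qed
    then have EC: "2 * (Q * N) * E X \<le> C * N"
      using Q N by (simp add: C_def mult_left_mono mult_right_mono mult.assoc mult.left_commute mult.commute)
    have XX: "X \<in> {0..X}" using X by simp
    have e0: "e j 0 = 1" for j by (simp add: e_def)
    \<comment> \<open>At the apex the time factor \<open>e j 0\<close> is \<open>1\<close>, which
      returns the original sums.\<close>
    have "f X (0, 0) \<le> C * N" "f X (1, 0) \<le> C * N" "f X (2, 0) \<le> C * N"
      using gron[OF XX, of "(0, 0)"] gron[OF XX, of "(1, 0)"] gron[OF XX, of "(2, 0)"] EC by (auto simp: I_def)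
    then show ?thesis
      unfolding f_def Vp_def Vm_def Z_def N_def by (simp add: e0) (simp add: e_def)
  qed
  then show ?thesis using C0 unfolding pw_def by blast
qed

section \<open>Transmutation\<close>

lemma continuous_on_bounded_Icc:
  fixes f :: "real \<Rightarrow> complex"
  assumes "continuous_on {a..b} f"
  obtains B where "B \<ge> 0" "\<And>x. x \<in> {a..b} \<Longrightarrow> cmod (f x) \<le> B"
proof -
  have "bounded (f ` {a..b})"
    using compact_continuous_image[OF assms] compact_imp_bounded by auto
  then obtain B where "B > 0" "\<forall>x\<in>{a..b}. cmod (f x) \<le> B"
    unfolding bounded_pos by auto
  then show ?thesis using that[of B] by auto
qed

context pencil
begin

definition th :: "real \<Rightarrow> complex" where "th x = integral {0..x} p"
definition sg :: "real \<Rightarrow> complex" where "sg x = integral {0..x} \<sigma>"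
definition ep :: "real \<Rightarrow> complex" where "ep x = exp (\<i> * th x)"
definition em :: "real \<Rightarrow> complex" where "em x = exp (- \<i> * th x)"

lemma ac_deriv_th: "ac_deriv 0 pi th p"
  unfolding th_def[abs_def] by (rule ac_deriv_indefinite_integral[OF abs_int_p])

lemma ac_deriv_sg: "ac_deriv 0 pi sg \<sigma>"
  unfolding sg_def[abs_def] by (rule ac_deriv_indefinite_integral[OF abs_int_\<sigma>])

lemma ac_deriv_ep: "ac_deriv 0 pi ep (\<lambda>x. \<i> * p x * ep x)"
  and ac_deriv_em: "ac_deriv 0 pi em (\<lambda>x. - \<i> * p x * em x)"
  unfolding ep_def[abs_def] em_def[abs_def] by (intro ac_deriv_exp ac_deriv_cmult ac_deriv_th)+

lemma ac_deriv_exp_sg: "ac_deriv 0 pi (\<lambda>x. exp (- 1 * sg x)) (\<lambda>x. - 1 * \<sigma> x * exp (- 1 * sg x))"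
  by (intro ac_deriv_exp ac_deriv_cmult ac_deriv_sg)

lemma continuous_sg: "continuous_on {0..pi} sg"
  and continuous_ep: "continuous_on {0..pi} ep"
  and continuous_em: "continuous_on {0..pi} em"
  using ac_deriv_sg ac_deriv_ep ac_deriv_em by (auto dest: ac_deriv_continuous)

lemma ep_em [simp]: "ep x * em x = 1" "em x * ep x = 1"
  by (simp_all add: ep_def em_def flip: exp_add)

text \<open>\<open>cos (l x - th x)\<close> and \<open>sin (l x - th x)\<close>, written with \<open>em = exp (-i th)\<close> and \<open>ep = exp (i th)\<close>.\<close>

definition cth :: "complex \<Rightarrow> real \<Rightarrow> complex" where
  "cth l x = (em x * exp (\<i> * l * of_real x) + ep x * exp (\<i> * l * of_real (- x))) / 2"

definition sth :: "complex \<Rightarrow> real \<Rightarrow> complex" where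
  "sth l x = (em x * exp (\<i> * l * of_real x) - ep x * exp (\<i> * l * of_real (- x))) / (2 * \<i>)"

lemma ac_deriv_ysol: "ac_deriv 0 pi (ysol l) (\<lambda>s. \<sigma> s * ysol l s + y1sol l s)"
  and ac_deriv_y1sol: "ac_deriv 0 pi (y1sol l) (\<lambda>s. q l s * ysol l s - \<sigma> s * y1sol l s)"
  and ysol_0: "ysol l 0 = 0" and y1sol_0: "y1sol l 0 = 1"
  using volterra_sol_ac_deriv[OF volterra_sol_ysol[of l]] by auto

text \<open>The functions \<open>up\<close>, \<open>um\<close> diagonalize the principal part of the equation, and the factors \<open>ep\<close>,
  \<open>em\<close> remove the diagonal terms of order zero.\<close>

lemma transmutation:
  "\<exists>C\<ge>0. \<forall>x\<in>{0..pi}. pw x C (\<lambda>l. y1sol l x - cth l x) \<and> pw x C (\<lambda>l. l * ysol l x - sth l x) \<and>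
     pw x C (\<lambda>l. ysol l x)"
proof -
  define up where "up = (\<lambda>l x. ep x * (y1sol l x + (\<i> * l) * ysol l x))"
  define um where "um = (\<lambda>l x. em x * (y1sol l x + (- \<i> * l) * ysol l x))"
  \<comment> \<open>\<open>exp (- sg)\<close> is an integrating factor for
    \<open>y' = \<sigma> y + y1\<close>: the derivative of \<open>zz\<close> is
    \<open>exp (- sg) * y1\<close>, a combination of \<open>up\<close> and \<open>um\<close> with
    continuous coefficients \<open>a1\<close>, \<open>a2\<close>.\<close>
  define zz where "zz = (\<lambda>l x. exp (- 1 * sg x) * ysol l x)"
  define q1 where "q1 = (\<lambda>s. (\<i> * p s - \<sigma> s) * (ep s * ep s))"
  define q2 where "q2 = (\<lambda>s. (- \<i> * p s - \<sigma> s) * (em s * em s))"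
  define r1 where "r1 = (\<lambda>s. (\<sigma> s)\<^sup>2 * (ep s * exp (sg s)))"
  define r2 where "r2 = (\<lambda>s. (\<sigma> s)\<^sup>2 * (em s * exp (sg s)))"
  define a1 where "a1 = (\<lambda>s. exp (- 1 * sg s) * em s / 2)"
  define a2 where "a2 = (\<lambda>s. exp (- 1 * sg s) * ep s / 2)"
  note c = continuous_ysol continuous_y1sol continuous_sg continuous_ep continuous_em
  have ss: "exp (sg s) * exp (- 1 * sg s) = 1" for s by (simp flip: exp_add)
  have "\<exists>C\<ge>0. \<forall>x\<in>{0..pi}. pw x C (\<lambda>l. up l x - exp (\<i> * l * of_real x)) \<and>
     pw x C (\<lambda>l. um l x - exp (\<i> * l * of_real (- x))) \<and> pw x C (\<lambda>l. zz l x)"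
  proof (rule hyperbolic_pw[where ?q1.0=q1 and ?q2.0=q2 and ?r1.0=r1 and ?r2.0=r2 and ?a1.0=a1 and ?a2.0=a2])
    show "sq_int 0 pi q1" unfolding q1_def
      by (intro sq_int_times_continuous sq_int_diff sq_int_cmult sq_p sq_\<sigma> continuous_on_mult c)
    show "sq_int 0 pi q2" unfolding q2_def
      by (intro sq_int_times_continuous sq_int_diff sq_int_cmult sq_p sq_\<sigma> continuous_on_mult c)
    show "sq_int 0 pi a1" "sq_int 0 pi a2" unfolding a1_def a2_def
      by (intro sq_int_continuous continuous_intros c; simp)+
    show "r1 absolutely_integrable_on {0..pi}" "r2 absolutely_integrable_on {0..pi}" unfolding r1_def r2_def
      by (intro abs_int_times_continuous[OF abs_int_\<sigma>2] continuous_intros c)+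
    show "continuous_on {0..pi} (up l)" "continuous_on {0..pi} (um l)" "continuous_on {0..pi} (zz l)" for l
      unfolding up_def um_def zz_def by (intro continuous_intros c)+
    fix l x assume x: "x \<in> {0..pi}"
    have w: "ac_deriv 0 pi (\<lambda>s. y1sol l s + k * ysol l s) (\<lambda>s. (q l s * ysol l s - \<sigma> s * y1sol l s) + k * (\<sigma> s * ysol l s + y1sol l s))" for k
      by (intro ac_deriv_add ac_deriv_cmult ac_deriv_ysol ac_deriv_y1sol)
    have e: "ac_deriv 0 pi (\<lambda>s. exp (k * of_real x + (- k) * of_real s)) (\<lambda>s. (0 + (- k) * 1) * exp (k * of_real x + (- k) * of_real s))" for k :: complex
      by (intro ac_deriv_exp ac_deriv_add ac_deriv_const ac_deriv_cmult ac_deriv_ident)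
    have eq: "exp (k * of_real x + (- k) * of_real s) = exp (k * of_real (x - s))" for k :: complex and s
      by (simp add: algebra_simps)
    \<comment> \<open>The exponential removes the principal term \<open>i l up\<close>, and
      \<open>ep\<close> has removed the multiple of \<open>up\<close> by \<open>p\<close>; the rest
      couples only to \<open>um\<close> and \<open>zz\<close>.\<close>
    have A: "ac_deriv 0 pi (\<lambda>s. exp ((\<i> * l) * of_real (x - s)) * up l s)
       (\<lambda>s. exp (\<i> * l * of_real (x - s)) * (q1 s * um l s - r1 s * zz l s))"
    proof (rule ac_deriv_cong)
      show "ac_deriv 0 pi (\<lambda>s. exp ((\<i> * l) * of_real (x - s)) * up l s)
        (\<lambda>s. exp ((\<i> * l) * of_real (x - s)) * (ep s * ((q l s * ysol l s - \<sigma> s * y1sol l s) + (\<i> * l) * (\<sigma> s * ysol l s + y1sol l s)) + (\<i> * p s * ep s) * (y1sol l s + (\<i> * l) * ysol l s))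
          + ((0 + (- (\<i> * l)) * 1) * exp ((\<i> * l) * of_real (x - s))) * (ep s * (y1sol l s + (\<i> * l) * ysol l s)))"
        using ac_deriv_mult[OF e[of "\<i> * l"] ac_deriv_mult[OF ac_deriv_ep w[of "\<i> * l"]]] unfolding eq up_def .
      fix s
      define X where "X = exp ((\<i> * l) * of_real (x - s))"
      have "q1 s * um l s = ep s * ((\<i> * p s - \<sigma> s) * (y1sol l s + (- \<i> * l) * ysol l s)) * (ep s * em s)"
        unfolding q1_def um_def by (simp only: mult_ac)
      moreover have "r1 s * zz l s = ep s * ((\<sigma> s)\<^sup>2 * ysol l s) * (exp (sg s) * exp (- 1 * sg s))"
        unfolding r1_def zz_def by (simp only: mult_ac)
      ultimately have R: "q1 s * um l s - r1 s * zz l s = ep s * ((\<i> * p s - \<sigma> s) * (y1sol l s + (- \<i> * l) * ysol l s) - (\<sigma> s)\<^sup>2 * ysol l s)"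
        unfolding ss by (simp add: algebra_simps)
      show "exp ((\<i> * l) * of_real (x - s)) * (ep s * ((q l s * ysol l s - \<sigma> s * y1sol l s) + (\<i> * l) * (\<sigma> s * ysol l s + y1sol l s)) + (\<i> * p s * ep s) * (y1sol l s + (\<i> * l) * ysol l s))
          + ((0 + (- (\<i> * l)) * 1) * exp ((\<i> * l) * of_real (x - s))) * (ep s * (y1sol l s + (\<i> * l) * ysol l s))
         = exp (\<i> * l * of_real (x - s)) * (q1 s * um l s - r1 s * zz l s)"
        unfolding R X_def[symmetric] q_def by (simp add: algebra_simps power2_eq_square)
    qed
    show "up l x = exp (\<i> * l * of_real x) +
        integral {0..x} (\<lambda>s. exp (\<i> * l * of_real (x - s)) * (q1 s * um l s - r1 s * zz l s))"
      using ac_deriv_integral(1)[OF A, of x] x by (simp add: up_def ysol_0 y1sol_0 ep_def th_def)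
    have B: "ac_deriv 0 pi (\<lambda>s. exp ((- \<i> * l) * of_real (x - s)) * um l s)
       (\<lambda>s. exp (\<i> * l * of_real (s - x)) * (q2 s * up l s - r2 s * zz l s))"
    proof (rule ac_deriv_cong)
      show "ac_deriv 0 pi (\<lambda>s. exp ((- \<i> * l) * of_real (x - s)) * um l s)
        (\<lambda>s. exp ((- \<i> * l) * of_real (x - s)) * (em s * ((q l s * ysol l s - \<sigma> s * y1sol l s) + (- \<i> * l) * (\<sigma> s * ysol l s + y1sol l s)) + (- \<i> * p s * em s) * (y1sol l s + (- \<i> * l) * ysol l s))
          + ((0 + (- (- \<i> * l)) * 1) * exp ((- \<i> * l) * of_real (x - s))) * (em s * (y1sol l s + (- \<i> * l) * ysol l s)))"
        using ac_deriv_mult[OF e[of "- \<i> * l"] ac_deriv_mult[OF ac_deriv_em w[of "- \<i> * l"]]] unfolding eq um_def .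
      fix s
      define X where "X = exp ((- \<i> * l) * of_real (x - s))"
      have X: "exp (\<i> * l * of_real (s - x)) = X" unfolding X_def by (simp add: algebra_simps)
      have "q2 s * up l s = em s * ((- \<i> * p s - \<sigma> s) * (y1sol l s + (\<i> * l) * ysol l s)) * (ep s * em s)"
        unfolding q2_def up_def by (simp only: mult_ac)
      moreover have "r2 s * zz l s = em s * ((\<sigma> s)\<^sup>2 * ysol l s) * (exp (sg s) * exp (- 1 * sg s))"
        unfolding r2_def zz_def by (simp only: mult_ac)
      ultimately have R: "q2 s * up l s - r2 s * zz l s = em s * ((- \<i> * p s - \<sigma> s) * (y1sol l s + (\<i> * l) * ysol l s) - (\<sigma> s)\<^sup>2 * ysol l s)"
        unfolding ss by (simp add: algebra_simps)
      show "exp ((- \<i> * l) * of_real (x - s)) * (em s * ((q l s * ysol l s - \<sigma> s * y1sol l s) + (- \<i> * l) * (\<sigma> s * ysol l s + y1sol l s)) + (- \<i> * p s * em s) * (y1sol l s + (- \<i> * l) * ysol l s))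
          + ((0 + (- (- \<i> * l)) * 1) * exp ((- \<i> * l) * of_real (x - s))) * (em s * (y1sol l s + (- \<i> * l) * ysol l s))
         = exp (\<i> * l * of_real (s - x)) * (q2 s * up l s - r2 s * zz l s)"
        unfolding R X X_def[symmetric] q_def by (simp add: algebra_simps power2_eq_square)
    qed
    show "um l x = exp (\<i> * l * of_real (- x)) +
        integral {0..x} (\<lambda>s. exp (\<i> * l * of_real (s - x)) * (q2 s * up l s - r2 s * zz l s))"
      using ac_deriv_integral(1)[OF B, of x] x by (simp add: um_def ysol_0 y1sol_0 em_def th_def)
    have Cz: "ac_deriv 0 pi (zz l) (\<lambda>s. a1 s * up l s + a2 s * um l s)"
    proof (rule ac_deriv_cong)
      show "ac_deriv 0 pi (zz l) (\<lambda>s. exp (- 1 * sg s) * (\<sigma> s * ysol l s + y1sol l s) + (- 1 * \<sigma> s * exp (- 1 * sg s)) * ysol l s)"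
        unfolding zz_def by (intro ac_deriv_mult ac_deriv_exp_sg ac_deriv_ysol)
      fix s
      have "a1 s * up l s + a2 s * um l s = exp (- 1 * sg s) / 2 * ((em s * ep s) * (y1sol l s + (\<i> * l) * ysol l s) + (ep s * em s) * (y1sol l s + (- \<i> * l) * ysol l s))"
        unfolding a1_def a2_def up_def um_def by (simp add: algebra_simps del: ep_em)
      also have "\<dots> = exp (- 1 * sg s) * y1sol l s" unfolding ep_em by (simp add: algebra_simps)
      finally show "exp (- 1 * sg s) * (\<sigma> s * ysol l s + y1sol l s) + (- 1 * \<sigma> s * exp (- 1 * sg s)) * ysol l s = a1 s * up l s + a2 s * um l s"
        by (simp add: algebra_simps)
    qed
    show "zz l x = integral {0..x} (\<lambda>s. a1 s * up l s + a2 s * um l s)"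
      using ac_deriv_integral(1)[OF Cz, of x] x by (simp add: zz_def ysol_0)
  qed
  then obtain C where C: "C \<ge> 0" "\<And>x. x \<in> {0..pi} \<Longrightarrow> pw x C (\<lambda>l. up l x - exp (\<i> * l * of_real x)) \<and>
     pw x C (\<lambda>l. um l x - exp (\<i> * l * of_real (- x))) \<and> pw x C (\<lambda>l. zz l x)" by blast
  obtain M1 where M1: "M1 \<ge> 0" "\<And>x. x \<in> {0..pi} \<Longrightarrow> cmod (ep x) \<le> M1" using continuous_on_bounded_Icc[OF continuous_ep] by blast
  obtain M2 where M2: "M2 \<ge> 0" "\<And>x. x \<in> {0..pi} \<Longrightarrow> cmod (em x) \<le> M2" using continuous_on_bounded_Icc[OF continuous_em] by blast
  obtain M3 where M3: "M3 \<ge> 0" "\<And>x. x \<in> {0..pi} \<Longrightarrow> cmod (exp (sg x)) \<le> M3"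
    using continuous_on_bounded_Icc[of 0 pi "\<lambda>x. exp (sg x)"] continuous_sg by (auto intro: continuous_intros)
  define K where "K = (M1 + M2 + M3) * C"
  show ?thesis
  proof (intro exI[of _ K] conjI ballI)
    show "K \<ge> 0" using C M1 M2 M3 by (simp add: K_def)
    fix x assume x: "x \<in> {0..pi}"
    note Cx = C(2)[OF x]
    have b: "cmod (em x / 2) * C + cmod (ep x / 2) * C \<le> K"
    proof -
      have "cmod (em x / 2) * C + cmod (ep x / 2) * C = ((cmod (em x) + cmod (ep x)) / 2) * C"
        by (simp add: norm_divide field_simps)
      also have "\<dots> \<le> (M1 + M2 + M3) * C"
      proof (rule mult_right_mono[OF _ C(1)])
        have "cmod (em x) \<le> M2" "cmod (ep x) \<le> M1" by (rule M2(2)[OF x], rule M1(2)[OF x])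
        then show "(cmod (em x) + cmod (ep x)) / 2 \<le> M1 + M2 + M3"
          using M1(1) M2(1) M3(1) by (simp add: field_simps)
      qed
      finally show ?thesis by (simp add: K_def)
    qed
    \<comment> \<open>Inverse of the diagonalization: \<open>y1sol\<close> is half of
      \<open>em * up + ep * um\<close>, and the same combination of the free waves is
      \<open>cth\<close>.\<close>
    have y1: "y1sol l x - cth l x = em x / 2 * (up l x - exp (\<i> * l * of_real x)) + ep x / 2 * (um l x - exp (\<i> * l * of_real (- x)))" for l
    proof -
      have "em x / 2 * (up l x - exp (\<i> * l * of_real x)) + ep x / 2 * (um l x - exp (\<i> * l * of_real (- x))) =
        ((em x * ep x) * (y1sol l x + (\<i> * l) * ysol l x) + (ep x * em x) * (y1sol l x + (- \<i> * l) * ysol l x)) / 2 - cth l x"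
        unfolding up_def um_def cth_def by (simp add: field_simps del: ep_em)
      then show ?thesis unfolding ep_em by (simp add: field_simps)
    qed
    have ly: "l * ysol l x - sth l x = (- \<i> * em x / 2) * (up l x - exp (\<i> * l * of_real x)) + (\<i> * ep x / 2) * (um l x - exp (\<i> * l * of_real (- x)))" for l
    proof -
      have "(- \<i> * em x / 2) * (up l x - exp (\<i> * l * of_real x)) + (\<i> * ep x / 2) * (um l x - exp (\<i> * l * of_real (- x))) =
        (- \<i> * (em x * ep x) * (y1sol l x + (\<i> * l) * ysol l x) + \<i> * (ep x * em x) * (y1sol l x + (- \<i> * l) * ysol l x)) / 2 - sth l x"
        unfolding up_def um_def sth_def by (simp add: field_simps del: ep_em)
      then show ?thesis unfolding ep_em by (simp add: field_simps)
    qed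
    show "pw x K (\<lambda>l. y1sol l x - cth l x)"
      unfolding y1 by (rule pw_mono[OF pw_add[OF pw_cmult pw_cmult]]) (use Cx b \<open>K \<ge> 0\<close> in auto)
    show "pw x K (\<lambda>l. l * ysol l x - sth l x)"
      unfolding ly by (rule pw_mono[OF pw_add[OF pw_cmult pw_cmult]]) (use Cx b \<open>K \<ge> 0\<close> in \<open>auto simp: norm_mult norm_divide\<close>)
    have y: "ysol l x = exp (sg x) * zz l x" for l
      using ss[of x] by (simp add: zz_def mult.assoc[symmetric])
    have "cmod (exp (sg x)) * C \<le> K"
      unfolding K_def using M1(1) M2(1) M3(2)[OF x] by (intro mult_right_mono C(1)) simp
    then show "pw x K (\<lambda>l. ysol l x)"
      unfolding y by (intro pw_mono[OF pw_cmult]) (use Cx \<open>K \<ge> 0\<close> in auto)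
  qed
qed

end

section \<open>Completeness\<close>

text \<open>\<open>zorder\<close> is the index of the first nonvanishing derivative, also when this
  index is \<open>0\<close>, that is, at a point which is not a zero. If all derivatives vanish at
  \<open>z\<close>, there is nothing to prove.\<close>

lemma zero_mult_imp_deriv_zero:
  assumes f: "f holomorphic_on UNIV" and m: "enat m \<le> zero_mult f z" and j: "j < m"
  shows "(deriv ^^ j) f z = 0"
proof (cases "\<exists>N. (deriv ^^ N) f z \<noteq> 0")
  case True
  define N where "N = (LEAST N. (deriv ^^ N) f z \<noteq> 0)"
  have N: "(deriv ^^ N) f z \<noteq> 0" unfolding N_def by (rule LeastI_ex[OF True])
  have less: "(deriv ^^ i) f z = 0" if "i < N" for i
    using that not_less_Least unfolding N_def by blast
  have "zorder f z = int N"
    by (rule zorder_zero_eqI[OF f open_UNIV UNIV_I]) (use N less in auto)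
  moreover have "\<not> (\<forall>w. f w = 0)"
  proof
    assume "\<forall>w. f w = 0"
    then have "f = (\<lambda>w. 0)" by auto
    then have "(deriv ^^ N) f z = 0" by simp
    then show False using N by simp
  qed
  ultimately have "zero_mult f z = enat N" by (simp only: zero_mult_def if_False nat_int)
  then have "m \<le> N" using m by simp
  then show ?thesis using less j by simp
qed blast

text \<open>\<open>w\<close> is the value at \<open>g\<close> of the continuous extension of the functional \<open>exp (i l t) \<mapsto> F l\<close>.\<close>

definition pw_ext :: "real \<Rightarrow> (complex \<Rightarrow> complex) \<Rightarrow> (real \<Rightarrow> complex) \<Rightarrow> complex \<Rightarrow> bool" where
  "pw_ext a F g w \<longleftrightarrow> sq_int (-a) a g \<and>
     (\<forall>e>0. \<exists>n c l. l2norm (-a) a (\<lambda>t. g t - esum n c l t) < e \<and> cmod ((\<Sum>j<n. c j * F (l j)) - w) < e)"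

text \<open>The coefficients and frequencies are chosen before \<open>G\<close>, so one
  concatenation serves the exponentials and the values of \<open>F\<close> together.\<close>

lemma esum_append:
  fixes n1 n2 :: nat and c1 c2 l1 l2 :: "nat \<Rightarrow> complex"
  shows "\<exists>c l. \<forall>G. (\<Sum>j<n1 + n2. c j * G (l j)) = (\<Sum>j<n1. c1 j * G (l1 j)) + (\<Sum>j<n2. c2 j * G (l2 j))"
proof (intro exI allI)
  fix G :: "complex \<Rightarrow> complex"
  let ?c = "\<lambda>j. if j < n1 then c1 j else c2 (j - n1)" and ?l = "\<lambda>j. if j < n1 then l1 j else l2 (j - n1)"
  show "(\<Sum>j<n1 + n2. ?c j * G (?l j)) = (\<Sum>j<n1. c1 j * G (l1 j)) + (\<Sum>j<n2. c2 j * G (l2 j))"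
    by (induction n2) (simp_all add: add.assoc)
qed

lemma pw_ext_add:
  assumes "pw_ext a F g w" "pw_ext a F h v"
  shows "pw_ext a F (\<lambda>t. g t + h t) (w + v)"
  unfolding pw_ext_def
proof (intro conjI allI impI)
  have g: "sq_int (-a) a g" and h: "sq_int (-a) a h" using assms by (auto simp: pw_ext_def)
  show "sq_int (-a) a (\<lambda>t. g t + h t)" by (rule sq_int_add[OF g h])
  fix e :: real assume "e > 0"
  then have e2: "e / 2 > 0" by simp
  obtain n1 c1 l1 where 1: "l2norm (-a) a (\<lambda>t. g t - esum n1 c1 l1 t) < e / 2" "cmod ((\<Sum>j<n1. c1 j * F (l1 j)) - w) < e / 2"
    using assms(1) e2 unfolding pw_ext_def by blast
  obtain n2 c2 l2 where 2: "l2norm (-a) a (\<lambda>t. h t - esum n2 c2 l2 t) < e / 2" "cmod ((\<Sum>j<n2. c2 j * F (l2 j)) - v) < e / 2"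
    using assms(2) e2 unfolding pw_ext_def by blast
  obtain c l where cl: "\<And>G. (\<Sum>j<n1 + n2. c j * G (l j)) = (\<Sum>j<n1. c1 j * G (l1 j)) + (\<Sum>j<n2. c2 j * G (l2 j))"
    using esum_append[where ?n1.0=n1 and ?n2.0=n2 and ?c1.0=c1 and ?c2.0=c2 and ?l1.0=l1 and ?l2.0=l2] by blast
  have es: "esum (n1 + n2) c l t = esum n1 c1 l1 t + esum n2 c2 l2 t" for t
    using cl[of "\<lambda>l. exp (\<i> * l * of_real t)"] by (simp add: esum_def)
  have "l2norm (-a) a (\<lambda>t. g t + h t - esum (n1 + n2) c l t) = l2norm (-a) a (\<lambda>t. (g t - esum n1 c1 l1 t) + (h t - esum n2 c2 l2 t))"
    unfolding es by (simp add: algebra_simps)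
  also have "\<dots> \<le> l2norm (-a) a (\<lambda>t. g t - esum n1 c1 l1 t) + l2norm (-a) a (\<lambda>t. h t - esum n2 c2 l2 t)"
    by (intro l2norm_triangle sq_int_diff g h sq_int_esum)
  also have "\<dots> < e" using 1 2 by linarith
  finally have A: "l2norm (-a) a (\<lambda>t. g t + h t - esum (n1 + n2) c l t) < e" .
  have eq: "(\<Sum>j<n1 + n2. c j * F (l j)) - (w + v) = ((\<Sum>j<n1. c1 j * F (l1 j)) - w) + ((\<Sum>j<n2. c2 j * F (l2 j)) - v)"
    unfolding cl by simp
  have "cmod ((\<Sum>j<n1 + n2. c j * F (l j)) - (w + v)) < e"
    unfolding eq by (rule order_le_less_trans[OF norm_triangle_ineq]) (use 1 2 in linarith)
  then show "\<exists>n c l. l2norm (-a) a (\<lambda>t. g t + h t - esum n c l t) < e \<and> cmod ((\<Sum>j<n. c j * F (l j)) - (w + v)) < e"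
    using A by blast
qed

lemma pw_ext_cmult:
  assumes "pw_ext a F g w"
  shows "pw_ext a F (\<lambda>t. k * g t) (k * w)"
  unfolding pw_ext_def
proof (intro conjI allI impI)
  have g: "sq_int (-a) a g" using assms by (auto simp: pw_ext_def)
  show "sq_int (-a) a (\<lambda>t. k * g t)" by (rule sq_int_cmult[OF g])
  fix e :: real assume "e > 0"
  define d where "d = e / (cmod k + 1)"
  have k1: "cmod k + 1 > 0" by (simp add: add_nonneg_pos)
  have d: "d > 0" "cmod k * d < e" using \<open>e > 0\<close> k1 by (auto simp: d_def field_simps)
  obtain n c l where 1: "l2norm (-a) a (\<lambda>t. g t - esum n c l t) < d" "cmod ((\<Sum>j<n. c j * F (l j)) - w) < d"
    using assms d(1) unfolding pw_ext_def by blast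
  have es: "esum n (\<lambda>j. k * c j) l t = k * esum n c l t" for t
    by (simp add: esum_def sum_distrib_left mult.assoc)
  have "l2norm (-a) a (\<lambda>t. k * g t - esum n (\<lambda>j. k * c j) l t) = l2norm (-a) a (\<lambda>t. k * (g t - esum n c l t))"
    unfolding es by (simp add: algebra_simps)
  also have "\<dots> = cmod k * l2norm (-a) a (\<lambda>t. g t - esum n c l t)"
    by (intro sq_int_cmult sq_int_diff g sq_int_esum)
  also have "\<dots> \<le> cmod k * d" using 1 by (intro mult_left_mono) auto
  finally have A: "l2norm (-a) a (\<lambda>t. k * g t - esum n (\<lambda>j. k * c j) l t) < e" using d by linarith
  have "(\<Sum>j<n. k * c j * F (l j)) - k * w = k * ((\<Sum>j<n. c j * F (l j)) - w)"
    by (simp add: sum_distrib_left algebra_simps)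
  then have "cmod ((\<Sum>j<n. k * c j * F (l j)) - k * w) \<le> cmod k * d"
    using 1 by (simp add: norm_mult mult_left_mono)
  then show "\<exists>n c l. l2norm (-a) a (\<lambda>t. k * g t - esum n c l t) < e \<and> cmod ((\<Sum>j<n. c j * F (l j)) - k * w) < e"
    using A d by (intro exI[of _ n] exI[of _ "\<lambda>j. k * c j"] exI[of _ l]) linarith
qed

lemma pw_ext_zero: "pw_ext a F (\<lambda>_. 0) 0"
  unfolding pw_ext_def
  by (auto intro!: exI[of _ 0] simp: sq_int_zero esum_def)

lemma pw_ext_sum:
  assumes "\<And>i. i \<in> I \<Longrightarrow> pw_ext a F (g i) (w i)"
  shows "pw_ext a F (\<lambda>t. \<Sum>i\<in>I. g i t) (\<Sum>i\<in>I. w i)"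
  using assms by (induction I rule: infinite_finite_induct) (auto simp: pw_ext_zero pw_ext_add)

lemma pw_ext_exp: "pw_ext a F (\<lambda>t. exp (\<i> * l * of_real t)) (F l)"
  unfolding pw_ext_def
proof (intro conjI allI impI)
  show "sq_int (-a) a (\<lambda>t. exp (\<i> * l * of_real t))" by (intro sq_int_continuous continuous_intros)
  fix e :: real assume "e > 0"
  then show "\<exists>n c l'. l2norm (-a) a (\<lambda>t. exp (\<i> * l * of_real t) - esum n c l' t) < e \<and> cmod ((\<Sum>j<n. c j * F (l' j)) - F l) < e"
    by (intro exI[of _ 1] exI[of _ "\<lambda>_. 1"] exI[of _ "\<lambda>_. l"]) (simp add: esum_def sq_int_zero)
qed

lemma pw_ext_limit:
  assumes g: "sq_int (-a) a g"
    and lim: "\<And>e. e > 0 \<Longrightarrow> \<exists>h v. pw_ext a F h v \<and> l2norm (-a) a (\<lambda>t. g t - h t) < e \<and> cmod (v - w) < e"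
  shows "pw_ext a F g w"
  unfolding pw_ext_def
proof (intro conjI allI impI g)
  fix e :: real assume "e > 0"
  then have e2: "e / 2 > 0" by simp
  obtain h v where h: "pw_ext a F h v" "l2norm (-a) a (\<lambda>t. g t - h t) < e / 2" "cmod (v - w) < e / 2"
    using lim[OF e2] by blast
  then obtain n c l where 1: "l2norm (-a) a (\<lambda>t. h t - esum n c l t) < e / 2" "cmod ((\<Sum>j<n. c j * F (l j)) - v) < e / 2"
    using e2 unfolding pw_ext_def by blast
  have hs: "sq_int (-a) a h" using h by (simp add: pw_ext_def)
  have "l2norm (-a) a (\<lambda>t. g t - esum n c l t) \<le> l2norm (-a) a (\<lambda>t. g t - h t) + l2norm (-a) a (\<lambda>t. h t - esum n c l t)"
    using l2norm_triangle[OF sq_int_diff[OF g hs] sq_int_diff[OF hs sq_int_esum[of _ _ n c l]]] by simp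
  moreover have "cmod ((\<Sum>j<n. c j * F (l j)) - w) \<le> cmod ((\<Sum>j<n. c j * F (l j)) - v) + cmod (v - w)"
    using norm_triangle_ineq[of "(\<Sum>j<n. c j * F (l j)) - v" "v - w"] by simp
  ultimately show "\<exists>n c l. l2norm (-a) a (\<lambda>t. g t - esum n c l t) < e \<and> cmod ((\<Sum>j<n. c j * F (l j)) - w) < e"
    using h 1 by (intro exI[of _ n] exI[of _ c] exI[of _ l]) linarith
qed

text \<open>The inequality of \<open>pw\<close> survives the limit. Applied to differences, it shows
  that \<open>g\<close> determines \<open>w\<close>.\<close>

lemma pw_ext_bound:
  assumes F: "pw a C F" "C \<ge> 0" and g: "pw_ext a F g w"
  shows "cmod w \<le> C * l2norm (-a) a g"
proof (rule field_le_epsilon)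
  fix e :: real assume e: "e > 0"
  define d where "d = e / (C + 1)"
  have d: "d > 0" "(C + 1) * d = e" using e F by (auto simp: d_def field_simps)
  obtain n c l where 1: "l2norm (-a) a (\<lambda>t. g t - esum n c l t) < d" "cmod ((\<Sum>j<n. c j * F (l j)) - w) < d"
    using g d unfolding pw_ext_def by blast
  have gs: "sq_int (-a) a g" using g by (simp add: pw_ext_def)
  have "cmod w \<le> cmod (\<Sum>j<n. c j * F (l j)) + cmod ((\<Sum>j<n. c j * F (l j)) - w)"
    by (metis add.commute norm_minus_commute norm_triangle_sub)
  also have "\<dots> \<le> C * l2norm (-a) a (esum n c l) + d"
    using pwD[OF F(1), where n=n and c=c and l=l] 1 by linarith
  also have "l2norm (-a) a (esum n c l) \<le> l2norm (-a) a g + l2norm (-a) a (\<lambda>t. esum n c l t - g t)"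
    using l2norm_triangle[OF gs sq_int_diff[OF sq_int_esum[of _ _ n c l] gs]] by simp
  also have "\<dots> \<le> l2norm (-a) a g + d"
    using 1(1) l2norm_minus_commute[of "-a" a "esum n c l" g] by simp
  finally have "cmod w \<le> C * (l2norm (-a) a g + d) + d" using F by (simp add: mult_left_mono)
  then show "cmod w \<le> C * l2norm (-a) a g + e" using d by (simp add: algebra_simps)
qed

lemma norm_exp_diff_quotient_le:
  fixes h t :: real
  assumes "h > 0"
  shows "cmod ((exp (\<i> * of_real h * of_real t) - 1) / of_real h - \<i> * of_real t) \<le> h * t\<^sup>2"
proof -
  have "cmod (exp (\<i> * of_real h * of_real t) - (\<Sum>k\<le>1. (\<i> * of_real h * of_real t) ^ k / fact k))
     \<le> exp \<bar>Re (\<i> * of_real h * of_real t)\<bar> * cmod (\<i> * of_real h * of_real t) ^ Suc 1 / fact 1"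
    by (rule Taylor_exp)
  then have b: "cmod (exp (\<i> * of_real h * of_real t) - 1 - \<i> * of_real h * of_real t) \<le> (h * t)\<^sup>2"
    by (simp add: norm_mult power2_eq_square power_mult_distrib abs_mult diff_diff_eq)
  have "(exp (\<i> * of_real h * of_real t) - 1) / of_real h - \<i> * of_real t = (exp (\<i> * of_real h * of_real t) - 1 - \<i> * of_real h * of_real t) / of_real h"
    using assms by (simp add: field_simps)
  then have "cmod ((exp (\<i> * of_real h * of_real t) - 1) / of_real h - \<i> * of_real t) = cmod (exp (\<i> * of_real h * of_real t) - 1 - \<i> * of_real h * of_real t) / h"
    using assms by (simp add: norm_divide)
  also have "\<dots> \<le> (h * t)\<^sup>2 / h" using b assms by (intro divide_right_mono) auto
  also have "\<dots> = h * t\<^sup>2" using assms by (simp add: power2_eq_square)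
  finally show ?thesis .
qed

text \<open>Induction by difference quotients in the frequency: those of the exponential converge
  uniformly in \<open>t\<close> by Taylor's estimate, those of the \<open>k\<close>-th derivative of
  \<open>F\<close> by holomorphy, and \<open>pw_ext_limit\<close> closes the step.\<close>

lemma pw_ext_deriv_exp:
  assumes F: "F holomorphic_on UNIV" and a: "a \<ge> 0"
  shows "pw_ext a F (\<lambda>t. (\<i> * of_real t) ^ k * exp (\<i> * l * of_real t)) ((deriv ^^ k) F l)"
proof (induction k arbitrary: l)
  case 0
  then show ?case by (simp add: pw_ext_exp)
next
  case (Suc k)
  show ?case
  proof (rule pw_ext_limit)
    show "sq_int (-a) a (\<lambda>t. (\<i> * of_real t) ^ Suc k * exp (\<i> * l * of_real t))"
      by (intro sq_int_continuous continuous_intros)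
    fix e :: real assume e: "e > 0"
    define Fk where "Fk = (deriv ^^ k) F"
    have "Fk holomorphic_on UNIV" unfolding Fk_def using F by (intro holomorphic_higher_deriv) auto
    then have "(Fk has_field_derivative deriv Fk l) (at l)"
      by (intro holomorphic_derivI[of _ UNIV]) auto
    then have lim: "((\<lambda>h. (Fk (l + h) - Fk l) / h) \<longlongrightarrow> deriv Fk l) (at 0)"
      by (simp add: DERIV_def)
    obtain d where d: "d > 0" "\<And>h. h \<noteq> 0 \<Longrightarrow> cmod h < d \<Longrightarrow> cmod ((Fk (l + h) - Fk l) / h - deriv Fk l) < e"
      using tendstoD[OF lim e] unfolding eventually_at by (auto simp: dist_norm)
    define M where "M = a ^ k * exp (cmod l * a) * a\<^sup>2"
    have M: "M \<ge> 0" using a by (simp add: M_def)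
    define s where "s = sqrt (a - (-a)) * M"
    have s: "s \<ge> 0" using M a by (simp add: s_def)
    \<comment> \<open>The bound \<open>d / 2\<close> serves the difference quotient of
      \<open>Fk\<close>, the other one the L2 error \<open>h * s\<close> of the
      exponentials.\<close>
    define h where "h = min (d / 2) (e / (2 * (s + 1)))"
    have h: "h > 0" "h < d" using d e s by (auto simp: h_def)
    have hs: "h * s < e"
    proof -
      have "h * s \<le> e / (2 * (s + 1)) * s" using s by (intro mult_right_mono) (auto simp: h_def)
      also have "\<dots> < e" using e s add_nonneg_pos[of "e * s" "e * 2"] by (simp add: field_simps)
      finally show ?thesis .
    qed
    define G where "G = (\<lambda>t. (1 / of_real h) * ((\<i> * of_real t) ^ k * exp (\<i> * (l + of_real h) * of_real t) + (-1) * ((\<i> * of_real t) ^ k * exp (\<i> * l * of_real t))))"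
    have "pw_ext a F G ((1 / of_real h) * ((deriv ^^ k) F (l + of_real h) + (-1) * (deriv ^^ k) F l))"
      unfolding G_def by (intro pw_ext_cmult pw_ext_add Suc.IH)
    then have G: "pw_ext a F G ((Fk (l + of_real h) - Fk l) / of_real h)" by (simp add: Fk_def)
    have "l2norm (-a) a (\<lambda>t. (\<i> * of_real t) ^ Suc k * exp (\<i> * l * of_real t) - G t) \<le> sqrt (a - (-a)) * (h * M)"
    proof (rule l2norm_le_sup)
      show "sq_int (-a) a (\<lambda>t. (\<i> * of_real t) ^ Suc k * exp (\<i> * l * of_real t) - G t)"
        unfolding G_def by (intro sq_int_continuous continuous_intros)
      fix t assume t: "t \<in> {-a..a}"
      have ex: "exp (\<i> * (l + of_real h) * of_real t) = exp (\<i> * l * of_real t) * exp (\<i> * of_real h * of_real t)"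
        by (simp add: exp_add[symmetric] algebra_simps)
      have "(\<i> * of_real t) ^ Suc k * exp (\<i> * l * of_real t) - G t =
         - ((\<i> * of_real t) ^ k * exp (\<i> * l * of_real t) * ((exp (\<i> * of_real h * of_real t) - 1) / of_real h - \<i> * of_real t))"
        unfolding G_def ex using h by (simp add: field_simps)
      then have "cmod ((\<i> * of_real t) ^ Suc k * exp (\<i> * l * of_real t) - G t) =
         \<bar>t\<bar> ^ k * cmod (exp (\<i> * l * of_real t)) * cmod ((exp (\<i> * of_real h * of_real t) - 1) / of_real h - \<i> * of_real t)"
        by (simp add: norm_mult norm_power)
      also have "\<dots> \<le> a ^ k * exp (cmod l * a) * (h * a\<^sup>2)"
      proof (intro mult_mono power_mono)
        have "cmod (exp (\<i> * l * of_real t)) \<le> exp (cmod (\<i> * l * of_real t))" by (rule norm_exp)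
        also have "\<dots> \<le> exp (cmod l * a)" using t by (auto simp: norm_mult intro!: mult_left_mono)
        finally show "cmod (exp (\<i> * l * of_real t)) \<le> exp (cmod l * a)" .
        have "t\<^sup>2 \<le> a\<^sup>2" using t a by (intro abs_le_square_iff[THEN iffD1]) auto
        then have "h * t\<^sup>2 \<le> h * a\<^sup>2" using h by (intro mult_left_mono) auto
        then show "cmod ((exp (\<i> * of_real h * of_real t) - 1) / of_real h - \<i> * of_real t) \<le> h * a\<^sup>2"
          using norm_exp_diff_quotient_le[OF h(1), of t] by linarith
      qed (use t a in auto)
      finally show "cmod ((\<i> * of_real t) ^ Suc k * exp (\<i> * l * of_real t) - G t) \<le> h * M"
        by (simp add: M_def mult_ac)
    qed (use a h M in auto)
    also have "\<dots> = h * s" by (simp add: s_def)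
    finally have "l2norm (-a) a (\<lambda>t. (\<i> * of_real t) ^ Suc k * exp (\<i> * l * of_real t) - G t) < e" using hs by linarith
    moreover have "cmod ((Fk (l + of_real h) - Fk l) / of_real h - (deriv ^^ Suc k) F l) < e"
      using d(2)[of "of_real h"] h by (simp add: Fk_def)
    ultimately show "\<exists>h v. pw_ext a F h v \<and> l2norm (-a) a (\<lambda>t. (\<i> * of_real t) ^ Suc k * exp (\<i> * l * of_real t) - h t) < e
        \<and> cmod (v - (deriv ^^ Suc k) F l) < e" using G by blast
  qed
qed

lemma higher_deriv_exp_it: "(deriv ^^ k) (\<lambda>w. exp (\<i> * w * of_real t)) = (\<lambda>w. (\<i> * of_real t) ^ k * exp (\<i> * w * of_real t))"
proof (induction k)
  case (Suc k)
  have "deriv (\<lambda>w. (\<i> * of_real t) ^ k * exp (\<i> * w * of_real t)) w = (\<i> * of_real t) ^ Suc k * exp (\<i> * w * of_real t)" for w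
    by (rule DERIV_imp_deriv) (auto intro!: derivative_eq_intros)
  then show ?case using Suc by auto
qed simp

text \<open>Leibniz' rule expands both Taylor coefficients with the same weights. With
  \<open>h w = w * f1 w\<close> or \<open>h = f2\<close> the function of \<open>t\<close> is a
  component of an entry of \<open>v_seq\<close>.\<close>

lemma pw_ext_higher_deriv:
  assumes F: "F holomorphic_on UNIV" and h: "h holomorphic_on UNIV" and a: "a \<ge> 0"
  shows "pw_ext a F (\<lambda>t. taylor_coeff (\<lambda>w. h w * exp (\<i> * w * of_real t)) k l) (taylor_coeff (\<lambda>w. h w * F w) k l)"
proof -
  have e: "(deriv ^^ k) (\<lambda>w. h w * exp (\<i> * w * of_real t)) l =
      (\<Sum>i = 0..k. of_nat (k choose i) * (deriv ^^ i) h l * ((\<i> * of_real t) ^ (k - i) * exp (\<i> * l * of_real t)))" for t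
    using higher_deriv_mult[OF h _ open_UNIV UNIV_I, of "\<lambda>w. exp (\<i> * w * of_real t)" k l]
    by (simp add: higher_deriv_exp_it holomorphic_intros)
  have f: "(deriv ^^ k) (\<lambda>w. h w * F w) l = (\<Sum>i = 0..k. of_nat (k choose i) * (deriv ^^ i) h l * (deriv ^^ (k - i)) F l)"
    by (rule higher_deriv_mult[OF h F open_UNIV UNIV_I])
  have "pw_ext a F (\<lambda>t. (1 / fact k) * (\<Sum>i = 0..k. of_nat (k choose i) * (deriv ^^ i) h l * ((\<i> * of_real t) ^ (k - i) * exp (\<i> * l * of_real t))))
     ((1 / fact k) * (\<Sum>i = 0..k. of_nat (k choose i) * (deriv ^^ i) h l * (deriv ^^ (k - i)) F l))"
    by (intro pw_ext_cmult pw_ext_sum pw_ext_deriv_exp F a)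
  then show ?thesis unfolding taylor_coeff_def e f by simp
qed

section \<open>Consequences of completeness in the direct sum\<close>

lemma in_H_iff: "in_H g \<longleftrightarrow> sq_int (-pi) pi (\<lambda>t. fst (g t)) \<and> sq_int (-pi) pi (\<lambda>t. snd (g t))"
  unfolding in_H_def using L2_on_imp_sq_int sq_int_imp_L2_on by blast

lemma norm_H_ge:
  assumes "in_H g"
  shows "l2norm (-pi) pi (\<lambda>t. fst (g t)) \<le> norm_H g" "l2norm (-pi) pi (\<lambda>t. snd (g t)) \<le> norm_H g"
proof -
  define A where "A = integral {-pi..pi} (\<lambda>t. (cmod (fst (g t)))\<^sup>2)"
  define B where "B = integral {-pi..pi} (\<lambda>t. (cmod (snd (g t)))\<^sup>2)"
  have i: "integrable (lebesgue_on {-pi<..<pi}) (\<lambda>x. (cmod (fst (g x)))\<^sup>2)" "integrable (lebesgue_on {-pi<..<pi}) (\<lambda>x. (cmod (snd (g x)))\<^sup>2)"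
    using assms by (auto simp: in_H_def L2_on_def)
  have "inner_H g g = (LINT t|lebesgue_on {-pi<..<pi}. complex_of_real ((cmod (fst (g t)))\<^sup>2 + (cmod (snd (g t)))\<^sup>2))"
  proof -
    have "cnj (fst (g t)) * fst (g t) + cnj (snd (g t)) * snd (g t) = complex_of_real ((cmod (fst (g t)))\<^sup>2 + (cmod (snd (g t)))\<^sup>2)" for t
      by (simp only: of_real_add complex_norm_square mult.commute)
    then show ?thesis by (simp only: inner_H_def)
  qed
  also have "\<dots> = complex_of_real (LINT t|lebesgue_on {-pi<..<pi}. (cmod (fst (g t)))\<^sup>2 + (cmod (snd (g t)))\<^sup>2)"
    by (rule integral_complex_of_real)
  also have "(LINT t|lebesgue_on {-pi<..<pi}. (cmod (fst (g t)))\<^sup>2 + (cmod (snd (g t)))\<^sup>2) =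
     (LINT t|lebesgue_on {-pi<..<pi}. (cmod (fst (g t)))\<^sup>2) + (LINT t|lebesgue_on {-pi<..<pi}. (cmod (snd (g t)))\<^sup>2)"
    by (rule Bochner_Integration.integral_add[OF i])
  also have "\<dots> = A + B"
    using lebesgue_integral_eq_integral[OF i(1)] lebesgue_integral_eq_integral[OF i(2)]
    by (simp add: A_def B_def integral_open_interval_real)
  finally have "norm_H g = sqrt (A + B)" by (simp add: norm_H_def)
  moreover have "A \<ge> 0" "B \<ge> 0" unfolding A_def B_def
    using l2norm_power2[of "-pi" pi] zero_le_power2 by metis+
  ultimately show "l2norm (-pi) pi (\<lambda>t. fst (g t)) \<le> norm_H g" "l2norm (-pi) pi (\<lambda>t. snd (g t)) \<le> norm_H g"
    by (auto simp: l2norm_def A_def B_def)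
qed

lemma complete_in_H_approx:
  assumes v: "complete_in_H v" and g: "sq_int (-pi) pi g1" "sq_int (-pi) pi g2" and e: "e > 0"
  obtains c N where "l2norm (-pi) pi (\<lambda>t. g1 t - (\<Sum>k<N. c k * fst (v k t))) < e"
    "l2norm (-pi) pi (\<lambda>t. g2 t - (\<Sum>k<N. c k * snd (v k t))) < e"
proof -
  have vk: "sq_int (-pi) pi (\<lambda>t. fst (v k t))" "sq_int (-pi) pi (\<lambda>t. snd (v k t))" for k
    using v by (auto simp: complete_in_H_def in_H_iff)
  have "in_H (\<lambda>t. (g1 t, g2 t))" using g by (simp add: in_H_iff)
  then obtain c N where cN: "norm_H (\<lambda>t. (g1 t, g2 t) - lin_comb c N v t) < e"
    using v e unfolding complete_in_H_def by meson
  have "in_H (\<lambda>t. (g1 t, g2 t) - lin_comb c N v t)"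
    unfolding in_H_iff lin_comb_def fst_diff snd_diff fst_conv snd_conv
    by (intro conjI sq_int_diff g sq_int_sum sq_int_cmult vk)
  from norm_H_ge[OF this] cN show ?thesis
    by (intro that[of c N]) (simp_all add: lin_comb_def)
qed

text \<open>With \<open>F = 0\<close> the relation \<open>pw_ext\<close> says just that a function
  is an L2 limit of exponential sums. The first components of \<open>v_seq\<close> are such limits,
  and completeness is applied to the pair \<open>(g, 0)\<close>.\<close>

lemma exp_dense:
  assumes "f1 holomorphic_on UNIV" "f2 holomorphic_on UNIV" and v: "complete_in_H (v_seq f1 f2 lam)"
    and g: "sq_int (-pi) pi g" and e: "e > 0"
  shows "\<exists>n c l. l2norm (-pi) pi (\<lambda>t. g t - esum n c l t) < e"
proof -
  have ext: "pw_ext pi (\<lambda>_. 0) (\<lambda>t. fst (v_seq f1 f2 lam k t)) 0" for k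
  proof (cases "k = 0")
    case True
    then show ?thesis by (simp add: v_seq_def pw_ext_zero)
  next
    case False
    define n where "n = (LEAST n. lam n = lam k)"
    have "(\<lambda>w. w * f1 w) holomorphic_on UNIV" using assms by (intro holomorphic_intros)
    from pw_ext_higher_deriv[OF holomorphic_on_const[of 0] this pi_ge_zero, of "k - n" "lam n"]
    show ?thesis using False by (simp add: v_seq_def v_coeff_def v_fun_def n_def Let_def taylor_coeff_def)
  qed
  have e2: "e / 2 > 0" using e by simp
  obtain c N where cN: "l2norm (-pi) pi (\<lambda>t. g t - (\<Sum>k<N. c k * fst (v_seq f1 f2 lam k t))) < e / 2"
    using complete_in_H_approx[OF v g sq_int_zero(1) e2] by blast
  have "pw_ext pi (\<lambda>_. 0) (\<lambda>t. \<Sum>k<N. c k * fst (v_seq f1 f2 lam k t)) (\<Sum>k<N. c k * 0)"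
    by (intro pw_ext_sum pw_ext_cmult ext)
  then obtain n d l where h: "sq_int (-pi) pi (\<lambda>t. \<Sum>k<N. c k * fst (v_seq f1 f2 lam k t))"
    "l2norm (-pi) pi (\<lambda>t. (\<Sum>k<N. c k * fst (v_seq f1 f2 lam k t)) - esum n d l t) < e / 2"
    using e2 unfolding pw_ext_def by blast
  have "l2norm (-pi) pi (\<lambda>t. g t - esum n d l t) \<le> l2norm (-pi) pi (\<lambda>t. g t - (\<Sum>k<N. c k * fst (v_seq f1 f2 lam k t)))
     + l2norm (-pi) pi (\<lambda>t. (\<Sum>k<N. c k * fst (v_seq f1 f2 lam k t)) - esum n d l t)"
    using l2norm_triangle[OF sq_int_diff[OF g h(1)] sq_int_diff[OF h(1) sq_int_esum[of _ _ n d l]]] by simp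
  then show ?thesis using cN h by (intro exI[of _ n] exI[of _ d] exI[of _ l]) linarith
qed

text \<open>The functional \<open>(g1, g2) \<mapsto> D1[g1] + D2[g2]\<close> is bounded on finite sums of exponentials and
  annihilates every \<open>v\<^sub>k\<close>.\<close>

theorem complete_imp_zero:
  assumes f: "f1 holomorphic_on UNIV" "f2 holomorphic_on UNIV" and v: "complete_in_H (v_seq f1 f2 lam)"
    and D: "D1 holomorphic_on UNIV" "D2 holomorphic_on UNIV" and pw: "pw pi C D1" "pw pi C D2" "C \<ge> 0"
    and zero: "\<And>k. k \<ge> 1 \<Longrightarrow> (deriv ^^ (k - (LEAST n. lam n = lam k))) (\<lambda>w. (w * f1 w) * D1 w + f2 w * D2 w) (lam k) = 0"
    and D20: "D2 0 = 0"
  shows "D1 \<mu> = 0" "D2 \<mu> = 0"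
proof -
  define v' where "v' = v_seq f1 f2 lam"
  have wf: "(\<lambda>w. w * f1 w) holomorphic_on UNIV" using f by (intro holomorphic_intros)
  have "\<exists>A B. pw_ext pi D1 (\<lambda>t. fst (v' k t)) A \<and> pw_ext pi D2 (\<lambda>t. snd (v' k t)) B \<and> A + B = 0" for k
  proof (cases "k = 0")
    case True
    \<comment> \<open>The vector \<open>[0, 1]\<close> is the exponential of frequency
      \<open>0\<close> in the second component, where the functional takes the value
      \<open>D2 0 = 0\<close>.\<close>
    have "pw_ext pi D2 (\<lambda>t. 1) 0" using pw_ext_exp[of pi D2 0] D20 by simp
    then show ?thesis using True by (intro exI[of _ 0]) (simp add: v'_def v_seq_def pw_ext_zero)
  next
    case False
    define n where "n = (LEAST n. lam n = lam k)"
    have ln: "lam n = lam k" unfolding n_def by (rule LeastI) simp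
    define A where "A = taylor_coeff (\<lambda>w. (w * f1 w) * D1 w) (k - n) (lam n)"
    define B where "B = taylor_coeff (\<lambda>w. f2 w * D2 w) (k - n) (lam n)"
    have "pw_ext pi D1 (\<lambda>t. fst (v' k t)) A"
      using pw_ext_higher_deriv[OF D(1) wf pi_ge_zero, of "k - n" "lam n"] False
      by (simp add: v'_def v_seq_def v_coeff_def v_fun_def n_def Let_def A_def)
    moreover have "pw_ext pi D2 (\<lambda>t. snd (v' k t)) B"
      using pw_ext_higher_deriv[OF D(2) f(2) pi_ge_zero, of "k - n" "lam n"] False
      by (simp add: v'_def v_seq_def v_coeff_def v_fun_def n_def Let_def B_def)
    moreover have "A + B = 0"
    proof -
      have "(deriv ^^ (k - n)) (\<lambda>w. (w * f1 w) * D1 w + f2 w * D2 w) (lam n)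
         = (deriv ^^ (k - n)) (\<lambda>w. (w * f1 w) * D1 w) (lam n) + (deriv ^^ (k - n)) (\<lambda>w. f2 w * D2 w) (lam n)"
        by (rule higher_deriv_add[of _ UNIV]) (use wf f D in \<open>auto intro!: holomorphic_intros\<close>)
      then show ?thesis using zero[of k] False by (simp add: A_def B_def taylor_coeff_def n_def[symmetric] ln add_divide_distrib[symmetric])
    qed
    ultimately show ?thesis by blast
  qed
  then obtain A B where AB: "\<And>k. pw_ext pi D1 (\<lambda>t. fst (v' k t)) (A k)" "\<And>k. pw_ext pi D2 (\<lambda>t. snd (v' k t)) (B k)"
      "\<And>k. A k + B k = 0" by metis
  \<comment> \<open>The pair is approximated by combinations of the \<open>v' k\<close>, on which
    the two values cancel; each component contributes an error of at most
    \<open>C * d\<close>.\<close>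
  have key: "cmod (w1 + w2) \<le> e" if g: "pw_ext pi D1 g1 w1" "pw_ext pi D2 g2 w2" and e: "e > 0" for g1 g2 w1 w2 e
  proof -
    define d where "d = e / (2 * C + 1)"
    have d: "d > 0" "2 * C * d \<le> e" using e pw by (auto simp: d_def field_simps)
    obtain c N where cN: "l2norm (-pi) pi (\<lambda>t. g1 t - (\<Sum>k<N. c k * fst (v' k t))) < d"
      "l2norm (-pi) pi (\<lambda>t. g2 t - (\<Sum>k<N. c k * snd (v' k t))) < d"
      using complete_in_H_approx[OF v _ _ d(1), of g1 g2] g unfolding v'_def pw_ext_def by blast
    have "pw_ext pi D1 (\<lambda>t. g1 t + (-1) * (\<Sum>k<N. c k * fst (v' k t))) (w1 + (-1) * (\<Sum>k<N. c k * A k))"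
      by (intro pw_ext_add pw_ext_cmult pw_ext_sum g AB)
    from pw_ext_bound[OF pw(1,3) this] have 1: "cmod (w1 - (\<Sum>k<N. c k * A k)) \<le> C * d"
      using cN(1) pw(3) mult_left_mono[OF less_imp_le[OF cN(1)] pw(3)] by simp
    have "pw_ext pi D2 (\<lambda>t. g2 t + (-1) * (\<Sum>k<N. c k * snd (v' k t))) (w2 + (-1) * (\<Sum>k<N. c k * B k))"
      by (intro pw_ext_add pw_ext_cmult pw_ext_sum g AB)
    from pw_ext_bound[OF pw(2,3) this] have 2: "cmod (w2 - (\<Sum>k<N. c k * B k)) \<le> C * d"
      using mult_left_mono[OF less_imp_le[OF cN(2)] pw(3)] by simp
    have "(\<Sum>k<N. c k * A k) + (\<Sum>k<N. c k * B k) = 0"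
      by (simp add: sum.distrib[symmetric] distrib_left[symmetric] AB(3))
    then have eq: "w1 + w2 = (w1 - (\<Sum>k<N. c k * A k)) + (w2 - (\<Sum>k<N. c k * B k))" by (simp add: algebra_simps)
    have "cmod (w1 + w2) \<le> C * d + C * d"
      unfolding eq by (rule order_trans[OF norm_triangle_ineq add_mono[OF 1 2]])
    then show ?thesis using d by simp
  qed
  \<comment> \<open>The pair \<open>(exp (i \<mu> t), 0)\<close> isolates
    \<open>D1 \<mu>\<close>.\<close>
  have "cmod (D1 \<mu> + 0) \<le> 0 + e" if "e > 0" for e
    using key[OF pw_ext_exp pw_ext_zero that] by simp
  then have "cmod (D1 \<mu> + 0) \<le> 0" by (rule field_le_epsilon)
  then show "D1 \<mu> = 0" by simp
  have "cmod (0 + D2 \<mu>) \<le> 0 + e" if "e > 0" for e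
    using key[OF pw_ext_zero pw_ext_exp that] by simp
  then have "cmod (0 + D2 \<mu>) \<le> 0" by (rule field_le_epsilon)
  then show "D2 \<mu> = 0" by simp
qed

section \<open>A uniqueness principle of Volterra type\<close>

lemma sq_int_reflect:
  assumes "sq_int a b f"
  shows "sq_int (-b) (-a) (\<lambda>x. f (-x))" "l2norm (-b) (-a) (\<lambda>x. f (-x)) = l2norm a b f"
proof -
  have "(\<lambda>x. f (-x)) absolutely_integrable_on {-b..-a}"
    using sq_int_abs_int[OF assms] by (simp add: absolutely_integrable_on_def
      Henstock_Kurzweil_Integration.integrable_reflect_real Henstock_Kurzweil_Integration.integrable_reflect_real[of "\<lambda>x. cmod (f x)"])
  then have "(\<lambda>x. f (-x)) \<in> borel_measurable (lebesgue_on {-b..-a})"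
    by (rule absolutely_integrable_imp_borel_measurable) simp
  then show "sq_int (-b) (-a) (\<lambda>x. f (-x))"
    using assms Henstock_Kurzweil_Integration.integrable_reflect_real[of "\<lambda>x. (cmod (f x))\<^sup>2" b a] by (simp add: sq_int_def)
  show "l2norm (-b) (-a) (\<lambda>x. f (-x)) = l2norm a b f"
    using Henstock_Kurzweil_Integration.integral_reflect_real[of b a "\<lambda>x. (cmod (f x))\<^sup>2"] by (simp add: l2norm_def)
qed

lemma sq_int_restrict:
  assumes f: "sq_int c d f" and sub: "{c..d} \<subseteq> {a..b}"
  shows "sq_int a b (\<lambda>x. if x \<in> {c..d} then f x else 0)"
    "l2norm a b (\<lambda>x. if x \<in> {c..d} then f x else 0) = l2norm c d f"
proof -
  have m: "(\<lambda>x. if x \<in> {c..d} then f x else 0) \<in> borel_measurable (lebesgue_on {a..b})"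
  proof -
    have "f \<in> borel_measurable (lebesgue_on {c..d})" using f by (simp add: sq_int_def)
    then have "(\<lambda>x. if x \<in> {c..d} then f x else 0) \<in> borel_measurable lebesgue"
      by (subst borel_measurable_if) auto
    then show ?thesis by (rule measurable_restrict_space1)
  qed
  have e: "(\<lambda>x. (cmod (if x \<in> {c..d} then f x else 0))\<^sup>2) = (\<lambda>x. if x \<in> {c..d} then (cmod (f x))\<^sup>2 else 0)" by auto
  have i: "((\<lambda>x. (cmod (f x))\<^sup>2) has_integral integral {c..d} (\<lambda>x. (cmod (f x))\<^sup>2)) {c..d}"
    using f by (simp add: sq_int_def integrable_integral)
  then have i': "((\<lambda>x. if x \<in> {c..d} then (cmod (f x))\<^sup>2 else 0) has_integral integral {c..d} (\<lambda>x. (cmod (f x))\<^sup>2)) {a..b}"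
    by (simp only: has_integral_restrict[OF sub])
  then show "sq_int a b (\<lambda>x. if x \<in> {c..d} then f x else 0)"
    unfolding sq_int_def e using m by (blast intro: has_integral_integrable)
  show "l2norm a b (\<lambda>x. if x \<in> {c..d} then f x else 0) = l2norm c d f"
    unfolding l2norm_def e using i' by (simp only: integral_unique)
qed

text \<open>The test function is the complex conjugate of \<open>(hp, hm)\<close> restricted to \<open>a \<le> \<bar>x\<bar>\<close>. If \<open>hp\<close> and
  \<open>hm\<close> vanish beyond \<open>b\<close> and \<open>b - a\<close> is small, then the right-hand side of the hypothesis is too small
  to match the left-hand side; so the vanishing propagates to \<open>a\<close> in steps of uniform length.\<close>

theorem volterra_uniqueness:
  fixes hp hm \<rho> :: "real \<Rightarrow> complex" and L :: real
  defines "\<kappa> \<equiv> \<lambda>x. L * ((cmod (hp x) + cmod (hm x)) * cmod (\<rho> x))"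
  assumes h: "sq_int 0 pi hp" "sq_int 0 pi hm" and \<rho>: "sq_int 0 pi \<rho>" and L: "L \<ge> 0"
    and dense: "\<And>g e. sq_int (-pi) pi g \<Longrightarrow> e > 0 \<Longrightarrow> \<exists>n c l. l2norm (-pi) pi (\<lambda>t. g t - esum n c l t) < e"
    and ineq: "\<And>a n c l. a \<in> {0..pi} \<Longrightarrow>
      cmod (integral {0..pi} (\<lambda>x. hp x * esum n c l x + hm x * esum n c l (-x))) \<le>
        l2norm (-a) a (esum n c l) * integral {0..a} \<kappa> + l2norm (-pi) pi (esum n c l) * integral {a..pi} \<kappa>"
  shows "l2norm 0 pi hp = 0" "l2norm 0 pi hm = 0"
proof -
  have hsub: "sq_int a b hp" "sq_int a b hm" "sq_int a b \<rho>" if "0 \<le> a" "b \<le> pi" for a b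
    using sq_int_subinterval(1)[OF h(1) that] sq_int_subinterval(1)[OF h(2) that] sq_int_subinterval(1)[OF \<rho> that] by auto
  have \<kappa>int: "\<kappa> integrable_on {a..b}" and \<kappa>le: "integral {a..b} \<kappa> \<le> L * ((l2norm a b hp + l2norm a b hm) * l2norm a b \<rho>)"
    and \<kappa>0: "integral {a..b} \<kappa> \<ge> 0"
    if ab: "0 \<le> a" "b \<le> pi" for a b
  proof -
    have e: "\<kappa> = (\<lambda>x. L * (cmod (hp x) * cmod (\<rho> x) + cmod (hm x) * cmod (\<rho> x)))"
      by (simp add: \<kappa>_def distrib_right)
    have i: "((\<lambda>x. L * (cmod (hp x) * cmod (\<rho> x) + cmod (hm x) * cmod (\<rho> x))) has_integral
       L * (integral {a..b} (\<lambda>x. cmod (hp x) * cmod (\<rho> x)) + integral {a..b} (\<lambda>x. cmod (hm x) * cmod (\<rho> x)))) {a..b}"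
      by (intro has_integral_mult_right has_integral_add integrable_integral sq_int_norm_mult(2) hsub ab)
    then show i': "\<kappa> integrable_on {a..b}" unfolding e by (rule has_integral_integrable)
    have "integral {a..b} \<kappa> = L * (integral {a..b} (\<lambda>x. cmod (hp x) * cmod (\<rho> x)) + integral {a..b} (\<lambda>x. cmod (hm x) * cmod (\<rho> x)))"
      unfolding e using i by (rule integral_unique)
    also have "\<dots> \<le> L * (l2norm a b hp * l2norm a b \<rho> + l2norm a b hm * l2norm a b \<rho>)"
      by (intro mult_left_mono add_mono cauchy_schwarz_integral hsub ab L)
    finally show "integral {a..b} \<kappa> \<le> L * ((l2norm a b hp + l2norm a b hm) * l2norm a b \<rho>)" by (simp add: distrib_right)
    show "integral {a..b} \<kappa> \<ge> 0" by (rule Henstock_Kurzweil_Integration.integral_nonneg[OF i']) (simp add: \<kappa>_def L)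
  qed
  \<comment> \<open>By density the hypothesis extends from exponential sums to every
    \<open>\<psi>\<close>. If \<open>\<psi>\<close> vanishes on \<open>[-a, a]\<close>, the term
    with the integral of \<open>\<kappa>\<close> over \<open>[0, a]\<close> disappears.\<close>
  have ineq': "cmod (integral {0..pi} (\<lambda>x. hp x * \<psi> x + hm x * \<psi> (-x))) \<le> l2norm (-pi) pi \<psi> * integral {a..pi} \<kappa>"
    if a: "a \<in> {0..pi}" and \<psi>: "sq_int (-pi) pi \<psi>" "l2norm (-a) a \<psi> = 0" for a \<psi>
  proof (rule field_le_epsilon)
    fix e :: real assume e: "e > 0"
    \<comment> \<open>Collects the factors of \<open>d\<close>: two from replacing
      \<open>\<psi>\<close> in the integral, two from replacing its norms on the right-hand
      side.\<close>
    define B where "B = l2norm 0 pi hp + l2norm 0 pi hm + integral {0..a} \<kappa> + integral {a..pi} \<kappa>"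
    have B: "B \<ge> 0" unfolding B_def using a by (intro add_nonneg_nonneg l2norm_nonneg \<kappa>0) auto
    define d where "d = e / (B + 1)"
    have d: "d > 0" "B * d \<le> e" using e B by (auto simp: d_def field_simps)
    obtain n c l where nl: "l2norm (-pi) pi (\<lambda>t. \<psi> t - esum n c l t) < d" using dense[OF \<psi>(1) d(1)] by blast
    define \<phi> where "\<phi> = esum n c l"
    have \<phi>: "sq_int x y \<phi>" for x y unfolding \<phi>_def by (rule sq_int_esum)
    have df: "sq_int (-pi) pi (\<lambda>t. \<psi> t - \<phi> t)" "l2norm (-pi) pi (\<lambda>t. \<psi> t - \<phi> t) < d"
      using nl \<psi> \<phi> by (auto simp: \<phi>_def intro: sq_int_diff)
    have r: "sq_int 0 pi f \<and> sq_int 0 pi (\<lambda>x. f (-x)) \<and> l2norm 0 pi f \<le> l2norm (-pi) pi f \<and> l2norm 0 pi (\<lambda>x. f (-x)) \<le> l2norm (-pi) pi f"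
      if "sq_int (-pi) pi f" for f
      using sq_int_subinterval[OF that, of 0 pi] sq_int_subinterval[OF that, of "-pi" 0] sq_int_reflect[of "-pi" 0 f] by auto
    have hd: "l2norm 0 pi (\<lambda>x. \<psi> x - \<phi> x) \<le> d" "l2norm 0 pi (\<lambda>x. \<psi> (-x) - \<phi> (-x)) \<le> d"
      "sq_int 0 pi (\<lambda>x. \<psi> x - \<phi> x)" "sq_int 0 pi (\<lambda>x. \<psi> (-x) - \<phi> (-x))"
      using r[OF df(1)] df(2) by linarith+
    have i: "(\<lambda>x. u x * v x) integrable_on {0..pi}" if "sq_int 0 pi u" "sq_int 0 pi v" for u v
      using sq_int_norm_mult(1)[OF that] by (simp add: absolutely_integrable_on_def)
    have fi: "(\<lambda>x. hp x * f x + hm x * f (-x)) integrable_on {0..pi}" if "sq_int (-pi) pi f" for f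
      using r[OF that] h by (intro integrable_add i) auto
    have "integral {0..pi} (\<lambda>x. hp x * \<psi> x + hm x * \<psi> (-x)) =
       integral {0..pi} (\<lambda>x. (hp x * \<phi> x + hm x * \<phi> (-x)) + (hp x * (\<psi> x - \<phi> x) + hm x * (\<psi> (-x) - \<phi> (-x))))"
      by (simp add: algebra_simps)
    also have "\<dots> = integral {0..pi} (\<lambda>x. hp x * \<phi> x + hm x * \<phi> (-x)) + integral {0..pi} (\<lambda>x. hp x * (\<psi> x - \<phi> x) + hm x * (\<psi> (-x) - \<phi> (-x)))"
      by (rule Henstock_Kurzweil_Integration.integral_add[OF fi[OF \<phi>] fi[OF df(1)]])
    also have "integral {0..pi} (\<lambda>x. hp x * (\<psi> x - \<phi> x) + hm x * (\<psi> (-x) - \<phi> (-x))) =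
       integral {0..pi} (\<lambda>x. hp x * (\<psi> x - \<phi> x)) + integral {0..pi} (\<lambda>x. hm x * (\<psi> (-x) - \<phi> (-x)))"
      using r[OF df(1)] h by (intro Henstock_Kurzweil_Integration.integral_add i) auto
    finally have "cmod (integral {0..pi} (\<lambda>x. hp x * \<psi> x + hm x * \<psi> (-x))) \<le>
       cmod (integral {0..pi} (\<lambda>x. hp x * \<phi> x + hm x * \<phi> (-x))) +
       (cmod (integral {0..pi} (\<lambda>x. hp x * (\<psi> x - \<phi> x))) + cmod (integral {0..pi} (\<lambda>x. hm x * (\<psi> (-x) - \<phi> (-x)))))"
      by (simp only:) (rule order_trans[OF norm_triangle_ineq add_left_mono[OF norm_triangle_ineq]])
    also have "cmod (integral {0..pi} (\<lambda>x. hp x * (\<psi> x - \<phi> x))) \<le> l2norm 0 pi hp * d"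
      by (rule order_trans[OF cauchy_schwarz_cmod[OF h(1) hd(3)] mult_left_mono[OF hd(1) l2norm_nonneg]])
    also have "cmod (integral {0..pi} (\<lambda>x. hm x * (\<psi> (-x) - \<phi> (-x)))) \<le> l2norm 0 pi hm * d"
      by (rule order_trans[OF cauchy_schwarz_cmod[OF h(2) hd(4)] mult_left_mono[OF hd(2) l2norm_nonneg]])
    also have "cmod (integral {0..pi} (\<lambda>x. hp x * \<phi> x + hm x * \<phi> (-x))) \<le>
        l2norm (-a) a \<phi> * integral {0..a} \<kappa> + l2norm (-pi) pi \<phi> * integral {a..pi} \<kappa>"
      unfolding \<phi>_def by (rule ineq[OF a])
    also have "\<dots> \<le> d * integral {0..a} \<kappa> + (l2norm (-pi) pi \<psi> + d) * integral {a..pi} \<kappa>"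
    proof (intro add_mono mult_right_mono)
      have \<phi>tri: "l2norm (-y) y \<phi> \<le> l2norm (-y) y \<psi> + d" if y: "y \<in> {0..pi}" for y
      proof -
        have s: "sq_int (-y) y \<psi>" using sq_int_subinterval(1)[OF \<psi>(1), of "-y" y] y by auto
        have "l2norm (-y) y \<phi> \<le> l2norm (-y) y \<psi> + l2norm (-y) y (\<lambda>t. \<phi> t - \<psi> t)"
          using l2norm_triangle[OF s sq_int_diff[OF \<phi> s]] by simp
        also have "l2norm (-y) y (\<lambda>t. \<phi> t - \<psi> t) \<le> l2norm (-pi) pi (\<lambda>t. \<psi> t - \<phi> t)"
          using sq_int_subinterval(2)[OF df(1), of "-y" y] y l2norm_minus_commute[of "-y" y \<phi> \<psi>] by auto
        finally show ?thesis using df(2) by linarith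
      qed
      show "l2norm (-a) a \<phi> \<le> d" using \<phi>tri[OF a] \<psi>(2) by simp
      show "l2norm (-pi) pi \<phi> \<le> l2norm (-pi) pi \<psi> + d" using \<phi>tri[of pi] by simp
    qed (use a \<kappa>0 in auto)
    finally have "cmod (integral {0..pi} (\<lambda>x. hp x * \<psi> x + hm x * \<psi> (-x))) \<le> l2norm (-pi) pi \<psi> * integral {a..pi} \<kappa> + B * d"
      by (simp add: B_def algebra_simps)
    then show "cmod (integral {0..pi} (\<lambda>x. hp x * \<psi> x + hm x * \<psi> (-x))) \<le> l2norm (-pi) pi \<psi> * integral {a..pi} \<kappa> + e"
      using d by linarith
  qed
  define H where "H = (\<lambda>a. sqrt ((l2norm a pi hp)\<^sup>2 + (l2norm a pi hm)\<^sup>2))"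
  have H0: "H a \<ge> 0" for a by (simp add: H_def)
  have Hle: "l2norm a pi hp \<le> H a" "l2norm a pi hm \<le> H a" for a
    unfolding H_def by (auto intro!: real_le_rsqrt)
  have step1: "H a \<le> integral {a..pi} \<kappa>" if a: "a \<in> {0..pi}" for a
  proof -
    define \<psi> where "\<psi> = (\<lambda>x. (if x \<in> {a..pi} then cnj (hp x) else 0) + (if x \<in> {-pi..-a} then cnj (hm (-x)) else 0))"
    have cs: "sq_int x y (\<lambda>x. cnj (f x))" "l2norm x y (\<lambda>x. cnj (f x)) = l2norm x y f" if "sq_int x y f" for x y f
    proof -
      have "(\<lambda>x. cnj (f x)) \<in> borel_measurable (lebesgue_on {x..y})"
        using that borel_measurable_continuous_onI[of cnj] continuous_on_cnj[OF continuous_on_id]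
        by (auto simp: sq_int_def intro: measurable_compose[of f])
      then show "sq_int x y (\<lambda>x. cnj (f x))" by (rule sq_int_bound(1)[OF that]) simp
      show "l2norm x y (\<lambda>x. cnj (f x)) = l2norm x y f" by (simp add: l2norm_def)
    qed
    define \<psi>1 where "\<psi>1 = (\<lambda>x. if x \<in> {a..pi} then cnj (hp x) else 0)"
    define \<psi>2 where "\<psi>2 = (\<lambda>x. if x \<in> {-pi..-a} then cnj (hm (-x)) else 0)"
    have \<psi>: "\<psi> = (\<lambda>x. \<psi>1 x + \<psi>2 x)" by (simp add: \<psi>_def \<psi>1_def \<psi>2_def)
    have ha: "sq_int a pi hp" "sq_int a pi hm" using hsub a by auto
    have 1: "sq_int (-pi) pi \<psi>1" "l2norm (-pi) pi \<psi>1 = l2norm a pi hp"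
      using sq_int_restrict[OF cs(1)[OF ha(1)], of "-pi" pi] cs(2)[OF ha(1)] a by (auto simp: \<psi>1_def)
    have 2: "sq_int (-pi) pi \<psi>2" "l2norm (-pi) pi \<psi>2 = l2norm a pi hm"
      using sq_int_restrict[OF sq_int_reflect(1)[OF cs(1)[OF ha(2)]], of "-pi" pi] sq_int_reflect(2)[OF cs(1)[OF ha(2)]] cs(2)[OF ha(2)] a
      by (auto simp: \<psi>2_def)
    have "l2norm (-pi) pi \<psi> = H a"
    proof -
      \<comment> \<open>For \<open>a = 0\<close> the two pieces of \<open>\<psi>\<close> overlap at
        the single point \<open>0\<close>, which is discarded.\<close>
      have "integral {-pi..pi} (\<lambda>x. (cmod (\<psi> x))\<^sup>2) = integral {-pi..pi} (\<lambda>x. (cmod (\<psi>1 x))\<^sup>2 + (cmod (\<psi>2 x))\<^sup>2)"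
        by (rule integral_spike[of "{0}"]) (use a in \<open>auto simp: \<psi>_def \<psi>1_def \<psi>2_def\<close>)
      also have "\<dots> = (l2norm (-pi) pi \<psi>1)\<^sup>2 + (l2norm (-pi) pi \<psi>2)\<^sup>2"
        unfolding l2norm_power2 using 1 2 by (intro Henstock_Kurzweil_Integration.integral_add) (auto simp: sq_int_def)
      finally show ?thesis unfolding l2norm_def[of "-pi" pi \<psi>] H_def 1(2) 2(2) by simp
    qed
    moreover have "l2norm (-a) a \<psi> = 0"
    proof -
      have "integral {-a..a} (\<lambda>x. (cmod (\<psi> x))\<^sup>2) = integral {-a..a} (\<lambda>x. 0)"
        by (rule integral_spike[of "{a, -a}"]) (auto simp: \<psi>_def)
      then show ?thesis by (simp add: l2norm_def)
    qed
    moreover have "integral {0..pi} (\<lambda>x. hp x * \<psi> x + hm x * \<psi> (-x)) = complex_of_real ((H a)\<^sup>2)"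
    proof (rule integral_unique)
      have "((\<lambda>x. (cmod (hp x))\<^sup>2 + (cmod (hm x))\<^sup>2) has_integral ((l2norm a pi hp)\<^sup>2 + (l2norm a pi hm)\<^sup>2)) {a..pi}"
        unfolding l2norm_power2 using ha by (intro has_integral_add integrable_integral) (auto simp: sq_int_def)
      then have "((\<lambda>x. (cmod (hp x))\<^sup>2 + (cmod (hm x))\<^sup>2) has_integral (H a)\<^sup>2) {a..pi}" by (simp add: H_def)
      then have "((\<lambda>x. if x \<in> {a..pi} then (cmod (hp x))\<^sup>2 + (cmod (hm x))\<^sup>2 else 0) has_integral (H a)\<^sup>2) {0..pi}"
        using a by (subst has_integral_restrict) auto
      from has_integral_linear[OF this bounded_linear_of_real[where 'a=complex]]
      have l: "((\<lambda>x. complex_of_real (if x \<in> {a..pi} then (cmod (hp x))\<^sup>2 + (cmod (hm x))\<^sup>2 else 0)) has_integral of_real ((H a)\<^sup>2)) {0..pi}"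
        by (simp only: o_def)
      show "((\<lambda>x. hp x * \<psi> x + hm x * \<psi> (-x)) has_integral of_real ((H a)\<^sup>2)) {0..pi}"
      proof (rule has_integral_spike[OF _ _ l])
        show "negligible {0 :: real}" by simp
        fix x assume x: "x \<in> {0..pi} - {0}"
        show "hp x * \<psi> x + hm x * \<psi> (-x) = complex_of_real (if x \<in> {a..pi} then (cmod (hp x))\<^sup>2 + (cmod (hm x))\<^sup>2 else 0)"
          using x a unfolding \<psi>_def by (auto simp: complex_norm_square[symmetric] simp del: of_real_power)
      qed
    qed
    moreover have "sq_int (-pi) pi \<psi>" unfolding \<psi> by (rule sq_int_add[OF 1(1) 2(1)])
    ultimately have "(H a)\<^sup>2 \<le> H a * integral {a..pi} \<kappa>"
      using ineq'[OF a, of \<psi>] by (simp add: norm_power)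
    then show ?thesis
      using H0[of a] \<kappa>0[of a pi] a by (cases "H a = 0") (auto simp: power2_eq_square)
  qed
  \<comment> \<open>Chosen so that \<open>2 * L * \<epsilon> \<le> 1 / 2\<close>; the factor
    \<open>2\<close> counts \<open>hp\<close> and \<open>hm\<close>.\<close>
  define \<epsilon> where "\<epsilon> = 1 / (2 * (2 * L + 1))"
  have \<epsilon>: "\<epsilon> > 0" "2 * L * \<epsilon> \<le> 1 / 2" using L by (auto simp: \<epsilon>_def field_simps)
  define G where "G = (\<lambda>x. integral {0..x} (\<lambda>s. (cmod (\<rho> s))\<^sup>2))"
  have \<rho>i: "(\<lambda>s. (cmod (\<rho> s))\<^sup>2) integrable_on {0..pi}" using \<rho> by (simp add: sq_int_def)
  have "uniformly_continuous_on {0..pi} G"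
    unfolding G_def by (intro compact_uniformly_continuous indefinite_integral_continuous_1 \<rho>i) simp
  \<comment> \<open>Uniform continuity of \<open>G\<close> gives a step length independent of the
    position: the norm of \<open>\<rho>\<close> on any subinterval shorter than
    \<open>\<delta>\<close> is at most \<open>\<epsilon>\<close>.\<close>
  then obtain \<delta> where \<delta>: "\<delta> > 0" "\<And>x y. x \<in> {0..pi} \<Longrightarrow> y \<in> {0..pi} \<Longrightarrow> dist y x < \<delta> \<Longrightarrow> dist (G y) (G x) < \<epsilon>\<^sup>2"
    unfolding uniformly_continuous_on_def using \<epsilon>(1) by (meson zero_less_power)
  \<comment> \<open>If the pair vanishes beyond \<open>b\<close>, only \<open>[a, b]\<close>
    contributes to the integral of \<open>\<kappa>\<close>, which gives
    \<open>H a \<le> H a / 2\<close>.\<close>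
  have step2: "H a = 0" if ab: "0 \<le> a" "a \<le> b" "b \<le> pi" "b - a < \<delta>" and Hb: "H b = 0" for a b
  proof -
    have "integral {0..a} (\<lambda>s. (cmod (\<rho> s))\<^sup>2) + integral {a..b} (\<lambda>s. (cmod (\<rho> s))\<^sup>2) = integral {0..b} (\<lambda>s. (cmod (\<rho> s))\<^sup>2)"
      by (rule Henstock_Kurzweil_Integration.integral_combine) (use ab hsub(3)[of 0 b] in \<open>auto simp: sq_int_def\<close>)
    then have "(l2norm a b \<rho>)\<^sup>2 = G b - G a" unfolding l2norm_power2 G_def by simp
    also have "\<dots> < \<epsilon>\<^sup>2" using \<delta>(2)[of a b] ab by (auto simp: dist_real_def)
    finally have "(l2norm a b \<rho>)\<^sup>2 < \<epsilon>\<^sup>2" .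
    then have \<rho>s: "l2norm a b \<rho> \<le> \<epsilon>"
      using power2_less_imp_less[OF _ less_imp_le[OF \<epsilon>(1)]] by (intro less_imp_le)
    have hb: "l2norm b pi hp = 0" "l2norm b pi hm = 0" 
      using Hle[of b] Hb l2norm_nonneg[of b pi hp] l2norm_nonneg[of b pi hm] by linarith+
    have "integral {a..b} \<kappa> + integral {b..pi} \<kappa> = integral {a..pi} \<kappa>"
      by (rule Henstock_Kurzweil_Integration.integral_combine) (use ab \<kappa>int in auto)
    moreover have "integral {b..pi} \<kappa> \<le> 0" using \<kappa>le[of b pi] ab hb by simp
    moreover have "integral {a..b} \<kappa> \<le> L * ((H a + H a) * \<epsilon>)"
    proof -
      have "l2norm a b hp \<le> H a" "l2norm a b hm \<le> H a"
        using sq_int_subinterval(2)[OF hsub(1)[of a pi], of a b] sq_int_subinterval(2)[OF hsub(2)[of a pi], of a b] Hle[of a] ab by auto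
      then have "(l2norm a b hp + l2norm a b hm) * l2norm a b \<rho> \<le> (H a + H a) * \<epsilon>"
        using \<rho>s H0[of a] by (intro mult_mono add_mono l2norm_nonneg) auto
      from order_trans[OF \<kappa>le[OF ab(1) ab(3)] mult_left_mono[OF this L]] show ?thesis .
    qed
    ultimately have "H a \<le> L * ((H a + H a) * \<epsilon>)" using step1[of a] ab by simp
    also have "\<dots> = (2 * L * \<epsilon>) * H a" by (simp add: algebra_simps)
    also have "\<dots> \<le> 1 / 2 * H a" using \<epsilon>(2) H0 by (rule mult_right_mono)
    finally show ?thesis using H0[of a] by simp
  qed
  \<comment> \<open>Descent from \<open>pi\<close>, where \<open>H\<close> is trivially
    \<open>0\<close>, in steps of length \<open>\<delta> / 2\<close>, cut off at
    \<open>0\<close>.\<close>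
  have iter: "H (max 0 (pi - real k * (\<delta> / 2))) = 0" for k
  proof (induction k)
    case 0
    then show ?case by (simp add: H_def l2norm_def)
  next
    case (Suc k)
    show ?case
      by (rule step2[OF _ _ _ _ Suc]) (use \<delta>(1) in \<open>auto simp: max_def algebra_simps\<close>)
  qed
  obtain k where "pi / (\<delta> / 2) < real k" using reals_Archimedean2 by blast
  then have "pi - real k * (\<delta> / 2) \<le> 0" using \<delta>(1) by (simp add: field_simps)
  then have "H 0 = 0" using iter[of k] by (simp add: max_absorb1)
  then show "l2norm 0 pi hp = 0" "l2norm 0 pi hm = 0"
    using Hle[of 0] l2norm_nonneg[of 0 pi hp] l2norm_nonneg[of 0 pi hm] by linarith+
qed

section \<open>Comparison of two pencils\<close>

lemma least_index:
  fixes lam :: "nat \<Rightarrow> complex" and k :: nat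
  assumes "equal_values_consecutive lam"
  defines "n \<equiv> LEAST n. lam n = lam k"
  shows "lam n = lam k" "enat (k - n) < occurrences lam n" "n \<le> k"
proof -
  show ln: "lam n = lam k" unfolding n_def by (rule LeastI) simp
  show nk: "n \<le> k" unfolding n_def by (rule Least_le) simp
  obtain n' \<nu> where n': "n' \<in> first_indices lam" "enat \<nu> < occurrences lam n'" "k = n' + \<nu>"
    using index_decomposition[OF assms(1), of k] by blast
  have lk: "lam k = lam n'" using n' assms(1) unfolding equal_values_consecutive_def by blast
  have "n = n'" unfolding n_def
  proof (rule Least_equality)
    show "lam n' = lam k" using lk by simp
    show "n' \<le> m" if "lam m = lam k" for m
      using n'(1) that lk by (metis (mono_tags, lifting) first_indices_def mem_Collect_eq not_le_imp_less)
  qed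
  then show "enat (k - n) < occurrences lam n" using n' by simp
qed

text \<open>In Leibniz' formula only the derivatives of order \<open>0\<close> and \<open>1\<close>
  of the factor \<open>w\<close> survive. The first carries the factor \<open>z\<close>, so at
  \<open>z = 0\<close> one more derivative vanishes.\<close>

lemma higher_deriv_times_ident:
  assumes f: "f holomorphic_on UNIV"
    and z: "\<And>j. j < m \<Longrightarrow> (deriv ^^ j) f z = 0" and \<nu>: "\<nu> < m \<or> z = 0 \<and> \<nu> \<le> m"
  shows "(deriv ^^ \<nu>) (\<lambda>w. w * f w) z = 0"
proof -
  have "(deriv ^^ \<nu>) (\<lambda>w. w * f w) z = (\<Sum>i = 0..\<nu>. of_nat (\<nu> choose i) * (deriv ^^ i) (\<lambda>w. w) z * (deriv ^^ (\<nu> - i)) f z)"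
    by (rule higher_deriv_mult[OF holomorphic_on_ident f open_UNIV UNIV_I])
  also have "\<dots> = 0"
  proof (rule sum.neutral, rule ballI)
    fix i assume i: "i \<in> {0..\<nu>}"
    consider "i = 0" | "i = 1" | "i \<ge> 2" by linarith
    then show "of_nat (\<nu> choose i) * (deriv ^^ i) (\<lambda>w. w) z * (deriv ^^ (\<nu> - i)) f z = 0"
    proof cases
      case 1
      then show ?thesis using \<nu> z[of \<nu>] by auto
    next
      case 2
      then have "\<nu> - i < m" using \<nu> i by auto
      then show ?thesis using z[of "\<nu> - i"] by simp
    qed simp
  qed
  finally show ?thesis .
qed

text \<open>The index \<open>0\<close> is not counted in a subspectrum; for the value \<open>0\<close> the factor \<open>w\<close> supplies the
  missing zero.\<close>

lemma subspectrum_deriv_zero: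
  assumes f: "f holomorphic_on UNIV" and l0: "lam 0 = 0" and cons: "equal_values_consecutive lam"
    and sub: "ecard {j. 1 \<le> j \<and> lam j = lam k} \<le> zero_mult f (lam k)"
  shows "(deriv ^^ (k - (LEAST n. lam n = lam k))) (\<lambda>w. w * f w) (lam k) = 0"
proof -
  define n where "n = (LEAST n. lam n = lam k)"
  note L = least_index[OF cons, of k, folded n_def]
  define \<nu> where "\<nu> = k - n"
  let ?A = "{j. lam j = lam k}" and ?B = "{j. 1 \<le> j \<and> lam j = lam k}"
  have occ: "enat \<nu> < ecard ?A" using L by (simp add: \<nu>_def occurrences_def)
  \<comment> \<open>A finite \<open>m\<close> stands in for the cardinality, which may be
    infinite.\<close>
  have "\<exists>m. enat m \<le> ecard ?B \<and> (\<nu> < m \<or> lam k = 0 \<and> \<nu> \<le> m)"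
  proof (cases "lam k = 0")
    case True
    \<comment> \<open>The conventional entry \<open>lam 0 = 0\<close> is one further occurrence of
      the value \<open>0\<close>, so here \<open>\<nu>\<close> may reach the cardinality of
      \<open>?B\<close>.\<close>
    then have A: "?A = insert 0 ?B" using l0 by (auto simp: not_le)
    have "enat \<nu> \<le> ecard ?B"
    proof (cases "finite ?B")
      case fin: True
      then have "card ?A = Suc (card ?B)" unfolding A by simp
      then show ?thesis using occ fin unfolding A by (simp add: ecard_def)
    qed (simp add: ecard_def)
    then show ?thesis using True by blast
  next
    case False
    then have "?B = ?A" using l0 by (metis (lifting) One_nat_def Suc_leI neq0_conv)
    then have "enat (Suc \<nu>) \<le> ecard ?B" using occ by (simp add: Suc_ile_eq)
    then show ?thesis by blast
  qed
  then obtain m where m: "enat m \<le> ecard ?B" "\<nu> < m \<or> lam k = 0 \<and> \<nu> \<le> m" by blast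
  have "(deriv ^^ j) f (lam k) = 0" if "j < m" for j
    by (rule zero_mult_imp_deriv_zero[OF f order_trans[OF m(1) sub] that])
  then show ?thesis
    using higher_deriv_times_ident[OF f _ m(2)] by (simp add: \<nu>_def n_def)
qed

lemma pw_trig:
  assumes F: "pw x C F" "C \<ge> 0" "0 \<le> x" and M: "cmod \<alpha> \<le> M" "cmod \<beta> \<le> M"
  shows "pw (2 * x) (2 * M * C) (\<lambda>l. (\<alpha> * exp (\<i> * l * of_real x) + \<beta> * exp (\<i> * l * of_real (- x))) * F l)"
proof -
  have s: "pw (x + x) C (\<lambda>l. exp (\<i> * l * of_real y) * F l)" if "\<bar>y\<bar> \<le> x" for y
    by (rule pw_shift[OF F(1,2) that F(3)])
  have p: "pw (x + x) (cmod \<alpha> * C + cmod \<beta> * C) (\<lambda>l. \<alpha> * (exp (\<i> * l * of_real x) * F l) + \<beta> * (exp (\<i> * l * of_real (- x)) * F l))"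
    by (intro pw_add pw_cmult s) (use F in auto)
  have le: "cmod \<alpha> * C + cmod \<beta> * C \<le> 2 * M * C"
    using mult_right_mono[OF M(1) F(2)] mult_right_mono[OF M(2) F(2)] by linarith
  have "pw (2 * x) (2 * M * C) (\<lambda>l. \<alpha> * (exp (\<i> * l * of_real x) * F l) + \<beta> * (exp (\<i> * l * of_real (- x)) * F l))"
    by (rule pw_mono[OF p _ le]) (use F M order_trans[OF norm_ge_zero M(1)] in auto)
  then show ?thesis by (simp only: distrib_right mult.assoc)
qed

lemma pw_prod:
  assumes "pw x C F" "pw x C G" "C \<ge> 0" "0 \<le> x" "x \<le> pi"
  shows "pw (2 * x) (C * (sqrt (2 * pi) * C)) (\<lambda>l. F l * G l)"
proof -
  have "pw (x + x) (C * (sqrt (2 * x) * C)) (\<lambda>l. F l * G l)"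
    by (rule pw_mult) (use assms in auto)
  then show ?thesis
    by (rule pw_mono) (use assms in \<open>auto intro!: mult_left_mono mult_right_mono\<close>)
qed

text \<open>Halving the frequencies stretches the sum by the factor \<open>2\<close>;
  \<open>sqrt 2\<close> comes from the Jacobian. This undoes the doubling of intervals caused by
  products of solutions.\<close>

lemma l2norm_esum_half:
  assumes "0 \<le> x"
  shows "l2norm (- (2 * x)) (2 * x) (esum n c (\<lambda>j. l j / 2)) = sqrt 2 * l2norm (- x) x (esum n c l)"
proof -
  define g where "g = (\<lambda>t. (cmod (esum n c l t))\<^sup>2)"
  have "continuous_on {-x..x} g" unfolding g_def by (intro continuous_intros continuous_esum)
  then have "(g has_integral integral {-x..x} g) (cbox (-x) x)"
    using integrable_integral[OF integrable_continuous_real] by simp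
  from has_integral_affinity[OF this, of "1/2" 0]
  have "((\<lambda>t. g ((1/2) * t)) has_integral 2 * integral {-x..x} g) ((\<lambda>t. 2 * t) ` {-x..x})"
    by simp
  moreover have "(\<lambda>t. 2 * t) ` {-x..x} = {-(2 * x)..2 * x}"
    using assms image_mult_atLeastAtMost[of 2 "-x" x] by simp
  moreover have "g ((1/2) * t) = (cmod (esum n c (\<lambda>j. l j / 2) t))\<^sup>2" for t
    by (simp add: g_def esum_def)
  ultimately have "integral {-(2 * x)..2 * x} (\<lambda>t. (cmod (esum n c (\<lambda>j. l j / 2) t))\<^sup>2) = 2 * integral {-x..x} g"
    by (simp add: integral_unique)
  then show ?thesis by (simp add: l2norm_def g_def real_sqrt_mult)
qed

lemma sq_int_l2n_zero_AE:
  assumes f: "sq_int a b f" and z: "l2norm a b f = 0"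
  shows "AE x in lebesgue_on {a<..<b}. f x = 0"
proof -
  have i: "integrable (lebesgue_on {a<..<b}) (\<lambda>x. (cmod (f x))\<^sup>2)"
    using sq_int_imp_L2_on[OF f] by (simp add: L2_on_def)
  have "integral\<^sup>L (lebesgue_on {a<..<b}) (\<lambda>x. (cmod (f x))\<^sup>2) = (l2norm a b f)\<^sup>2"
    using lebesgue_integral_eq_integral[OF i] by (simp add: l2norm_power2 integral_open_interval_real)
  then have "integral\<^sup>L (lebesgue_on {a<..<b}) (\<lambda>x. (cmod (f x))\<^sup>2) = 0" using z by simp
  then have "AE x in lebesgue_on {a<..<b}. (cmod (f x))\<^sup>2 = 0"
    using integral_nonneg_eq_0_iff_AE[OF i] by simp
  then show ?thesis by simp
qed

text \<open>Since \<open>ep * em = 1\<close> for both problems, the two assumptions force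
  \<open>c\<^sup>2 = 1\<close>; in the application \<open>c = exp (i pi k)\<close>.\<close>

locale pencil_pair = P: pencil p \<sigma> + Q: pencil pt \<sigma>t for p \<sigma> pt \<sigma>t +
  fixes c :: complex
  assumes em_pi: "P.em pi = c * Q.em pi" and ep_pi: "P.ep pi = c * Q.ep pi"
begin

lemma boundary_pw:
  "\<exists>C\<ge>0. pw pi C (\<lambda>l. P.y1sol l pi - c * Q.y1sol l pi) \<and> pw pi C (\<lambda>l. l * P.ysol l pi - c * (l * Q.ysol l pi))"
proof -
  have pi: "pi \<in> {0..pi}" by simp
  obtain C where C: "C \<ge> 0" "pw pi C (\<lambda>l. P.y1sol l pi - P.cth l pi)" "pw pi C (\<lambda>l. l * P.ysol l pi - P.sth l pi)"
    using P.transmutation pi by blast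
  obtain C' where C': "C' \<ge> 0" "pw pi C' (\<lambda>l. Q.y1sol l pi - Q.cth l pi)" "pw pi C' (\<lambda>l. l * Q.ysol l pi - Q.sth l pi)"
    using Q.transmutation pi by blast
  have cc: "P.cth l pi = c * Q.cth l pi" "P.sth l pi = c * Q.sth l pi" for l
    by (simp_all add: P.cth_def Q.cth_def P.sth_def Q.sth_def em_pi ep_pi field_simps)
  have e: "P.y1sol l pi - c * Q.y1sol l pi = (P.y1sol l pi - P.cth l pi) + (- c) * (Q.y1sol l pi - Q.cth l pi)"
    "l * P.ysol l pi - c * (l * Q.ysol l pi) = (l * P.ysol l pi - P.sth l pi) + (- c) * (l * Q.ysol l pi - Q.sth l pi)" for l
    unfolding cc by (simp_all add: algebra_simps)
  have "pw pi (C + cmod (- c) * C') (\<lambda>l. P.y1sol l pi - c * Q.y1sol l pi)"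
    unfolding e(1) by (rule pw_add[OF C(2) pw_cmult[OF C'(2)]])
  moreover have "pw pi (C + cmod (- c) * C') (\<lambda>l. l * P.ysol l pi - c * (l * Q.ysol l pi))"
    unfolding e(2) by (rule pw_add[OF C(3) pw_cmult[OF C'(3)]])
  ultimately show ?thesis
    using C(1) C'(1) by (intro exI[of _ "C + cmod (- c) * C'"]) simp
qed

section \<open>The derivative of the Wronskian\<close>

definition g1 :: "real \<Rightarrow> complex" where "g1 x = \<sigma>t x - \<sigma> x"
definition g2 :: "real \<Rightarrow> complex" where "g2 x = p x - pt x"

text \<open>Derivative of the Wronskian \<open>y1 * yt - y * y1t\<close>; the middle term is what
  remains of \<open>\<sigma>t\<^sup>2 - \<sigma>\<^sup>2\<close>.\<close>

definition W' :: "complex \<Rightarrow> real \<Rightarrow> complex" where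
  "W' l x = g1 x * (P.y1sol l x * Q.ysol l x + P.ysol l x * Q.y1sol l x) +
     g1 x * (\<sigma> x + \<sigma>t x) * (P.ysol l x * Q.ysol l x) + 2 * l * g2 x * (P.ysol l x * Q.ysol l x)"

lemma sq_g1: "sq_int 0 pi g1" and sq_g2: "sq_int 0 pi g2"
  unfolding g1_def[abs_def] g2_def[abs_def]
  by (intro sq_int_diff P.sq_p P.sq_\<sigma> Q.sq_p Q.sq_\<sigma>)+

lemma wronskian:
  "ac_deriv 0 pi (\<lambda>x. P.y1sol l x * Q.ysol l x + (-1) * (P.ysol l x * Q.y1sol l x)) (W' l)"
proof (rule ac_deriv_cong)
  show "ac_deriv 0 pi (\<lambda>x. P.y1sol l x * Q.ysol l x + (-1) * (P.ysol l x * Q.y1sol l x))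
    (\<lambda>x. (P.y1sol l x * (\<sigma>t x * Q.ysol l x + Q.y1sol l x) + (P.q l x * P.ysol l x - \<sigma> x * P.y1sol l x) * Q.ysol l x)
      + (-1) * (P.ysol l x * (Q.q l x * Q.ysol l x - \<sigma>t x * Q.y1sol l x) + (\<sigma> x * P.ysol l x + P.y1sol l x) * Q.y1sol l x))"
    by (intro ac_deriv_add ac_deriv_cmult ac_deriv_mult P.ac_deriv_ysol P.ac_deriv_y1sol Q.ac_deriv_ysol Q.ac_deriv_y1sol)
  fix x
  show "(P.y1sol l x * (\<sigma>t x * Q.ysol l x + Q.y1sol l x) + (P.q l x * P.ysol l x - \<sigma> x * P.y1sol l x) * Q.ysol l x)
      + (-1) * (P.ysol l x * (Q.q l x * Q.ysol l x - \<sigma>t x * Q.y1sol l x) + (\<sigma> x * P.ysol l x + P.y1sol l x) * Q.y1sol l x) = W' l x"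
    by (simp add: W'_def g1_def g2_def P.q_def Q.q_def algebra_simps power2_eq_square)
qed

text \<open>\<open>hp\<close> and \<open>hm\<close> are the coefficients of
  \<open>exp (2 i l x)\<close> and \<open>exp (- 2 i l x)\<close> in the leading part of
  \<open>l * W' l x\<close>.\<close>

definition hp :: "real \<Rightarrow> complex" where
  "hp x = (g1 x / (2 * \<i>) - g2 x / 2) * (P.em x * Q.em x)"
definition hm :: "real \<Rightarrow> complex" where
  "hm x = (- g1 x / (2 * \<i>) - g2 x / 2) * (P.ep x * Q.ep x)"

text \<open>Products of two solutions minus their trigonometric leading parts. In \<open>rC\<close>
  nothing is subtracted, because \<open>P.ysol\<close> itself is already a remainder.\<close>

definition rA :: "real \<Rightarrow> complex \<Rightarrow> complex" where
  "rA x l = P.y1sol l x * (l * Q.ysol l x) + (l * P.ysol l x) * Q.y1sol l x - (P.cth l x * Q.sth l x + P.sth l x * Q.cth l x)"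
definition rB :: "real \<Rightarrow> complex \<Rightarrow> complex" where
  "rB x l = (l * P.ysol l x) * (l * Q.ysol l x) - P.sth l x * Q.sth l x"
definition rC :: "real \<Rightarrow> complex \<Rightarrow> complex" where
  "rC x l = P.ysol l x * (l * Q.ysol l x)"

text \<open>The part of \<open>l * W' l x\<close> that does not oscillate with \<open>l\<close>. It is not controlled by the \<open>L\<^sub>2\<close> norm of
  a test function, but it is the derivative of \<open>sin (P.th - Q.th)\<close>, which vanishes at both ends.\<close>

definition T :: "real \<Rightarrow> complex" where
  "T x = g2 x * (P.em x * Q.ep x + P.ep x * Q.em x) / 2"

text \<open>Product formulas for \<open>cos\<close> and \<open>sin\<close> at the arguments
  \<open>l x - P.th x\<close> and \<open>l x - Q.th x\<close>: sums of the arguments give the terms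
  with \<open>hp\<close> and \<open>hm\<close>, differences give \<open>T\<close>.\<close>

lemma W'_decomposition:
  "l * W' l x = hp x * exp (\<i> * l * of_real (2 * x)) + hm x * exp (\<i> * l * of_real (- (2 * x))) + T x
     + (g1 x * rA x l + (g1 x * (\<sigma> x + \<sigma>t x)) * rC x l + (2 * g2 x) * rB x l)"
proof -
  define e where "e = exp (\<i> * l * of_real x)"
  define f where "f = exp (\<i> * l * of_real (- x))"
  have ef: "e * f = 1" "f * e = 1" by (simp_all add: e_def f_def flip: exp_add)
  have ee: "exp (\<i> * l * of_real (2 * x)) = e * e" "exp (\<i> * l * of_real (- (2 * x))) = f * f"
    unfolding e_def f_def exp_add[symmetric] by (simp_all add: algebra_simps)
  have s1: "P.cth l x * Q.sth l x + P.sth l x * Q.cth l x = (P.em x * Q.em x * (e * e) - P.ep x * Q.ep x * (f * f)) / (2 * \<i>)"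
    unfolding P.cth_def Q.cth_def P.sth_def Q.sth_def e_def[symmetric] f_def[symmetric]
    by (simp add: field_simps)
  have s2: "2 * (P.sth l x * Q.sth l x) = - (P.em x * Q.em x * (e * e) + P.ep x * Q.ep x * (f * f)) / 2 + (P.em x * Q.ep x * (e * f) + P.ep x * Q.em x * (f * e)) / 2"
    unfolding P.sth_def Q.sth_def e_def[symmetric] f_def[symmetric]
    by (simp add: field_simps)
  have d: "w / (2 * \<i>) = (- \<i> / 2) * w" for w by (simp add: field_simps)
  have "l * W' l x = g1 x * (P.cth l x * Q.sth l x + P.sth l x * Q.cth l x) + g2 x * (2 * (P.sth l x * Q.sth l x))
     + (g1 x * rA x l + (g1 x * (\<sigma> x + \<sigma>t x)) * rC x l + (2 * g2 x) * rB x l)"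
    by (simp add: W'_def rA_def rB_def rC_def algebra_simps)
  then show ?thesis
    unfolding s1 s2 ef ee hp_def hm_def T_def d by (simp add: algebra_simps add_divide_distrib diff_divide_distrib)
qed

lemma T_integral: "(T has_integral 0) {0..pi}"
proof -
  \<comment> \<open>At \<open>pi\<close> both products equal \<open>c\<close>, by the assumptions of
    the locale and \<open>ep * em = 1\<close>; at \<open>0\<close> both equal
    \<open>1\<close>.\<close>
  have A: "ac_deriv 0 pi (\<lambda>x. P.ep x * Q.em x + (-1) * (P.em x * Q.ep x)) (\<lambda>x. 2 * \<i> * T x)"
  proof (rule ac_deriv_cong)
    show "ac_deriv 0 pi (\<lambda>x. P.ep x * Q.em x + (-1) * (P.em x * Q.ep x))
      (\<lambda>x. (P.ep x * (- \<i> * pt x * Q.em x) + (\<i> * p x * P.ep x) * Q.em x) + (-1) * (P.em x * (\<i> * pt x * Q.ep x) + (- \<i> * p x * P.em x) * Q.ep x))"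
      by (intro ac_deriv_add ac_deriv_cmult ac_deriv_mult P.ac_deriv_ep P.ac_deriv_em Q.ac_deriv_ep Q.ac_deriv_em)
    fix x
    show "(P.ep x * (- \<i> * pt x * Q.em x) + (\<i> * p x * P.ep x) * Q.em x) + (-1) * (P.em x * (\<i> * pt x * Q.ep x) + (- \<i> * p x * P.em x) * Q.ep x) = 2 * \<i> * T x"
      by (simp add: T_def g2_def algebra_simps)
  qed
  have "P.ep 0 = 1" "P.em 0 = 1" "Q.ep 0 = 1" "Q.em 0 = 1"
    by (simp_all add: P.ep_def P.em_def Q.ep_def Q.em_def P.th_def Q.th_def)
  with ac_deriv_has_integral[OF A] have "((\<lambda>x. 2 * \<i> * T x) has_integral 0) {0..pi}"
    by (simp add: em_pi ep_pi mult.assoc)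
  from has_integral_mult_right[OF this, of "1 / (2 * \<i>)"] show ?thesis by simp
qed

lemma exponents_bounded:
  obtains M where "M \<ge> 1"
    "\<And>x. x \<in> {0..pi} \<Longrightarrow> cmod (P.ep x) \<le> M \<and> cmod (P.em x) \<le> M \<and> cmod (Q.ep x) \<le> M \<and> cmod (Q.em x) \<le> M"
proof -
  obtain M1 where M1: "M1 \<ge> 0" "\<And>x. x \<in> {0..pi} \<Longrightarrow> cmod (P.ep x) \<le> M1" using continuous_on_bounded_Icc[OF P.continuous_ep] by blast
  obtain M2 where M2: "M2 \<ge> 0" "\<And>x. x \<in> {0..pi} \<Longrightarrow> cmod (P.em x) \<le> M2" using continuous_on_bounded_Icc[OF P.continuous_em] by blast
  obtain M3 where M3: "M3 \<ge> 0" "\<And>x. x \<in> {0..pi} \<Longrightarrow> cmod (Q.ep x) \<le> M3" using continuous_on_bounded_Icc[OF Q.continuous_ep] by blast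
  obtain M4 where M4: "M4 \<ge> 0" "\<And>x. x \<in> {0..pi} \<Longrightarrow> cmod (Q.em x) \<le> M4" using continuous_on_bounded_Icc[OF Q.continuous_em] by blast
  have "cmod (P.ep x) \<le> 1 + M1 + M2 + M3 + M4 \<and> cmod (P.em x) \<le> 1 + M1 + M2 + M3 + M4 \<and>
      cmod (Q.ep x) \<le> 1 + M1 + M2 + M3 + M4 \<and> cmod (Q.em x) \<le> 1 + M1 + M2 + M3 + M4" if "x \<in> {0..pi}" for x
    using M1(1) M2(1) M3(1) M4(1) M1(2)[OF that] M2(2)[OF that] M3(2)[OF that] M4(2)[OF that] by linarith
  then show ?thesis using that[of "1 + M1 + M2 + M3 + M4"] M1(1) M2(1) M3(1) M4(1) by auto
qed

text \<open>Each of \<open>y1\<close> and \<open>l y\<close> is its trigonometric part plus a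
  transform on \<open>(-x, x)\<close>. In a product a trigonometric factor shifts by
  \<open>x\<close> and \<open>-x\<close>, and a second remainder convolves; both enlarge the
  interval to \<open>(-2x, 2x)\<close>.\<close>

lemma remainder_pw:
  obtains K where "K \<ge> 0" "\<And>x. x \<in> {0..pi} \<Longrightarrow> pw (2 * x) K (rA x) \<and> pw (2 * x) K (rB x) \<and> pw (2 * x) K (rC x)"
proof -
  obtain M where M: "M \<ge> 1"
    "\<And>x. x \<in> {0..pi} \<Longrightarrow> cmod (P.ep x) \<le> M \<and> cmod (P.em x) \<le> M \<and> cmod (Q.ep x) \<le> M \<and> cmod (Q.em x) \<le> M"
    by (rule exponents_bounded) blast
  obtain C1 where C1: "C1 \<ge> 0" "\<And>x. x \<in> {0..pi} \<Longrightarrow> pw x C1 (\<lambda>l. P.y1sol l x - P.cth l x) \<and> pw x C1 (\<lambda>l. l * P.ysol l x - P.sth l x) \<and>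
     pw x C1 (\<lambda>l. P.ysol l x)" using P.transmutation by blast
  obtain C2 where C2: "C2 \<ge> 0" "\<And>x. x \<in> {0..pi} \<Longrightarrow> pw x C2 (\<lambda>l. Q.y1sol l x - Q.cth l x) \<and> pw x C2 (\<lambda>l. l * Q.ysol l x - Q.sth l x) \<and>
     pw x C2 (\<lambda>l. Q.ysol l x)" using Q.transmutation by blast
  define C where "C = C1 + C2"
  have C: "C \<ge> 0" using C1(1) C2(1) by (simp add: C_def)
  define t where "t = 2 * M * C"
  define r where "r = C * (sqrt (2 * pi) * C)"
  have tr: "t \<ge> 0" "r \<ge> 0" using M(1) C by (auto simp: t_def r_def)
  \<comment> \<open>\<open>rA\<close> needs the largest constant: four terms with one trigonometric
    factor and two products of remainders.\<close>
  define K where "K = 4 * t + 2 * r"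
  have "pw (2 * x) K (rA x) \<and> pw (2 * x) K (rB x) \<and> pw (2 * x) K (rC x)" if x: "x \<in> {0..pi}" for x
  proof -
    have x0: "0 \<le> x" "x \<le> pi" using x by auto
    define Kp where "Kp = (\<lambda>l. P.y1sol l x - P.cth l x)"
    define Kq where "Kq = (\<lambda>l. Q.y1sol l x - Q.cth l x)"
    define Np where "Np = (\<lambda>l. l * P.ysol l x - P.sth l x)"
    define Nq where "Nq = (\<lambda>l. l * Q.ysol l x - Q.sth l x)"
    define Yp where "Yp = (\<lambda>l. P.ysol l x)"
    have u1: "pw x C F" if "pw x C1 F" for F
      by (rule pw_mono[OF that]) (use C1(1) C2(1) in \<open>simp_all add: C_def\<close>)
    have u2: "pw x C F" if "pw x C2 F" for F
      by (rule pw_mono[OF that]) (use C1(1) C2(1) in \<open>simp_all add: C_def\<close>)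
    have N: "pw x C Kp" "pw x C Np" "pw x C Yp" "pw x C Kq" "pw x C Nq"
      unfolding Kp_def Np_def Yp_def Kq_def Nq_def
      by (rule u1[OF conjunct1[OF C1(2)[OF x]]], rule u1[OF conjunct1[OF conjunct2[OF C1(2)[OF x]]]],
          rule u1[OF conjunct2[OF conjunct2[OF C1(2)[OF x]]]], rule u2[OF conjunct1[OF C2(2)[OF x]]],
          rule u2[OF conjunct1[OF conjunct2[OF C2(2)[OF x]]]])
    have h: "cmod (w / 2) \<le> M" "cmod (w / (2 * \<i>)) \<le> M" "cmod (- w / (2 * \<i>)) \<le> M" if "cmod w \<le> M" for w
      using that M(1) norm_ge_zero[of w] by (auto simp: norm_divide norm_mult)
    note Mx = M(2)[OF x]
    have tc: "pw (2 * x) t (\<lambda>l. P.cth l x * F l)" "pw (2 * x) t (\<lambda>l. P.sth l x * F l)"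
       "pw (2 * x) t (\<lambda>l. Q.cth l x * F l)" "pw (2 * x) t (\<lambda>l. Q.sth l x * F l)" if F: "pw x C F" for F
    proof -
      have eq: "P.cth l x = P.em x / 2 * exp (\<i> * l * of_real x) + P.ep x / 2 * exp (\<i> * l * of_real (- x))"
        "Q.cth l x = Q.em x / 2 * exp (\<i> * l * of_real x) + Q.ep x / 2 * exp (\<i> * l * of_real (- x))"
        "P.sth l x = P.em x / (2 * \<i>) * exp (\<i> * l * of_real x) + (- P.ep x / (2 * \<i>)) * exp (\<i> * l * of_real (- x))"
        "Q.sth l x = Q.em x / (2 * \<i>) * exp (\<i> * l * of_real x) + (- Q.ep x / (2 * \<i>)) * exp (\<i> * l * of_real (- x))" for l
        by (simp_all add: P.cth_def Q.cth_def P.sth_def Q.sth_def field_simps)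
      show "pw (2 * x) t (\<lambda>l. P.cth l x * F l)" "pw (2 * x) t (\<lambda>l. P.sth l x * F l)"
       "pw (2 * x) t (\<lambda>l. Q.cth l x * F l)" "pw (2 * x) t (\<lambda>l. Q.sth l x * F l)"
        unfolding eq t_def by (intro pw_trig F C x0 h; use Mx in simp)+
    qed
    have pr: "pw (2 * x) r (\<lambda>l. F l * G l)" if "pw x C F" "pw x C G" for F G
      unfolding r_def by (rule pw_prod[OF that C x0])
    have A: "rA x l = P.cth l x * Nq l + (Q.sth l x * Kp l + (Kp l * Nq l + (P.sth l x * Kq l + (Q.cth l x * Np l + Np l * Kq l))))" for l
      by (simp add: rA_def Kp_def Kq_def Np_def Nq_def algebra_simps)
    have B: "rB x l = P.sth l x * Nq l + (Q.sth l x * Np l + Np l * Nq l)" for l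
      by (simp add: rB_def Np_def Nq_def algebra_simps)
    have D: "rC x l = Q.sth l x * Yp l + Yp l * Nq l" for l
      by (simp add: rC_def Yp_def Nq_def algebra_simps)
    have uK: "pw (2 * x) K F" if "pw (2 * x) D F" "D \<le> K" for D F
      by (rule pw_mono[OF that(1) order_refl that(2)]) (use tr in \<open>simp add: K_def\<close>)
    have "pw (2 * x) (t + (t + (r + (t + (t + r))))) (\<lambda>l. rA x l)"
      unfolding A by (intro pw_add tc pr N)
    moreover have "pw (2 * x) (t + (t + r)) (\<lambda>l. rB x l)"
      unfolding B by (intro pw_add tc pr N)
    moreover have "pw (2 * x) (t + r) (\<lambda>l. rC x l)"
      unfolding D by (intro pw_add tc pr N)
    ultimately show ?thesis
      by (intro conjI) (erule uK, use tr in \<open>simp add: K_def\<close>)+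
  qed
  then show ?thesis using that[of K] tr by (simp add: K_def)
qed

end

lemma sq_int_cmod:
  assumes "sq_int a b f"
  shows "sq_int a b (\<lambda>x. complex_of_real (cmod (f x)))"
proof -
  have [measurable]: "f \<in> borel_measurable (lebesgue_on {a..b})" using assms by (simp add: sq_int_def)
  have "(\<lambda>x. complex_of_real (cmod (f x))) \<in> borel_measurable (lebesgue_on {a..b})" by measurable
  then show ?thesis by (rule sq_int_bound(1)[OF assms]) simp
qed

context pencil_pair
begin

lemma sq_hp: "sq_int 0 pi hp" and sq_hm: "sq_int 0 pi hm"
proof -
  have "sq_int 0 pi (\<lambda>x. ((1 / (2 * \<i>)) * g1 x - (1 / 2) * g2 x) * (P.em x * Q.em x))"
    "sq_int 0 pi (\<lambda>x. ((- 1 / (2 * \<i>)) * g1 x - (1 / 2) * g2 x) * (P.ep x * Q.ep x))"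
    by (intro sq_int_times_continuous sq_int_diff sq_int_cmult sq_g1 sq_g2 continuous_on_mult
        P.continuous_ep P.continuous_em Q.continuous_ep Q.continuous_em)+
  then show "sq_int 0 pi hp" "sq_int 0 pi hm" by (simp_all add: hp_def[abs_def] hm_def[abs_def])
qed

text \<open>The linear map from \<open>(g1, g2)\<close> to \<open>(hp, hm)\<close> is inverted
  pointwise: after division by the phases, the sum of \<open>hp\<close> and \<open>hm\<close> gives
  \<open>g2\<close> and their difference gives \<open>g1\<close>.\<close>

lemma g_le_h:
  assumes M: "M \<ge> 1" "cmod (P.ep x) \<le> M \<and> cmod (P.em x) \<le> M \<and> cmod (Q.ep x) \<le> M \<and> cmod (Q.em x) \<le> M"
  shows "cmod (g1 x) + cmod (g2 x) \<le> 2 * M\<^sup>2 * (cmod (hp x) + cmod (hm x))"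
proof -
  have d: "w / (2 * \<i>) = (- \<i> / 2) * w" for w by (simp add: field_simps)
  have e: "(P.ep x * Q.ep x) * (P.em x * Q.em x) = 1" "(P.em x * Q.em x) * (P.ep x * Q.ep x) = 1"
  proof -
    have "(P.ep x * Q.ep x) * (P.em x * Q.em x) = (P.ep x * P.em x) * (Q.ep x * Q.em x)" by (simp only: mult_ac)
    then show "(P.ep x * Q.ep x) * (P.em x * Q.em x) = 1" by simp
    then show "(P.em x * Q.em x) * (P.ep x * Q.ep x) = 1" by (simp only: mult.commute)
  qed
  have "(P.ep x * Q.ep x) * hp x = (g1 x / (2 * \<i>) - g2 x / 2) * ((P.em x * Q.em x) * (P.ep x * Q.ep x))"
    unfolding hp_def by (simp only: mult_ac)
  then have hp: "(P.ep x * Q.ep x) * hp x = g1 x / (2 * \<i>) - g2 x / 2" unfolding e by simp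
  have "(P.em x * Q.em x) * hm x = (- g1 x / (2 * \<i>) - g2 x / 2) * ((P.ep x * Q.ep x) * (P.em x * Q.em x))"
    unfolding hm_def by (simp only: mult_ac)
  then have hm: "(P.em x * Q.em x) * hm x = - g1 x / (2 * \<i>) - g2 x / 2" unfolding e by simp
  have b: "cmod (P.ep x * Q.ep x) \<le> M\<^sup>2" "cmod (P.em x * Q.em x) \<le> M\<^sup>2"
    using M unfolding norm_mult power2_eq_square by (auto intro!: mult_mono)
  have n: "cmod ((P.ep x * Q.ep x) * hp x) \<le> M\<^sup>2 * cmod (hp x)" "cmod ((P.em x * Q.em x) * hm x) \<le> M\<^sup>2 * cmod (hm x)"
    using b by (auto simp: norm_mult intro!: mult_right_mono)
  have "g2 x = - ((P.ep x * Q.ep x) * hp x + (P.em x * Q.em x) * hm x)" unfolding hp hm by simp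
  then have "cmod (g2 x) = cmod ((P.ep x * Q.ep x) * hp x + (P.em x * Q.em x) * hm x)" by (simp only: norm_minus_cancel)
  then have 1: "cmod (g2 x) \<le> M\<^sup>2 * cmod (hp x) + M\<^sup>2 * cmod (hm x)"
    using norm_triangle_ineq[of "(P.ep x * Q.ep x) * hp x" "(P.em x * Q.em x) * hm x"] n by linarith
  have "g1 x = \<i> * ((P.ep x * Q.ep x) * hp x - (P.em x * Q.em x) * hm x)" unfolding hp hm d by (simp add: algebra_simps)
  then have "cmod (g1 x) = cmod ((P.ep x * Q.ep x) * hp x - (P.em x * Q.em x) * hm x)" by (metis norm_mult norm_ii mult_1)
  then have 2: "cmod (g1 x) \<le> M\<^sup>2 * cmod (hp x) + M\<^sup>2 * cmod (hm x)"
    using norm_triangle_ineq4[of "(P.ep x * Q.ep x) * hp x" "(P.em x * Q.em x) * hm x"] n by linarith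
  show ?thesis using 1 2 by (simp add: algebra_simps)
qed

text \<open>For exponential sums the vanishing integral of \<open>l * W' l\<close> says that the
  integrals of \<open>S\<close> and \<open>R\<close> are opposite, where the remainder
  \<open>R\<close> at \<open>x\<close> is bounded by the L2 norm of the sum on
  \<open>(-x, x)\<close>. This is the hypothesis of \<open>volterra_uniqueness\<close> for
  \<open>hp\<close>, \<open>hm\<close>.\<close>

theorem potentials_equal:
  assumes bd: "\<And>l. P.y1sol l pi = c * Q.y1sol l pi" "\<And>l. l * P.ysol l pi = c * (l * Q.ysol l pi)"
    and dense: "\<And>g e. sq_int (-pi) pi g \<Longrightarrow> e > 0 \<Longrightarrow> \<exists>n c l. l2norm (-pi) pi (\<lambda>t. g t - esum n c l t) < e"
  shows "l2norm 0 pi g1 = 0 \<and> l2norm 0 pi g2 = 0"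
proof -
  obtain K where K: "K \<ge> 0" "\<And>x. x \<in> {0..pi} \<Longrightarrow> pw (2 * x) K (rA x) \<and> pw (2 * x) K (rB x) \<and> pw (2 * x) K (rC x)"
    by (rule remainder_pw) blast
  obtain M where M: "M \<ge> 1"
    "\<And>x. x \<in> {0..pi} \<Longrightarrow> cmod (P.ep x) \<le> M \<and> cmod (P.em x) \<le> M \<and> cmod (Q.ep x) \<le> M \<and> cmod (Q.em x) \<le> M"
    by (rule exponents_bounded) blast
  define \<rho> where "\<rho> = (\<lambda>x. complex_of_real (1 + cmod (\<sigma> x + \<sigma>t x)))"
  \<comment> \<open>The factor \<open>2\<close> is the weight of \<open>g2\<close> in
    \<open>R\<close>, \<open>K\<close> comes from \<open>remainder_pw\<close>,
    \<open>2 * M\<^sup>2\<close> from \<open>g_le_h\<close> and \<open>sqrt 2\<close> from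
    \<open>l2norm_esum_half\<close>.\<close>
  define L where "L = 2 * K * (2 * M\<^sup>2) * sqrt 2"
  have L: "L \<ge> 0" using K(1) M(1) by (simp add: L_def)
  define \<kappa> where "\<kappa> = (\<lambda>x. L * ((cmod (hp x) + cmod (hm x)) * cmod (\<rho> x)))"
  have sq_ss: "sq_int 0 pi (\<lambda>x. \<sigma> x + \<sigma>t x)" by (intro sq_int_add P.sq_\<sigma> Q.sq_\<sigma>)
  have \<rho>: "sq_int 0 pi \<rho>"
  proof -
    have "sq_int 0 pi (\<lambda>x. complex_of_real (cmod (\<sigma> x + \<sigma>t x)))" by (rule sq_int_cmod[OF sq_ss])
    from sq_int_add[OF sq_int_continuous[OF continuous_on_const[of _ 1]] this] show ?thesis by (simp add: \<rho>_def)
  qed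
  have \<kappa>i: "\<kappa> integrable_on {a..b}" if "0 \<le> a" "b \<le> pi" for a b
  proof -
    have "(\<lambda>x. L * (cmod (hp x) * cmod (\<rho> x) + cmod (hm x) * cmod (\<rho> x))) integrable_on {a..b}"
      using sq_int_subinterval(1)[OF sq_hp that] sq_int_subinterval(1)[OF sq_hm that] sq_int_subinterval(1)[OF \<rho> that]
      by (intro integrable_on_mult_right integrable_add sq_int_norm_mult(2))
    then show ?thesis by (simp add: \<kappa>_def distrib_right)
  qed
  \<comment> \<open>The Wronskian vanishes at \<open>0\<close> by the initial values and, multiplied
    by \<open>l\<close>, at \<open>pi\<close> by proportionality of the boundary values.\<close>
  have W0: "((\<lambda>x. l * W' l x) has_integral 0) {0..pi}" for l
  proof -
    have "P.y1sol l pi * (l * Q.ysol l pi) = (l * P.ysol l pi) * Q.y1sol l pi"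
      unfolding bd[of l] by simp
    then have e: "l * ((P.y1sol l pi * Q.ysol l pi + (-1) * (P.ysol l pi * Q.y1sol l pi)) - (P.y1sol l 0 * Q.ysol l 0 + (-1) * (P.ysol l 0 * Q.y1sol l 0))) = 0"
      by (simp add: P.ysol_0 Q.ysol_0 algebra_simps)
    show ?thesis
      by (rule has_integral_eq_rhs[OF has_integral_mult_right[OF ac_deriv_has_integral[OF wronskian pi_ge_zero]] e[symmetric]])
  qed
  have main: "cmod (integral {0..pi} (\<lambda>x. hp x * esum n d l x + hm x * esum n d l (-x))) \<le>
        l2norm (-a) a (esum n d l) * integral {0..a} \<kappa> + l2norm (-pi) pi (esum n d l) * integral {a..pi} \<kappa>"
    if a: "a \<in> {0..pi}" for a n d l
  proof -
    \<comment> \<open>\<open>hp\<close> and \<open>hm\<close> multiply exponentials in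
      \<open>2 * x\<close>; half frequencies turn these into the given sum at \<open>x\<close> and
      at \<open>-x\<close>.\<close>
    define l' where "l' = (\<lambda>j. l j / 2)"
    have es: "esum n d l x = (\<Sum>j<n. d j * exp (\<i> * l' j * of_real (2 * x)))" for x
    proof -
      have "\<i> * l' j * of_real (2 * x) = \<i> * l j * of_real x" for j by (simp add: l'_def)
      then show ?thesis by (simp only: esum_def)
    qed
    define R where "R = (\<lambda>x. g1 x * (\<Sum>j<n. d j * rA x (l' j)) + (g1 x * (\<sigma> x + \<sigma>t x)) * (\<Sum>j<n. d j * rC x (l' j))
       + (2 * g2 x) * (\<Sum>j<n. d j * rB x (l' j)))"
    define S where "S = (\<lambda>x. hp x * esum n d l x + hm x * esum n d l (-x))"
    have sum: "(\<Sum>j<n. d j * (l' j * W' (l' j) x)) = S x + (\<Sum>j<n. d j) * T x + R x" for x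
    proof -
      have "(\<Sum>j<n. d j * (l' j * W' (l' j) x)) = (\<Sum>j<n. hp x * (d j * exp (\<i> * l' j * of_real (2 * x))) + hm x * (d j * exp (\<i> * l' j * of_real (2 * (- x))))
         + d j * T x + (g1 x * (d j * rA x (l' j)) + (g1 x * (\<sigma> x + \<sigma>t x)) * (d j * rC x (l' j)) + (2 * g2 x) * (d j * rB x (l' j))))"
        unfolding W'_decomposition by (rule sum.cong) (simp_all add: algebra_simps)
      then show ?thesis
        unfolding S_def R_def es by (simp only: sum.distrib sum_distrib_left sum_distrib_right)
    qed
    have "((\<lambda>x. \<Sum>j<n. d j * (l' j * W' (l' j) x)) has_integral (\<Sum>j<n. d j * 0)) {0..pi}"
      by (intro has_integral_sum has_integral_mult_right W0) simp
    then have I: "((\<lambda>x. S x + (\<Sum>j<n. d j) * T x + R x) has_integral 0) {0..pi}" unfolding sum by simp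
    have Si: "S integrable_on {0..pi}"
    proof -
      have "(\<lambda>x. hp x * esum n d l x) absolutely_integrable_on {0..pi}" "(\<lambda>x. hm x * esum n d l ((-1) * x + 0)) absolutely_integrable_on {0..pi}"
        by (intro sq_int_norm_mult(1) sq_hp sq_hm sq_int_esum sq_int_compose_affine continuous_esum)+
      then show ?thesis unfolding S_def by (intro integrable_add) (simp_all add: absolutely_integrable_on_def)
    qed
    \<comment> \<open>The factor of \<open>T\<close> does not depend on \<open>x\<close>, and
      \<open>T\<close> has integral \<open>0\<close>, so this term drops out.\<close>
    have "((\<lambda>x. (S x + (\<Sum>j<n. d j) * T x + R x) - S x - (\<Sum>j<n. d j) * T x) has_integral (0 - integral {0..pi} S - (\<Sum>j<n. d j) * 0)) {0..pi}"
      by (intro has_integral_diff has_integral_mult_right T_integral I integrable_integral Si)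
    then have R: "(R has_integral (- integral {0..pi} S)) {0..pi}" by (simp add: algebra_simps)
    have Ri: "R integrable_on {0..pi}" using R by (rule has_integral_integrable)
    \<comment> \<open>The parameter \<open>b\<close> lets one norm serve a whole interval:
      \<open>b = a\<close> on \<open>[0, a]\<close> and \<open>b = pi\<close> on
      \<open>[a, pi]\<close>.\<close>
    have Rb: "cmod (R x) \<le> \<kappa> x * l2norm (-b) b (esum n d l)" if x: "x \<in> {0..pi}" and b: "x \<le> b" for x b
    proof -
      define N where "N = l2norm (- (2 * x)) (2 * x) (esum n d l')"
      have N: "N \<ge> 0" by (simp add: N_def l2norm_nonneg)
      have s: "cmod (\<Sum>j<n. d j * rA x (l' j)) \<le> K * N" "cmod (\<Sum>j<n. d j * rB x (l' j)) \<le> K * N" "cmod (\<Sum>j<n. d j * rC x (l' j)) \<le> K * N"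
        unfolding N_def using K(2)[OF x] by (auto intro: pwD)
      have "cmod (R x) \<le> cmod (g1 x) * (K * N) + (cmod (g1 x) * cmod (\<sigma> x + \<sigma>t x)) * (K * N) + (2 * cmod (g2 x)) * (K * N)"
        unfolding R_def
        by (intro order_trans[OF norm_triangle_ineq] add_mono) (auto simp: norm_mult intro!: mult_left_mono s)
      also have "\<dots> = (cmod (g1 x) * (1 + cmod (\<sigma> x + \<sigma>t x)) + 2 * cmod (g2 x)) * (K * N)" by (simp add: algebra_simps)
      also have "\<dots> \<le> (2 * (cmod (g1 x) + cmod (g2 x)) * (1 + cmod (\<sigma> x + \<sigma>t x))) * (K * N)"
      proof (rule mult_right_mono)
        have "cmod (g1 x) * (1 + cmod (\<sigma> x + \<sigma>t x)) \<le> 2 * cmod (g1 x) * (1 + cmod (\<sigma> x + \<sigma>t x))"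
          by (intro mult_right_mono) auto
        moreover have "2 * cmod (g2 x) * 1 \<le> 2 * cmod (g2 x) * (1 + cmod (\<sigma> x + \<sigma>t x))"
          by (intro mult_left_mono) auto
        ultimately show "cmod (g1 x) * (1 + cmod (\<sigma> x + \<sigma>t x)) + 2 * cmod (g2 x) \<le> 2 * (cmod (g1 x) + cmod (g2 x)) * (1 + cmod (\<sigma> x + \<sigma>t x))"
          by (simp add: algebra_simps)
      qed (use K(1) N in simp)
      also have "\<dots> \<le> (2 * (2 * M\<^sup>2 * (cmod (hp x) + cmod (hm x))) * (1 + cmod (\<sigma> x + \<sigma>t x))) * (K * N)"
        using g_le_h[OF M(1) M(2)[OF x]] K(1) N by (intro mult_right_mono mult_left_mono) auto
      also have "N \<le> sqrt 2 * l2norm (-b) b (esum n d l)"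
        unfolding N_def l'_def
        using l2norm_esum_half[of x n d l] sq_int_subinterval(2)[OF sq_int_esum[of "-b" b n d l], of "-x" x] x b by simp
      finally have "cmod (R x) \<le> (2 * (2 * M\<^sup>2 * (cmod (hp x) + cmod (hm x))) * (1 + cmod (\<sigma> x + \<sigma>t x))) * (K * (sqrt 2 * l2norm (-b) b (esum n d l)))"
        using K(1) by (simp add: mult_left_mono)
      also have "\<dots> = \<kappa> x * l2norm (-b) b (esum n d l)"
      proof -
        have "cmod (\<rho> x) = 1 + cmod (\<sigma> x + \<sigma>t x)" unfolding \<rho>_def norm_of_real by simp
        then show ?thesis unfolding \<kappa>_def L_def by (simp only: mult_ac)
      qed
      finally show ?thesis .
    qed
    have part: "cmod (integral {u..v} R) \<le> l2norm (-v) v (esum n d l) * integral {u..v} \<kappa>" if uv: "0 \<le> u" "v \<le> pi" for u v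
    proof -
      have "R integrable_on {u..v}" by (rule integrable_on_subinterval[OF Ri]) (use uv in auto)
      moreover have "(\<lambda>x. \<kappa> x * l2norm (-v) v (esum n d l)) integrable_on {u..v}"
        using \<kappa>i[OF uv] by (rule integrable_on_mult_left)
      ultimately have "cmod (integral {u..v} R) \<le> integral {u..v} (\<lambda>x. \<kappa> x * l2norm (-v) v (esum n d l))"
        by (rule Henstock_Kurzweil_Integration.integral_norm_bound_integral) (use uv Rb in auto)
      then show ?thesis by (simp add: mult.commute)
    qed
    have "integral {0..pi} S = - (integral {0..a} R + integral {a..pi} R)"
      using Henstock_Kurzweil_Integration.integral_combine[OF _ _ Ri, of a] a integral_unique[OF R] by simp
    then have "cmod (integral {0..pi} S) \<le> cmod (integral {0..a} R) + cmod (integral {a..pi} R)"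
      by (simp only: norm_minus_cancel norm_triangle_ineq)
    also have "\<dots> \<le> l2norm (-a) a (esum n d l) * integral {0..a} \<kappa> + l2norm (-pi) pi (esum n d l) * integral {a..pi} \<kappa>"
      by (intro add_mono part) (use a in auto)
    finally show ?thesis by (simp only: S_def)
  qed
  have h0: "l2norm 0 pi hp = 0" "l2norm 0 pi hm = 0"
    using volterra_uniqueness[OF sq_hp sq_hm \<rho> L dense main[unfolded \<kappa>_def]] by blast+
  have le: "cmod (g1 x) \<le> cmod (complex_of_real (2 * M\<^sup>2) * (of_real (cmod (hp x)) + of_real (cmod (hm x))))"
    "cmod (g2 x) \<le> cmod (complex_of_real (2 * M\<^sup>2) * (of_real (cmod (hp x)) + of_real (cmod (hm x))))" if x: "x \<in> {0..pi}" for x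
  proof -
    have "cmod (complex_of_real (2 * M\<^sup>2) * (of_real (cmod (hp x)) + of_real (cmod (hm x)))) = 2 * M\<^sup>2 * (cmod (hp x) + cmod (hm x))"
      unfolding of_real_add[symmetric] norm_mult norm_of_real by simp
    then show "cmod (g1 x) \<le> cmod (complex_of_real (2 * M\<^sup>2) * (of_real (cmod (hp x)) + of_real (cmod (hm x))))"
      "cmod (g2 x) \<le> cmod (complex_of_real (2 * M\<^sup>2) * (of_real (cmod (hp x)) + of_real (cmod (hm x))))"
      using g_le_h[OF M(1) M(2)[OF x]] norm_ge_zero[of "g1 x"] norm_ge_zero[of "g2 x"] by linarith+
  qed
  note sqn = sq_int_cmod
  have nn: "l2norm 0 pi (\<lambda>x. complex_of_real (cmod (f x))) = l2norm 0 pi f" for f by (simp add: l2norm_def)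
  define G where "G = (\<lambda>x. complex_of_real (2 * M\<^sup>2) * (of_real (cmod (hp x)) + of_real (cmod (hm x))))"
  have G: "sq_int 0 pi G" unfolding G_def by (intro sq_int_cmult sq_int_add sqn sq_hp sq_hm)
  have "l2norm 0 pi (\<lambda>x. complex_of_real (cmod (hp x)) + of_real (cmod (hm x))) \<le> 0"
    using l2norm_triangle[OF sqn[OF sq_hp] sqn[OF sq_hm]] by (simp add: nn h0)
  then have "l2norm 0 pi G = 0"
    unfolding G_def using sq_int_cmult(2)[OF sq_int_add[OF sqn[OF sq_hp] sqn[OF sq_hm]]] l2norm_nonneg by (simp add: order_antisym)
  moreover have "l2norm 0 pi g1 \<le> l2norm 0 pi G" "l2norm 0 pi g2 \<le> l2norm 0 pi G"
    using sq_int_bound(2)[OF G, of g1] sq_int_bound(2)[OF G, of g2] sq_g1 sq_g2 le by (auto simp: sq_int_def G_def)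
  ultimately show ?thesis using l2norm_nonneg[of 0 pi g1] l2norm_nonneg[of 0 pi g2] by auto
qed

end

lemma (in pencil) omega0_eq: "th pi = of_real pi * omega0 p"
proof -
  have "p absolutely_integrable_on {0<..<pi}"
    using abs_int_p absolutely_integrable_on_Icc_iff_Ioo by blast
  then have "integrable (lebesgue_on {0<..<pi}) p"
    by (simp add: set_integrable_def integrable_restrict_space)
  from lebesgue_integral_eq_integral[OF this]
  have "(LINT s|lebesgue_on {0<..<pi}. p s) = th pi"
    by (simp add: th_def integral_open_interval_real)
  then show ?thesis by (simp add: omega0_def)
qed

lemma (in pencil) char_fun_eq: "char_fun f1 f2 p \<sigma> = (\<lambda>z. f1 z * y1sol z pi + f2 z * ysol z pi)"
  by (simp add: fun_eq_iff char_fun_def S_sol_eq S_quasi_eq)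

theorem theorem1:
  fixes f1 f2 :: "complex \<Rightarrow> complex"
    and p \<sigma> pt \<sigma>t :: "real \<Rightarrow> complex"
    and lam lamt :: "nat \<Rightarrow> complex"
  assumes "f1 holomorphic_on UNIV" and "f2 holomorphic_on UNIV"
    and "L2_on 0 pi p" and "L2_on 0 pi \<sigma>"
    and "L2_on 0 pi pt" and "L2_on 0 pi \<sigma>t"
    and "lam 0 = 0" and "equal_values_consecutive lam"
    and "lamt 0 = 0" and "equal_values_consecutive lamt"
    and "subspectrum f1 f2 p \<sigma> lam"
    and "subspectrum f1 f2 pt \<sigma>t lamt"
    and "complete_in_H (v_seq f1 f2 lam)"
    and "\<forall>n\<ge>1. lam n = lamt n"
    and "omega0 p - omega0 pt \<in> \<int>"
  shows "(AE x in lebesgue_on {0<..<pi}. p x = pt x) \<and>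
         (AE x in lebesgue_on {0<..<pi}. \<sigma> x = \<sigma>t x)"
proof -
  interpret P: pencil p \<sigma> using assms by unfold_locales
  interpret Q: pencil pt \<sigma>t using assms by unfold_locales
  \<comment> \<open>The sequences agree at index \<open>0\<close> too, where both carry the value
    \<open>0\<close> by convention.\<close>
  have lamt: "lamt = lam"
  proof
    fix n show "lamt n = lam n" using assms(7,9,14) by (cases "n = 0") auto
  qed
  obtain k where k: "omega0 p - omega0 pt = of_int k" using assms(15) by (elim Ints_cases)
  define c where "c = exp (\<i> * (of_real pi * of_int k))"
  have th: "P.th pi = Q.th pi + of_real pi * of_int k"
    unfolding P.omega0_eq Q.omega0_eq k[symmetric] by (simp add: algebra_simps)
  have ep: "P.ep pi = c * Q.ep pi"
    unfolding P.ep_def Q.ep_def th c_def by (simp add: algebra_simps flip: exp_add)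
  \<comment> \<open>\<open>c\<close> is its own inverse because \<open>k\<close> is an integer. So
    \<open>em\<close>, which acquires the inverse factor, satisfies the same relation as
    \<open>ep\<close>.\<close>
  have "exp (- \<i> * (of_real pi * of_int k)) = c"
  proof -
    have "c * c = 1"
      unfolding c_def exp_add[symmetric] using exp_integer_2pi[of "of_int k"] by (simp add: algebra_simps)
    moreover have "c * exp (- \<i> * (of_real pi * of_int k)) = 1" unfolding c_def by (simp flip: exp_add)
    ultimately show ?thesis by (metis mult.left_commute mult.right_neutral)
  qed
  then have em: "P.em pi = c * Q.em pi"
    unfolding P.em_def Q.em_def th distrib_left exp_add by (simp only: mult.commute)
  interpret pencil_pair p \<sigma> pt \<sigma>t c
    using ep em by unfold_locales
  define D1 where "D1 = (\<lambda>l. P.y1sol l pi - c * Q.y1sol l pi)"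
  define D2 where "D2 = (\<lambda>l. l * P.ysol l pi - c * (l * Q.ysol l pi))"
  have pi: "pi \<in> {0..pi}" by simp
  have hol: "D1 holomorphic_on UNIV" "D2 holomorphic_on UNIV"
    unfolding D1_def D2_def by (intro holomorphic_intros P.ysol_holomorphic Q.ysol_holomorphic pi)+
  define \<Delta> where "\<Delta> = char_fun f1 f2 p \<sigma>"
  define \<Delta>t where "\<Delta>t = char_fun f1 f2 pt \<sigma>t"
  have hol\<Delta>: "\<Delta> holomorphic_on UNIV" "\<Delta>t holomorphic_on UNIV"
    unfolding \<Delta>_def \<Delta>t_def P.char_fun_eq Q.char_fun_eq
    by (intro holomorphic_intros P.ysol_holomorphic Q.ysol_holomorphic pi assms(1,2))+
  have sub: "ecard {j. 1 \<le> j \<and> lam j = lam k} \<le> zero_mult \<Delta> (lam k)" "ecard {j. 1 \<le> j \<and> lam j = lam k} \<le> zero_mult \<Delta>t (lam k)" if "k \<ge> 1" for k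
    using assms(11,12) that unfolding lamt subspectrum_def \<Delta>_def \<Delta>t_def by auto
  obtain C where C: "C \<ge> 0" "pw pi C D1" "pw pi C D2"
    using boundary_pw unfolding D1_def D2_def by blast
  have zero: "(deriv ^^ (k - (LEAST n. lam n = lam k))) (\<lambda>w. (w * f1 w) * D1 w + f2 w * D2 w) (lam k) = 0" if k: "k \<ge> 1" for k
  proof -
    \<comment> \<open>The common factors \<open>f1\<close>, \<open>f2\<close> combine the boundary
      differences into the two characteristic functions, each multiplied by \<open>w\<close>; both
      products have the required zero at \<open>lam k\<close>.\<close>
    have e: "(\<lambda>w. (w * f1 w) * D1 w + f2 w * D2 w) = (\<lambda>w. w * \<Delta> w + (- c) * (w * \<Delta>t w))"
      by (simp add: fun_eq_iff D1_def D2_def \<Delta>_def \<Delta>t_def P.char_fun_eq Q.char_fun_eq algebra_simps)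
    let ?n = "k - (LEAST n. lam n = lam k)"
    have hw: "(\<lambda>w. w * \<Delta> w) holomorphic_on UNIV" "(\<lambda>w. w * \<Delta>t w) holomorphic_on UNIV"
      using hol\<Delta> by (auto intro!: holomorphic_intros)
    have "(deriv ^^ ?n) (\<lambda>w. w * \<Delta> w + (- c) * (w * \<Delta>t w)) (lam k)
       = (deriv ^^ ?n) (\<lambda>w. w * \<Delta> w) (lam k) + (deriv ^^ ?n) (\<lambda>w. (- c) * (w * \<Delta>t w)) (lam k)"
      by (rule higher_deriv_add[of _ UNIV]) (use hw in \<open>auto intro!: holomorphic_intros\<close>)
    also have "(deriv ^^ ?n) (\<lambda>w. (- c) * (w * \<Delta>t w)) (lam k) = (- c) * (deriv ^^ ?n) (\<lambda>w. w * \<Delta>t w) (lam k)"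
      by (rule higher_deriv_cmult[of _ UNIV]) (use hw in auto)
    finally show ?thesis
      unfolding e
      using subspectrum_deriv_zero[OF hol\<Delta>(1) assms(7,8) sub(1)[OF k]] subspectrum_deriv_zero[OF hol\<Delta>(2) assms(7,8) sub(2)[OF k]]
      by simp
  qed
  have "D1 l = 0" "D2 l = 0" for l
    using complete_imp_zero[OF assms(1,2,13) hol C(2,3,1) zero, of l] by (simp_all add: D2_def)
  then have bd: "P.y1sol l pi = c * Q.y1sol l pi" "l * P.ysol l pi = c * (l * Q.ysol l pi)" for l
    by (simp_all add: D1_def D2_def)
  have "l2norm 0 pi g1 = 0 \<and> l2norm 0 pi g2 = 0"
    by (rule potentials_equal[OF bd exp_dense[OF assms(1,2,13)]])
  then have "AE x in lebesgue_on {0<..<pi}. g1 x = 0" "AE x in lebesgue_on {0<..<pi}. g2 x = 0"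
    using sq_int_l2n_zero_AE[OF sq_g1] sq_int_l2n_zero_AE[OF sq_g2] by auto
  then show ?thesis by (simp add: g1_def g2_def eq_commute[of "\<sigma>t _"])
qed

end
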